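(* Let $\Delta$ be a positive integer. If $k\geq \Delta/2$, then the \textsc{Directed Anchored $k$-Core} problem can be solved in time $2^{O(\Delta^3 b+\Delta^2 b p)}\cdot n^{O(1)}$ on $n$-vertex directed graphs of maximum degree at most $\Delta$. In particular, for such $k$ the problem is fixed-parameter tractable parameterized by $p+\Delta$.
   Context: Directed graphs are finite, without loops or multiple arcs; $d^-_G(v)$, $d^+_G(v)$ denote in- and out-degree, the degree of $v$ is $d^-_G(v)+d^+_G(v)$, and the maximum degree of $G$ is the maximum degree of its vertices; $G[U]$ is the induced subgraph. \textsc{Directed Anchored $k$-Core}: given a directed graph $G$ and integers $b,k,p$, decide whether there exist sets $A\subseteq H\subseteq V(G)$ with $|A|\leq b$, $|H|\geq p$ and $d^-_{G[H]}(v)\geq k$ for every $v\in H\setminus A$. One may assume $b\leq p$. *)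

theory Defs
  imports "Graph_Theory.Graph_Theory" Complex_Main
begin

section \<open>Digraphs and anchored cores\<close>

(* The inserted 0 only matters for the graph without vertices. *)
definition max_degree :: "('a, 'b) pre_digraph \<Rightarrow> nat" where
  "max_degree G = Max (insert 0 ((\<lambda>v. in_degree G v + out_degree G v) ` verts G))"

definition has_anchored_core :: "('a, 'b) pre_digraph \<Rightarrow> nat \<Rightarrow> nat \<Rightarrow> nat \<Rightarrow> bool" where
  "has_anchored_core G b k p \<longleftrightarrow>
     (\<exists>A H. A \<subseteq> H \<and> H \<subseteq> verts G \<and> card A \<le> b \<and> p \<le> card H \<and>
            (\<forall>v \<in> H - A. k \<le> in_degree (G \<restriction> H) v))"

(* Algorithms receive a digraph whose n vertices are numbered 0, ..., n - 1. *)
definition input_digraph :: "nat pair_pre_digraph \<Rightarrow> bool" where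
  "input_digraph G \<longleftrightarrow>
     digraph (with_proj G) \<and> verts (with_proj G) = {..<card (verts (with_proj G))}"


section \<open>Random access machines\<close>

text \<open>
  Running time is measured on a deterministic unit-cost random access machine whose arithmetic
  instructions are addition and (truncated) subtraction of natural numbers. There is no
  multiplication: together with unit cost it would break polynomial equivalence with
  Turing machines. A state consists of the registers and of the memory, which is accessed with
  indirect addressing. Control flow is structured instead of using jumps, which changes running
  times by a constant factor only.
\<close>

type_synonym ram_state = "(nat \<Rightarrow> nat) \<times> (nat \<Rightarrow> nat)"

datatype ram =
    Skip
  | Const nat nat        (* R i := c *)
  | Copy nat nat         (* R i := R j *)
  | Add nat nat nat      (* R i := R j + R l *)
  | Sub nat nat nat      (* R i := R j - R l, truncated at 0 *)
  | Load nat nat         (* R i := M (R j) *)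
  | Store nat nat        (* M (R i) := R j *)
  | Seq ram ram
  | IfNZ nat ram ram     (* if R i is nonzero then ... else ... *)
  | WhileNZ nat ram      (* while R i is nonzero do ... *)

(* exec P s t s': started in state s, P halts in state s' after exactly t steps.
   Instructions and tests take one step each. *)
inductive exec :: "ram \<Rightarrow> ram_state \<Rightarrow> nat \<Rightarrow> ram_state \<Rightarrow> bool" where
  Skip: "exec Skip s 1 s"
| Const: "exec (Const i c) (R, M) 1 (R(i := c), M)"
| Copy: "exec (Copy i j) (R, M) 1 (R(i := R j), M)"
| Add: "exec (Add i j l) (R, M) 1 (R(i := R j + R l), M)"
| Sub: "exec (Sub i j l) (R, M) 1 (R(i := R j - R l), M)"
| Load: "exec (Load i j) (R, M) 1 (R(i := M (R j)), M)"
| Store: "exec (Store i j) (R, M) 1 (R, M(R i := R j))"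
| Seq: "exec P s t s' \<Longrightarrow> exec Q s' u s'' \<Longrightarrow> exec (Seq P Q) s (t + u) s''"
| IfTrue: "R i \<noteq> 0 \<Longrightarrow> exec P (R, M) t s' \<Longrightarrow> exec (IfNZ i P Q) (R, M) (1 + t) s'"
| IfFalse: "R i = 0 \<Longrightarrow> exec Q (R, M) t s' \<Longrightarrow> exec (IfNZ i P Q) (R, M) (1 + t) s'"
| WhileTrue: "R i \<noteq> 0 \<Longrightarrow> exec P (R, M) t s' \<Longrightarrow> exec (WhileNZ i P) s' u s'' \<Longrightarrow>
    exec (WhileNZ i P) (R, M) (1 + t + u) s''"
| WhileFalse: "R i = 0 \<Longrightarrow> exec (WhileNZ i P) (R, M) 1 (R, M)"

inductive_cases exec_SkipE: "exec Skip s t s'"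
inductive_cases exec_ConstE: "exec (Const i c) s t s'"
inductive_cases exec_CopyE: "exec (Copy i j) s t s'"
inductive_cases exec_AddE: "exec (Add i j l) s t s'"
inductive_cases exec_SubE: "exec (Sub i j l) s t s'"
inductive_cases exec_LoadE: "exec (Load i j) s t s'"
inductive_cases exec_StoreE: "exec (Store i j) s t s'"
inductive_cases exec_SeqE: "exec (Seq P Q) s t s'"
inductive_cases exec_IfE: "exec (IfNZ i P Q) s t s'"
inductive_cases exec_WhileE: "exec (WhileNZ i P) s t s'"

lemma exec_deterministic:
  "exec P s t s' \<Longrightarrow> exec P s u s'' \<Longrightarrow> u = t \<and> s'' = s'"
proof (induction P s t s' arbitrary: u s'' rule: exec.induct)
  case (Seq P s t s' Q v sq)
  from Seq.prems obtain t1 s1 u1 where "exec P s t1 s1" "exec Q s1 u1 s''" "u = t1 + u1"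
    by (rule exec_SeqE)
  with Seq.IH show ?case by metis
next
  case (IfTrue R i P M t s' Q)
  from IfTrue.prems \<open>R i \<noteq> 0\<close> obtain t1 where "exec P (R, M) t1 s''" "u = 1 + t1"
    by (auto elim!: exec_IfE)
  with IfTrue.IH show ?case by metis
next
  case (IfFalse R i Q M t s' P)
  from IfFalse.prems \<open>R i = 0\<close> obtain t1 where "exec Q (R, M) t1 s''" "u = 1 + t1"
    by (auto elim!: exec_IfE)
  with IfFalse.IH show ?case by metis
next
  case (WhileTrue R i P M t s' v sq)
  from WhileTrue.prems obtain t1 s1 u1
    where "exec P (R, M) t1 s1" "exec (WhileNZ i P) s1 u1 s''" "u = 1 + t1 + u1"
    by (rule exec_WhileE) (use \<open>R i \<noteq> 0\<close> in simp_all)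
  with WhileTrue.IH show ?case by metis
next
  case (WhileFalse R i P M)
  from WhileFalse.prems show ?case
    by (rule exec_WhileE) (use \<open>R i = 0\<close> in simp_all)
qed (erule exec_SkipE exec_ConstE exec_CopyE exec_AddE exec_SubE exec_LoadE exec_StoreE; simp)+

definition init_state :: "nat list \<Rightarrow> ram_state" where
  "init_state xs = ((\<lambda>_. 0), (\<lambda>a. if a < length xs then xs ! a else 0))"

(* The output is read off register 0. *)
definition ram_outputs_within :: "ram \<Rightarrow> nat list \<Rightarrow> nat \<Rightarrow> nat \<Rightarrow> bool" where
  "ram_outputs_within P xs T y \<longleftrightarrow>
     (\<exists>t s. exec P (init_state xs) t s \<and> t \<le> T \<and> fst s 0 = y)"

definition ram_decides_within :: "ram \<Rightarrow> nat list \<Rightarrow> nat \<Rightarrow> bool \<Rightarrow> bool" where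
  "ram_decides_within P xs T Q \<longleftrightarrow> ram_outputs_within P xs T (if Q then 1 else 0)"

definition ram_computable :: "(nat \<Rightarrow> nat) \<Rightarrow> bool" where
  "ram_computable f \<longleftrightarrow> (\<exists>P. \<forall>x. \<exists>T. ram_outputs_within P [x] T (f x))"


section \<open>Fixed-parameter tractability\<close>

(* X: the admissible instances, Q: the yes-instances among them,
   enc: the encoding of instances as machine inputs, par: the parameter. *)
definition fpt :: "'i set \<Rightarrow> ('i \<Rightarrow> bool) \<Rightarrow> ('i \<Rightarrow> nat list) \<Rightarrow> ('i \<Rightarrow> nat) \<Rightarrow> bool" where
  "fpt X Q enc par \<longleftrightarrow>
     (\<exists>P f c. ram_computable f \<and>
        (\<forall>x \<in> X. ram_decides_within P (enc x) (f (par x) * length (enc x) ^ c) (Q x)))"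


section \<open>Input encoding\<close>

definition core_input :: "nat pair_pre_digraph \<Rightarrow> nat \<Rightarrow> nat \<Rightarrow> nat \<Rightarrow> nat list" where
  "core_input G b k p =
     (let n = card (verts (with_proj G))
      in [n, b, k, p] @
         [if (i, j) \<in> arcs_ends (with_proj G) then 1 else 0. i \<leftarrow> [0..<n], j \<leftarrow> [0..<n]])"

end

theory Submission
  imports Defs
begin

text \<open>
  For a set \<open>A\<close> of anchors the largest core is found by deleting vertices greedily, so it suffices
  to find \<open>A\<close>. If \<open>b \<ge> p\<close>, any \<open>p\<close> vertices form a solution. Otherwise the algorithm enumerates
  \<open>2^O(\<Delta>\<^sup>2 b p)\<close> guesses, each of which determines a candidate for \<open>A\<close>. Let \<open>H\<close> be a solution.

  If all components of \<open>H\<close> have fewer than \<open>p\<close> vertices, each component with anchors is described by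
  a starting vertex and \<open>O(p \<Delta>)\<close> bits, which steer an exploration and mark the anchors. Starting
  vertices are guessed by their rank among the vertices from which the same bits lead to a component
  with as many vertices and anchors. Such a component can replace the one in \<open>H\<close> unless it meets the
  rest of \<open>H\<close>, which excludes only \<open>2^O(p \<Delta>)\<close> starting vertices, so small ranks suffice.

  If \<open>H\<close> has a component with at least \<open>p\<close> vertices, a connected subset \<open>K\<close> of it with \<open>p\<close> vertices
  is guessed, and what remains is to enclose \<open>K\<close> in a set with few vertices of in-degree less than
  \<open>k\<close>. Among vertices of total in-degree at most \<open>k\<close> these are counted by a vertex cut. The
  vertices of larger total in-degree are ignored at first. When the least minimum cut contains such a
  vertex \<open>u\<close>, one guesses whether \<open>u \<in> H\<close>, and if so, which of its in-neighbours are in \<open>H\<close>; these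
  vertices join \<open>K\<close>. Since \<open>u\<close> belongs to every minimum cut, excluding it increases the size of the
  cut, which happens at most \<open>b\<close> times. Including it happens at most \<open>b (\<Delta> + 1)\<close> times, because
  \<open>k \<ge> \<Delta>/2\<close> implies that unanchored vertices of \<open>H\<close> receive at least as many arcs of \<open>H\<close> as they
  send, and strictly more if their total in-degree exceeds \<open>k\<close>.
\<close>

section \<open>Anchored cores\<close>

text \<open>The machine is deterministic, so a guess is an enumerated number whose digits answer
  questions asked adaptively. How many digits a run consumes depends on earlier answers. Codes are
  therefore built backwards: for every number \<open>X'\<close> to be left over there is a start
  \<open>X\<close> whose answers agree with the hidden solution, with
  \<open>Suc X \<le> Suc X' * 2 ^ m\<close> for \<open>m\<close> questions, a bound that multiplies
  along a run. Wrong guesses do no harm, since each candidate is verified before the answer is set.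
  If \<open>all_in v \<le> k\<close>, then having \<open>k\<close> in-neighbours in a set is a
  closure condition: \<open>all_in v = k\<close> and all in-neighbours are present. Cuts can express
  this. For larger in-degree it is a genuine threshold, which is what forces the queries.
  \<open>D\<close> will be the maximum degree plus one, so \<open>k \<ge> \<Delta>/2\<close> gives
  \<open>D \<le> 2 * k + 1\<close>. Guesses lie below \<open>2 ^ (16 * (b * (D * D * p)))\<close>:
  four numbers below \<open>2 ^ (4 * (D * D * p))\<close> for each of \<open>b\<close> components.
  This also leaves room for the \<open>b * (D + 1) * D + b\<close> bits of queries and the
  \<open>p * (D - 1)\<close> bits that select \<open>K\<close>.\<close>

locale loopfree_graph =
  fixes n :: nat and E :: "nat \<Rightarrow> nat \<Rightarrow> bool" and k :: nat and D :: nat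
  assumes E_less: "E u v \<Longrightarrow> u < n" "E u v \<Longrightarrow> v < n"
    and degree_less: "v < n \<Longrightarrow> card {u. E u v} + card {u. E v u} < D"
    and D_le: "D \<le> 2 * k + 1"
begin

definition indeg :: "nat set \<Rightarrow> nat \<Rightarrow> nat" where
  "indeg S v = card {u \<in> S. E u v}"

definition sol :: "nat set \<Rightarrow> nat set \<Rightarrow> bool" where
  "sol A H \<longleftrightarrow> A \<subseteq> H \<and> H \<subseteq> {..<n} \<and> (\<forall>v\<in>H - A. k \<le> indeg H v)"

definition adj :: "nat \<Rightarrow> nat \<Rightarrow> bool" where
  "adj u v \<longleftrightarrow> E u v \<or> E v u"

lemma finite_E [simp, intro]: "finite {u. E u v}" "finite {u. E v u}"
  by (rule finite_subset[of _ "{..<n}"], use E_less in auto)+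

lemma finite_adj [simp, intro]: "finite {u. adj v u}"
  unfolding adj_def Collect_disj_eq by simp

lemma finite_subset_V: "S \<subseteq> {..<n} \<Longrightarrow> finite S"
  by (rule finite_subset) auto

lemma adj_sym: "adj u v \<Longrightarrow> adj v u"
  by (auto simp: adj_def)

lemma adj_less: "adj u v \<Longrightarrow> u < n \<and> v < n"
  using E_less by (auto simp: adj_def)

lemma card_adj_less: "v < n \<Longrightarrow> card {u. adj v u} < D"
  using card_Un_le[of "{u. E v u}" "{u. E u v}"] degree_less[of v]
  by (simp add: adj_def Collect_disj_eq)

lemma indeg_mono: "S \<subseteq> T \<Longrightarrow> indeg S v \<le> indeg T v"
  unfolding indeg_def by (intro card_mono finite_subset[OF _ finite_E(1)[of v]]) auto

lemma sol_Un: "sol A H \<Longrightarrow> sol A' H' \<Longrightarrow> sol (A \<union> A') (H \<union> H')"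
  unfolding sol_def
  by (auto intro: order_trans[OF _ indeg_mono[of H "H \<union> H'"]] order_trans[OF _ indeg_mono[of H' "H \<union> H'"]])

abbreviation all_in :: "nat \<Rightarrow> nat" where "all_in \<equiv> indeg {..<n}"

lemma all_in_eq: "all_in v = card {u. E u v}"
  unfolding indeg_def by (rule arg_cong[of _ _ card]) (use E_less in auto)

lemma sum_indeg_eq_sum_outdeg:
  assumes "finite H"
  shows "(\<Sum>v\<in>H. card {u\<in>H. E u v}) = (\<Sum>v\<in>H. card {u\<in>H. E v u})"
proof -
  have "(\<Sum>v\<in>H. card {u\<in>H. E u v}) = (\<Sum>v\<in>H. \<Sum>u\<in>H. of_bool (E u v))"
    using assms by (simp add: sum.If_cases of_bool_def Int_def)
  also have "\<dots> = (\<Sum>u\<in>H. \<Sum>v\<in>H. of_bool (E u v))" by (rule sum.swap)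
  also have "\<dots> = (\<Sum>v\<in>H. card {u\<in>H. E v u})"
    using assms by (simp add: sum.If_cases of_bool_def Int_def)
  finally show ?thesis .
qed

text \<open>
  Every unanchored vertex of a solution has at least as many in-neighbours as out-neighbours in
  it, and strictly more if its total in-degree exceeds \<open>k\<close>; only anchors can compensate for that.
\<close>

lemma card_large_indegree_le:
  assumes "sol A H"
  shows "card {u \<in> H - A. k < all_in u} \<le> card A * D"
proof -
  have fin: "finite H" "finite A" "A \<subseteq> H" "H \<subseteq> {..<n}"
    using assms finite_subset_V[of H] finite_subset[of A H] by (auto simp: sol_def)
  let ?i = "\<lambda>v. card {u\<in>H. E u v}" and ?o = "\<lambda>v. card {u\<in>H. E v u}"
  \<comment> \<open>The total degree is at most \<open>2 * k\<close>. As
    \<open>all_in v \<ge> k\<close>, at most \<open>k\<close> out-neighbours remain, and at most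
    \<open>k - 1\<close> if \<open>all_in v > k\<close>, while \<open>k\<close> in-neighbours lie in
    \<open>H\<close>.\<close>
  have le: "?o v + of_bool (k < all_in v) \<le> ?i v" if "v \<in> H - A" for v
  proof -
    have "k \<le> ?i v" using assms that by (auto simp: sol_def indeg_def)
    moreover have "?i v \<le> card {u. E u v}" "?o v \<le> card {u. E v u}" by (auto intro!: card_mono)
    moreover have "card {u. E u v} + card {u. E v u} < D" using degree_less that fin by auto
    ultimately show ?thesis using D_le by (auto simp: all_in_eq of_bool_def)
  qed
  have "(\<Sum>v\<in>H - A. ?o v) + card {u \<in> H - A. k < all_in u} = (\<Sum>v\<in>H - A. ?o v + of_bool (k < all_in v))"
    using fin by (simp add: sum.distrib sum.If_cases of_bool_def Int_def)
  also have "\<dots> \<le> (\<Sum>v\<in>H - A. ?i v)" by (rule sum_mono) (rule le)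
  also have "\<dots> \<le> (\<Sum>v\<in>H. ?i v)" using fin by (intro sum_mono2) auto
  also have "\<dots> = (\<Sum>v\<in>H. ?o v)" by (rule sum_indeg_eq_sum_outdeg[OF fin(1)])
  also have "\<dots> = (\<Sum>v\<in>H - A. ?o v) + (\<Sum>v\<in>A. ?o v)" by (rule sum.subset_diff[OF fin(3,1)])
  finally have "card {u \<in> H - A. k < all_in u} \<le> (\<Sum>v\<in>A. ?o v)" by simp
  also have "\<dots> \<le> (\<Sum>v\<in>A. D)"
  proof (rule sum_mono)
    fix v assume "v \<in> A"
    have "?o v \<le> card {u. E v u}" by (auto intro!: card_mono)
    with degree_less[of v] fin \<open>v \<in> A\<close> show "?o v \<le> D" by auto
  qed
  finally show ?thesis by simp
qed


section \<open>Supersets of minimum cost and a potential that bounds the search\<close>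

subsection \<open>Large components\<close>

text \<open>Deficient members of total in-degree above \<open>k\<close> are free, so
  \<open>cost\<close> may underestimate the number of anchors as long as such members are
  unresolved.\<close>

definition cost :: "nat set \<Rightarrow> nat" where
  "cost H = card {w \<in> H. all_in w \<le> k \<and> indeg H w < k}"

definition feas :: "nat set \<Rightarrow> nat set \<Rightarrow> nat set \<Rightarrow> bool" where
  "feas K F H \<longleftrightarrow> K \<subseteq> H \<and> H \<subseteq> {..<n} \<and> H \<inter> F = {}"

definition least_opt :: "nat set \<Rightarrow> nat set \<Rightarrow> nat set \<Rightarrow> bool" where
  "least_opt K F X \<longleftrightarrow> feas K F X \<and> (\<forall>H. feas K F H \<longrightarrow> cost X \<le> cost H)
     \<and> (\<forall>H. feas K F H \<longrightarrow> cost H = cost X \<longrightarrow> X \<subseteq> H)"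

text \<open>Without a feasible set the \<open>LEAST\<close> is unspecified; the lemmas below
  therefore supply a feasible set.\<close>

definition min_cost :: "nat set \<Rightarrow> nat set \<Rightarrow> nat" where
  "min_cost K F = (LEAST m. \<exists>H. feas K F H \<and> cost H = m)"

lemma min_cost_le: "feas K F H \<Longrightarrow> min_cost K F \<le> cost H"
  unfolding min_cost_def by (rule Least_le) blast

lemma min_cost_attained:
  assumes "feas K F H"
  obtains H' where "feas K F H'" "cost H' = min_cost K F"
proof -
  have "\<exists>H'. feas K F H' \<and> cost H' = min_cost K F"
    unfolding min_cost_def by (rule LeastI_ex) (use assms in blast)
  then show ?thesis using that by blast
qed

lemma least_opt_cost: "least_opt K F X \<Longrightarrow> min_cost K F = cost X"
  unfolding least_opt_def
  by (metis le_antisym min_cost_attained min_cost_le)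

lemma min_cost_mono:
  assumes "feas K' F' H" "K \<subseteq> K'" "F \<subseteq> F'"
  shows "min_cost K F \<le> min_cost K' F'"
proof -
  obtain H' where H': "feas K' F' H'" "cost H' = min_cost K' F'" using min_cost_attained[OF assms(1)] .
  then have "feas K F H'" using assms(2,3) by (auto simp: feas_def)
  with H' show ?thesis using min_cost_le by metis
qed

lemma min_cost_forbid:
  assumes "least_opt K F X" "u \<in> X" "feas K (insert u F) H"
  shows "min_cost K F < min_cost K (insert u F)"
proof -
  obtain H' where H': "feas K (insert u F) H'" "cost H' = min_cost K (insert u F)"
    using min_cost_attained[OF assms(3)] .
  then have f: "feas K F H'" and "u \<notin> H'" by (auto simp: feas_def)
  then have "cost H' \<noteq> cost X" using assms(1,2) by (auto simp: least_opt_def)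
  moreover have "cost X \<le> cost H'" using assms(1) f by (auto simp: least_opt_def)
  ultimately show ?thesis using least_opt_cost[OF assms(1)] H'(2) by simp
qed

text \<open>
  A search state records known members \<open>K\<close>, known non-members \<open>F\<close>, and resolved vertices \<open>R\<close>,
  whose in-neighbours have been classified.
\<close>

definition good :: "nat set \<Rightarrow> nat set \<times> nat set \<times> nat set \<Rightarrow> bool" where
  "good H = (\<lambda>(K, F, R). K \<subseteq> H \<and> H \<inter> F = {} \<and> R \<subseteq> H \<and> (\<forall>u\<in>R. {r \<in> H. E r u} \<subseteq> K))"

definition unresolved :: "nat set \<times> nat set \<times> nat set \<Rightarrow> nat \<Rightarrow> bool" where
  "unresolved = (\<lambda>(K, F, R) u. u \<notin> F \<and> u \<notin> R \<and> k < all_in u)"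

text \<open>The transition under truthful answers, with \<open>H\<close> as the hidden solution.
  In-neighbours of \<open>u\<close> outside \<open>H\<close> are not put into \<open>F\<close>: an
  optimum that contains them only gains arcs.\<close>

definition advance :: "nat set \<Rightarrow> nat \<Rightarrow> nat set \<times> nat set \<times> nat set \<Rightarrow> nat set \<times> nat set \<times> nat set" where
  "advance H u = (\<lambda>(K, F, R). if u \<in> H then (insert u (K \<union> {r \<in> H. E r u}), F, insert u R) else (K, insert u F, R))"

text \<open>A bound on the bits that the remaining answers cost. Including \<open>u\<close> takes
  one bit for \<open>u\<close> and one per in-neighbour, at most \<open>D\<close> in all. Excluding
  \<open>u\<close> takes one bit and raises \<open>min_cost\<close>, which truthful answers keep at
  most \<open>b\<close>.\<close>

definition pot :: "nat \<Rightarrow> nat set \<Rightarrow> nat set \<times> nat set \<times> nat set \<Rightarrow> nat" where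
  "pot b H = (\<lambda>(K, F, R). card {u \<in> H - R. k < all_in u} * D + (b - min_cost K F))"

lemma cost_le_anchors:
  assumes "sol A H"
  shows "cost H \<le> card {w \<in> A. all_in w \<le> k}"
  unfolding cost_def
  by (rule card_mono) (use assms finite_subset[of A H] finite_subset_V[of H] in \<open>auto simp: sol_def not_le\<close>,
      meson DiffI leD)

lemma good_feas: "sol A H \<Longrightarrow> good H (K, F, R) \<Longrightarrow> feas K F H"
  by (auto simp: good_def feas_def sol_def)

lemma good_advance: "good H \<sigma> \<Longrightarrow> good H (advance H u \<sigma>)"
  by (cases \<sigma>) (auto simp: good_def advance_def)

lemma pot_advance:
  assumes "sol A H" "card A \<le> b" "good H (K, F, R)" "least_opt K F X" "u \<in> X" "unresolved (K, F, R) u"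
  shows "pot b H (advance H u (K, F, R)) + (if u \<in> H then D else 1) \<le> pot b H (K, F, R)"
proof (cases "u \<in> H")
  case True
  let ?K = "insert u (K \<union> {r \<in> H. E r u})"
  have g: "good H (?K, F, insert u R)" using good_advance[OF assms(3), of u] True by (simp add: advance_def)
  have mc: "min_cost K F \<le> min_cost ?K F" by (rule min_cost_mono[OF good_feas[OF assms(1) g]]) auto
  have "finite {u \<in> H - R. k < all_in u}" using assms(1) finite_subset_V[of H] by (auto simp: sol_def)
  moreover have "{v \<in> H - R. k < all_in v} = insert u {v \<in> H - insert u R. k < all_in v}"
    using True assms(6) by (auto simp: unresolved_def)
  ultimately have "card {v \<in> H - R. k < all_in v} = Suc (card {v \<in> H - insert u R. k < all_in v})"
    by simp
  then show ?thesis using True mc by (simp add: advance_def pot_def)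
next
  case False
  have g: "good H (K, insert u F, R)" using good_advance[OF assms(3), of u] False by (simp add: advance_def)
  have "min_cost K F < min_cost K (insert u F)"
    by (rule min_cost_forbid[OF assms(4,5) good_feas[OF assms(1) g]])
  \<comment> \<open>The truncated difference \<open>b - min_cost\<close> decreases strictly only if
    the increased minimum is still at most \<open>b\<close>. It is, because \<open>H\<close> remains
    feasible and costs no more than its anchors.\<close>
  moreover have "min_cost K (insert u F) \<le> b"
  proof -
    have "min_cost K (insert u F) \<le> cost H" by (rule min_cost_le[OF good_feas[OF assms(1) g]])
    also have "\<dots> \<le> card {w \<in> A. all_in w \<le> k}" by (rule cost_le_anchors[OF assms(1)])
    also have "\<dots> \<le> card A"
      using assms(1) finite_subset[of A H] finite_subset_V[of H] by (intro card_mono) (auto simp: sol_def)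
    finally show ?thesis using assms(2) by simp
  qed
  ultimately show ?thesis using False by (simp add: advance_def pot_def)
qed

lemma pot_le:
  assumes "sol A H" "card A \<le> b"
  shows "pot b H \<sigma> \<le> b * (D + 1) * D + b"
proof -
  obtain K F R where \<sigma>: "\<sigma> = (K, F, R)" by (cases \<sigma>)
  have fin: "finite A" "finite H" using assms finite_subset_V[of H] finite_subset[of A H] by (auto simp: sol_def)
  have "card {u \<in> H - R. k < all_in u} \<le> card ({u \<in> H - A. k < all_in u} \<union> A)"
    using fin by (intro card_mono) auto
  also have "\<dots> \<le> card A * D + card A"
    using card_large_indegree_le[OF assms(1)] card_Un_le[of "{u \<in> H - A. k < all_in u}" A] by simp
  also have "\<dots> = card A * (D + 1)" by simp
  also have "\<dots> \<le> b * (D + 1)" by (rule mult_le_mono1[OF assms(2)])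
  finally show ?thesis by (simp add: pot_def \<sigma> add_le_mono mult_le_mono1)
qed

text \<open>The deficient vertices of \<open>X\<close> split by total in-degree. The small ones
  number \<open>cost X \<le> cost H\<close>, hence at most the small anchors. A large one is
  resolved, so its in-neighbours in \<open>H\<close> belong to \<open>K\<close> and thus to
  \<open>X\<close>; it is then deficient in \<open>H\<close> as well and must be an anchor.\<close>

lemma resolved_opt_sol:
  assumes "sol A H" "good H (K, F, R)" "least_opt K F X" "\<And>u. u \<in> X \<Longrightarrow> \<not> unresolved (K, F, R) u"
  shows "sol {w \<in> X. indeg X w < k} X" "card {w \<in> X. indeg X w < k} \<le> card A" "K \<subseteq> X"
proof -
  have X: "feas K F X" using assms(3) by (simp add: least_opt_def)
  then show "sol {w \<in> X. indeg X w < k} X" by (auto simp: sol_def feas_def)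
  show "K \<subseteq> X" using X by (auto simp: feas_def)
  have fin: "finite A" "finite X" using assms(1) X finite_subset_V[of H] finite_subset[of A H] finite_subset_V[of X]
    by (auto simp: sol_def feas_def)
  have sub: "{w \<in> X. indeg X w < k} \<subseteq> {w \<in> X. all_in w \<le> k \<and> indeg X w < k} \<union> {w \<in> A. k < all_in w}"
  proof
    fix w assume w: "w \<in> {w \<in> X. indeg X w < k}"
    show "w \<in> {w \<in> X. all_in w \<le> k \<and> indeg X w < k} \<union> {w \<in> A. k < all_in w}"
    proof (cases "k < all_in w")
      case True
      then have "w \<in> R" using assms(4)[of w] w X by (auto simp: unresolved_def feas_def)
      then have "w \<in> H" "{r \<in> H. E r w} \<subseteq> K" using assms(2) by (auto simp: good_def)
      then have "{r \<in> H. E r w} \<subseteq> X" using X by (auto simp: feas_def)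
      then have "indeg H w \<le> indeg X w" unfolding indeg_def using fin by (intro card_mono) auto
      then have "\<not> k \<le> indeg H w" using w by simp
      then have "w \<in> A" using assms(1) \<open>w \<in> H\<close> by (auto simp: sol_def)
      then show ?thesis using True by simp
    qed (use w in auto)
  qed
  have "card {w \<in> X. indeg X w < k} \<le> cost X + card {w \<in> A. k < all_in w}"
    using card_mono[OF _ sub] card_Un_le[of "{w \<in> X. all_in w \<le> k \<and> indeg X w < k}" "{w \<in> A. k < all_in w}"] fin
    unfolding cost_def by simp
  also have "cost X \<le> cost H" using assms(3) good_feas[OF assms(1,2)] by (auto simp: least_opt_def)
  also have "cost H \<le> card {w \<in> A. all_in w \<le> k}" by (rule cost_le_anchors[OF assms(1)])
  also have "card {w \<in> A. all_in w \<le> k} + card {w \<in> A. k < all_in w} = card A"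
    using fin by (subst card_Un_disjoint[symmetric]) (auto intro!: arg_cong[of _ _ card])
  finally show "card {w \<in> X. indeg X w < k} \<le> card A" by simp
qed


section \<open>Balls in the underlying graph and connected sets coded by binary digits\<close>

subsection \<open>Exploration\<close>

text \<open>
  The binary digits of a number answer, lowest digit first, the question for each
  encountered vertex whether it belongs to the set being explored.
\<close>

definition estep :: "nat \<Rightarrow> nat \<Rightarrow> nat \<Rightarrow> nat list \<times> nat \<Rightarrow> nat list \<times> nat" where
  "estep p t w = (\<lambda>(Q, X). if t < length Q \<and> length Q < p \<and> w \<notin> set Q \<and> adj (Q ! t) w
     then (if odd X then Q @ [w] else Q, X div 2) else (Q, X))"

definition expl :: "nat \<Rightarrow> nat \<Rightarrow> nat \<Rightarrow> nat list \<times> nat" where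
  "expl p v X = fold (\<lambda>t. fold (estep p t) [0..<n]) [0..<p] ([v], X)"

definition mstep :: "nat list \<Rightarrow> nat \<Rightarrow> nat set \<times> nat \<Rightarrow> nat set \<times> nat" where
  "mstep Q t = (\<lambda>(S, X). if t < length Q then (if odd X then insert (Q ! t) S else S, X div 2) else (S, X))"

definition marks :: "nat \<Rightarrow> nat list \<Rightarrow> nat \<Rightarrow> nat set \<times> nat" where
  "marks p Q X = fold (mstep Q) [0..<p] ({}, X)"

definition piece :: "nat \<Rightarrow> nat \<Rightarrow> nat \<Rightarrow> nat list" where
  "piece p v M = fst (expl p v M)"

definition piece_anchors :: "nat \<Rightarrow> nat \<Rightarrow> nat \<Rightarrow> nat set" where
  "piece_anchors p v M = fst (marks p (piece p v M) (snd (expl p v M)))"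

text \<open>Reflexive, so that \<open>near ^^ i\<close> relates vertices at distance at most
  \<open>i\<close>.\<close>

definition near :: "(nat \<times> nat) set" where
  "near = {(x, y). x = y \<or> adj x y}"

lemma near_relpow_sym: "(x, y) \<in> near ^^ i \<Longrightarrow> (y, x) \<in> near ^^ i"
proof (induction i arbitrary: x y)
  case (Suc i)
  then obtain z where "(x, z) \<in> near ^^ i" "(z, y) \<in> near" by auto
  then have "(y, z) \<in> near" "(z, x) \<in> near ^^ i" using Suc.IH adj_sym by (auto simp: near_def)
  then show ?case by (metis relpow_Suc_I2)
qed auto

lemma near_relpow_mono: "i \<le> j \<Longrightarrow> (x, y) \<in> near ^^ i \<Longrightarrow> (x, y) \<in> near ^^ j"
proof (induction j)
  case (Suc j)
  then show ?case by (cases "i = Suc j") (auto simp: near_def intro: relcompI)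
qed auto

lemma card_near_relpow:
  assumes "S \<subseteq> {..<n}"
  shows "(near ^^ i) `` S \<subseteq> {..<n} \<and> card ((near ^^ i) `` S) \<le> card S * D ^ i"
proof (induction i)
  case 0
  then show ?case using assms by simp
next
  case (Suc i)
  let ?T = "(near ^^ i) `` S"
  have eq: "(near ^^ Suc i) `` S = (\<Union>x\<in>?T. near `` {x})" by auto
  \<comment> \<open>Fewer than \<open>D\<close> neighbours together with the vertex itself make at
    most \<open>D\<close>.\<close>
  have "near `` {x} \<subseteq> {..<n} \<and> card (near `` {x}) \<le> D" if "x < n" for x
  proof -
    have "near `` {x} = insert x {u. adj x u}" by (auto simp: near_def)
    moreover have "card (insert x {u. adj x u}) \<le> Suc (card {u. adj x u})" by (rule card_insert_le_m1) auto
    ultimately show ?thesis using card_adj_less[OF that] that adj_less by auto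
  qed
  then have "near `` {x} \<subseteq> {..<n}" "card (near `` {x}) \<le> D" if "x \<in> ?T" for x using Suc that by blast+
  then have "(\<Union>x\<in>?T. near `` {x}) \<subseteq> {..<n}" "(\<Sum>x\<in>?T. card (near `` {x})) \<le> card ?T * D"
    using sum_bounded_above[of ?T "\<lambda>x. card (near `` {x})" D] by auto
  moreover have "card (\<Union>x\<in>?T. near `` {x}) \<le> (\<Sum>x\<in>?T. card (near `` {x}))"
    using Suc finite_subset_V[of ?T] by (intro card_UN_le) auto
  moreover have "card ?T * D \<le> card S * D ^ Suc i" using Suc by simp
  ultimately show ?case unfolding eq by linarith
qed

lemma expl_props:
  assumes "v < n" "0 < p"
  shows "distinct (fst (expl p v X))" "length (fst (expl p v X)) \<le> p" "set (fst (expl p v X)) \<subseteq> {..<n}"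
    "v \<in> set (fst (expl p v X))" "x \<in> set (fst (expl p v X)) \<Longrightarrow> (v, x) \<in> near ^^ p"
proof -
  \<comment> \<open>An entry is attached to an earlier one, so its index bounds its distance from
    \<open>v\<close>; the length bound \<open>p\<close> then turns this into a radius.\<close>
  define I where "I \<tau> \<longleftrightarrow> distinct (fst \<tau>) \<and> length (fst \<tau>) \<le> p \<and> set (fst \<tau>) \<subseteq> {..<n} \<and> v \<in> set (fst \<tau>)
    \<and> (\<forall>i<length (fst \<tau>). (v, fst \<tau> ! i) \<in> near ^^ i)" for \<tau> :: "nat list \<times> nat"
  have step: "I (estep p t w \<tau>)" if "I \<tau>" for t w \<tau>
  proof -
    obtain Q X where \<tau>: "\<tau> = (Q, X)" by (cases \<tau>)
    show ?thesis
    proof (cases "t < length Q \<and> length Q < p \<and> w \<notin> set Q \<and> adj (Q ! t) w \<and> odd X")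
      case True
      have "(v, Q ! t) \<in> near ^^ t" using that True by (auto simp: I_def \<tau>)
      moreover have "(Q ! t, w) \<in> near" using True by (auto simp: near_def)
      ultimately have "(v, w) \<in> near ^^ Suc t" by auto
      then have "(v, w) \<in> near ^^ length Q" by (rule near_relpow_mono[rotated]) (use True in simp)
      then show ?thesis using that True adj_less[of "Q ! t" w]
        by (auto simp: I_def \<tau> estep_def nth_append less_Suc_eq)
    qed (use that in \<open>auto simp: I_def \<tau> estep_def\<close>)
  qed
  have "I (fold (estep p t) ws \<tau>)" if "I \<tau>" for t ws \<tau>
    using that by (induction ws arbitrary: \<tau>) (simp_all add: step)
  then have "I (fold (\<lambda>t. fold (estep p t) [0..<n]) ts \<tau>)" if "I \<tau>" for ts \<tau>
    using that by (induction ts arbitrary: \<tau>) simp_all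
  moreover have "I ([v], X)" using assms by (auto simp: I_def)
  ultimately have I: "I (expl p v X)" unfolding expl_def by blast
  then show "distinct (fst (expl p v X))" "length (fst (expl p v X)) \<le> p" "set (fst (expl p v X)) \<subseteq> {..<n}"
    "v \<in> set (fst (expl p v X))" unfolding I_def by blast+
  assume "x \<in> set (fst (expl p v X))"
  then obtain i where "i < length (fst (expl p v X))" "x = fst (expl p v X) ! i" by (auto simp: in_set_conv_nth)
  then have "(v, x) \<in> near ^^ i" "i \<le> p" using I by (auto simp: I_def)
  then show "(v, x) \<in> near ^^ p" by (rule near_relpow_mono[rotated])
qed

text \<open>The counterpart of \<open>estep\<close> in which membership in \<open>Y\<close> answers
  the questions. The digits that produce the same run are constructed afterwards.\<close>

definition ostep :: "nat set \<Rightarrow> nat \<Rightarrow> nat \<Rightarrow> nat \<Rightarrow> nat list \<Rightarrow> nat list" where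
  "ostep Y p t w Q = (if t < length Q \<and> length Q < p \<and> w \<notin> set Q \<and> adj (Q ! t) w \<and> w \<in> Y then Q @ [w] else Q)"

lemma ostep_append: "\<exists>R. fold (ostep Y p t) ws Q = Q @ R"
proof (induction ws arbitrary: Q)
  case (Cons w ws)
  have "\<exists>R. ostep Y p t w Q = Q @ R" by (auto simp: ostep_def)
  then obtain R where R: "ostep Y p t w Q = Q @ R" by blast
  obtain R' where "fold (ostep Y p t) ws (ostep Y p t w Q) = ostep Y p t w Q @ R'" using Cons.IH by blast
  with R show ?case by simp
qed auto

lemma ostep_subset: "set Q \<subseteq> Y \<Longrightarrow> set (fold (ostep Y p t) ws Q) \<subseteq> Y"
  by (induction ws arbitrary: Q) (auto simp: ostep_def)

lemma ostep_stop: "length Q \<le> t \<Longrightarrow> fold (ostep Y p t) ws Q = Q"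
  by (induction ws arbitrary: Q) (auto simp: ostep_def)

lemma ostep_closed:
  "p \<le> length (fold (ostep Y p t) ws Q) \<or> length Q \<le> t
     \<or> (\<forall>w\<in>set ws. w \<in> Y \<longrightarrow> adj (Q ! t) w \<longrightarrow> w \<in> set (fold (ostep Y p t) ws Q))"
proof (induction ws arbitrary: Q)
  case (Cons w ws)
  obtain R where R: "fold (ostep Y p t) ws (ostep Y p t w Q) = ostep Y p t w Q @ R" using ostep_append by blast
  show ?case
  proof (cases "p \<le> length (fold (ostep Y p t) (w # ws) Q) \<or> length Q \<le> t")
    case False
    then have lt: "t < length Q" "length Q < p" using R by (auto simp: ostep_def split: if_splits)
    then have "t < length (ostep Y p t w Q)" "ostep Y p t w Q ! t = Q ! t" by (auto simp: ostep_def nth_append)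
    with Cons.IH[of "ostep Y p t w Q"] False
    have "\<forall>w'\<in>set ws. w' \<in> Y \<longrightarrow> adj (Q ! t) w' \<longrightarrow> w' \<in> set (fold (ostep Y p t) (w # ws) Q)"
      by auto
    moreover have "w \<in> Y \<longrightarrow> adj (Q ! t) w \<longrightarrow> w \<in> set (fold (ostep Y p t) (w # ws) Q)"
      using lt R by (auto simp: ostep_def)
    ultimately show ?thesis by auto
  qed blast
qed auto

text \<open>By induction from the last question to the first: each question prepends a lowest digit
  to the code of the rest, and as \<open>Suc (2 * X + 1) = 2 * Suc X\<close>, it at most doubles
  \<open>Suc X\<close>. Only neighbours of entry \<open>t\<close> are asked about.\<close>

lemma estep_ostep:
  "\<exists>X. fold (estep p t) ws (Q, X) = (fold (ostep Y p t) ws Q, X')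
     \<and> Suc X \<le> Suc X' * 2 ^ (if length Q \<le> t then 0 else length (filter (adj (Q ! t)) ws))"
proof (induction ws arbitrary: Q)
  case (Cons w ws)
  let ?c = "t < length Q \<and> length Q < p \<and> w \<notin> set Q \<and> adj (Q ! t) w"
  obtain X where X: "fold (estep p t) ws (ostep Y p t w Q, X) = (fold (ostep Y p t) ws (ostep Y p t w Q), X')"
    "Suc X \<le> Suc X' * 2 ^ (if length (ostep Y p t w Q) \<le> t then 0 else length (filter (adj (ostep Y p t w Q ! t)) ws))"
    using Cons.IH by blast
  define X0 where "X0 = (if ?c then 2 * X + of_bool (w \<in> Y) else X)"
  have st: "estep p t w (Q, X0) = (ostep Y p t w Q, X)" by (auto simp: estep_def X0_def ostep_def)
  have t: "t < length Q \<Longrightarrow> ostep Y p t w Q ! t = Q ! t" "length (ostep Y p t w Q) \<le> t \<longleftrightarrow> length Q \<le> t"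
    by (auto simp: ostep_def nth_append)
  have "Suc X0 \<le> Suc X' * 2 ^ (if length Q \<le> t then 0 else length (filter (adj (Q ! t)) (w # ws)))"
  proof (cases ?c)
    case True
    then have "Suc X0 \<le> 2 * Suc X" by (simp add: X0_def of_bool_def)
    with True X(2) t show ?thesis by simp
  next
    case False
    then have "X0 = X" by (auto simp: X0_def)
    with X(2) t show ?thesis by (auto split: if_splits intro: order_trans)
  qed
  with X(1) st show ?case by (intro exI[of _ X0]) simp
qed auto

definition oexpl :: "nat set \<Rightarrow> nat \<Rightarrow> nat list \<Rightarrow> nat list \<Rightarrow> nat list" where
  "oexpl Y p ts Q = fold (\<lambda>t. fold (ostep Y p t) [0..<n]) ts Q"

lemma expl_oexpl:
  assumes "set Q \<subseteq> Y" "Y \<subseteq> {..<n}"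
  shows "\<exists>X. fold (\<lambda>t. fold (estep p t) [0..<n]) ts (Q, X) = (oexpl Y p ts Q, X')
     \<and> Suc X \<le> Suc X' * 2 ^ (length ts * (D - 1))"
  using assms(1)
proof (induction ts arbitrary: Q)
  case (Cons t ts)
  let ?Q = "fold (ostep Y p t) [0..<n] Q" and ?len = "length (filter (adj (Q ! t)) [0..<n])"
  obtain X1 where 1: "fold (\<lambda>t. fold (estep p t) [0..<n]) ts (?Q, X1) = (oexpl Y p ts ?Q, X')"
    "Suc X1 \<le> Suc X' * 2 ^ (length ts * (D - 1))" using Cons.IH[OF ostep_subset[OF Cons.prems]] by blast
  obtain X where 2: "fold (estep p t) [0..<n] (Q, X) = (?Q, X1)"
    "Suc X \<le> Suc X1 * 2 ^ (if length Q \<le> t then 0 else ?len)" using estep_ostep by blast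
  \<comment> \<open>Every entry is expanded in one pass only, which asks at most once about each of
    its at most \<open>D - 1\<close> neighbours.\<close>
  have "(if length Q \<le> t then 0 else ?len) \<le> D - 1"
  proof (cases "length Q \<le> t")
    case False
    then have "Q ! t < n" using Cons.prems assms(2) nth_mem[of t Q] by (meson lessThan_iff not_le subsetD)
    have "?len = card (set (filter (adj (Q ! t)) [0..<n]))" by (rule distinct_card[symmetric]) simp
    also have "\<dots> \<le> card {w. adj (Q ! t) w}" by (rule card_mono) auto
    also have "\<dots> \<le> D - 1" using card_adj_less[OF \<open>Q ! t < n\<close>] by simp
    finally show ?thesis by simp
  qed simp
  then have "Suc X \<le> Suc X1 * 2 ^ (D - 1)"
    using 2(2) by (meson mult_le_mono2 order_trans one_le_numeral power_increasing)
  also have "\<dots> \<le> Suc X' * 2 ^ (length ts * (D - 1)) * 2 ^ (D - 1)" using 1(2) by (rule mult_le_mono1)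
  also have "\<dots> = Suc X' * 2 ^ (length (t # ts) * (D - 1))"
    unfolding length_Cons mult_Suc[of "length ts"] power_add by (simp only: ac_simps)
  finally show ?case using 1(1) 2(1) by (intro exI[of _ X]) (simp add: oexpl_def)
qed (simp add: oexpl_def)

lemma oexpl_props:
  "(\<exists>R. oexpl Y p ts Q = Q @ R) \<and> (set Q \<subseteq> Y \<longrightarrow> set (oexpl Y p ts Q) \<subseteq> Y)
   \<and> ((\<forall>t\<in>set ts. length Q \<le> t) \<longrightarrow> oexpl Y p ts Q = Q)"
proof (induction ts arbitrary: Q)
  case (Cons t ts)
  let ?Q = "fold (ostep Y p t) [0..<n] Q"
  have "oexpl Y p (t # ts) Q = oexpl Y p ts ?Q" by (simp add: oexpl_def)
  then show ?case using Cons.IH[of ?Q] ostep_append[of Y p t "[0..<n]" Q] ostep_subset[of Q Y p t "[0..<n]"]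
      ostep_stop[of Q t Y p "[0..<n]"] by auto
qed (simp add: oexpl_def)

lemma oexpl_closed:
  assumes "Y \<subseteq> {..<n}" "a \<le> t" "t < a + m" "t < length (oexpl Y p [a..<a + m] Q)" "w \<in> Y"
    "adj (oexpl Y p [a..<a + m] Q ! t) w" "length (oexpl Y p [a..<a + m] Q) < p"
  shows "w \<in> set (oexpl Y p [a..<a + m] Q)"
  using assms(2-)
proof (induction m arbitrary: a Q)
  case (Suc m)
  let ?Q = "fold (ostep Y p a) [0..<n] Q"
  let ?Q' = "oexpl Y p [Suc a..<Suc a + m] ?Q"
  have "[a..<a + Suc m] = a # [Suc a..<Suc a + m]" by (simp add: upt_conv_Cons del: upt_Suc)
  then have eq: "oexpl Y p [a..<a + Suc m] Q = ?Q'" by (simp add: oexpl_def)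
  show ?case
  proof (cases "t = a")
    case False
    then show ?thesis using Suc.IH[of "Suc a" ?Q] Suc.prems eq by simp
  next
    case True
    obtain R where R: "?Q = Q @ R" using ostep_append by blast
    obtain R' where R': "?Q' = ?Q @ R'" using oexpl_props by blast
    \<comment> \<open>If pass \<open>a\<close> starts with at most \<open>a\<close> entries, neither
      it nor a later pass appends anything, so entry \<open>a\<close> could not exist at the
      end.\<close>
    have "a < length Q"
    proof (rule ccontr)
      assume "\<not> a < length Q"
      then have "?Q = Q" using ostep_stop[of Q a] by simp
      then have "?Q' = Q" using oexpl_props[of Y p "[Suc a..<Suc a + m]" ?Q] \<open>\<not> a < length Q\<close> by auto
      then show False using Suc.prems True eq \<open>\<not> a < length Q\<close> by simp
    qed
    then have nth: "?Q' ! a = Q ! a" unfolding R' unfolding R by (simp add: nth_append)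
    have "length ?Q < p" using Suc.prems eq R' by simp
    then have "w \<in> set ?Q" using ostep_closed[of p Y a "[0..<n]" Q] \<open>a < length Q\<close> Suc.prems nth True eq assms(1) by auto
    then show ?thesis unfolding eq R' by simp
  qed
qed simp

text \<open>\<open>Q\<close> is chosen before \<open>X'\<close>: the explored list does not depend
  on the digits left over, so these are free to encode the anchor marks or the answers of the later
  search. As \<open>Q\<close> has at most \<open>p\<close> entries, \<open>p\<close> passes expand
  all of them.\<close>

lemma expl_oracle:
  assumes "v \<in> Y" "Y \<subseteq> {..<n}" "0 < p"
  obtains Q where "\<And>X'. \<exists>X. expl p v X = (Q, X') \<and> X < Suc X' * 2 ^ (p * (D - 1))" "set Q \<subseteq> Y"
    "length Q = p \<or> (\<forall>x\<in>set Q. \<forall>w\<in>Y. adj x w \<longrightarrow> w \<in> set Q)"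
proof -
  define Q where "Q = oexpl Y p [0..<0 + p] [v]"
  have Y: "set [v] \<subseteq> Y" using assms by simp
  have 1: "\<exists>X. expl p v X = (Q, X') \<and> X < Suc X' * 2 ^ (p * (D - 1))" for X'
    using expl_oexpl[OF Y assms(2), of p "[0..<0 + p]" X'] by (simp add: expl_def Q_def Suc_le_eq)
  have 2: "set Q \<subseteq> Y" using oexpl_props Y unfolding Q_def by blast
  obtain X where "expl p v X = (Q, 0)" using 1 by blast
  then have len: "length Q \<le> p" using expl_props(2)[of v p X] assms by auto
  have "length Q = p \<or> (\<forall>x\<in>set Q. \<forall>w\<in>Y. adj x w \<longrightarrow> w \<in> set Q)"
  proof (cases "length Q = p")
    case False
    show ?thesis
    proof (intro disjI2 ballI impI)
      fix x w assume "x \<in> set Q" "w \<in> Y" "adj x w"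
      then obtain t where "t < length Q" "x = Q ! t" by (auto simp: in_set_conv_nth)
      then show "w \<in> set Q"
        using oexpl_closed[OF assms(2), of 0 t p p "[v]" w] len False \<open>w \<in> Y\<close> \<open>adj x w\<close> unfolding Q_def by auto
    qed
  qed simp
  then show ?thesis using that 1 2 by blast
qed

lemma marks_subset: "fst (marks p Q X) \<subseteq> set Q"
proof -
  have step: "fst (mstep Q t \<tau>) \<subseteq> set Q" if "fst \<tau> \<subseteq> set Q" for t \<tau>
    using that by (cases \<tau>) (auto simp: mstep_def)
  have "fst (fold (mstep Q) ts \<tau>) \<subseteq> set Q" if "fst \<tau> \<subseteq> set Q" for ts \<tau>
    using that by (induction ts arbitrary: \<tau>) (simp_all add: step)
  then show ?thesis by (auto simp: marks_def)
qed

lemma marks_oracle: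
  assumes "length Q \<le> p"
  obtains X where "marks p Q X = (set Q \<inter> A, X')" "X < Suc X' * 2 ^ p"
proof -
  have "\<exists>X. fold (mstep Q) ts (S, X) = (S \<union> {Q ! t |t. t \<in> set ts \<and> t < length Q \<and> Q ! t \<in> A}, X')
      \<and> Suc X \<le> Suc X' * 2 ^ length ts" for ts S
  proof (induction ts arbitrary: S)
    case (Cons t ts)
    define S1 where "S1 = (if t < length Q \<and> Q ! t \<in> A then insert (Q ! t) S else S)"
    obtain X where X: "fold (mstep Q) ts (S1, X) = (S1 \<union> {Q ! t |t. t \<in> set ts \<and> t < length Q \<and> Q ! t \<in> A}, X')"
      "Suc X \<le> Suc X' * 2 ^ length ts" using Cons.IH by blast
    define X0 where "X0 = (if t < length Q then 2 * X + of_bool (Q ! t \<in> A) else X)"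
    have "mstep Q t (S, X0) = (S1, X)" by (auto simp: mstep_def X0_def S1_def)
    moreover have "Suc X0 \<le> 2 * Suc X" by (simp add: X0_def of_bool_def)
    ultimately show ?case using X by (intro exI[of _ X0]) (auto simp: S1_def)
  qed auto
  from this[of "[0..<p]" "{}"] obtain X where "marks p Q X = ({Q ! t |t. t \<in> set [0..<p] \<and> t < length Q \<and> Q ! t \<in> A}, X')"
    "Suc X \<le> Suc X' * 2 ^ p" by (auto simp: marks_def)
  moreover have "{Q ! t |t. t \<in> set [0..<p] \<and> t < length Q \<and> Q ! t \<in> A} = set Q \<inter> A"
    using assms by (force simp: in_set_conv_nth)
  ultimately show ?thesis using that by simp
qed

section \<open>Connected components inside a vertex set\<close>

definition component :: "nat set \<Rightarrow> nat \<Rightarrow> nat set" where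
  "component H v = {y. (v, y) \<in> {(x, y). x \<in> H \<and> y \<in> H \<and> adj x y}\<^sup>*}"

lemma component_self: "v \<in> component H v"
  by (simp add: component_def)

lemma component_subset: "v \<in> H \<Longrightarrow> component H v \<subseteq> H"
proof
  fix y assume "v \<in> H" "y \<in> component H v"
  then have "(v, y) \<in> {(x, y). x \<in> H \<and> y \<in> H \<and> adj x y}\<^sup>*" by (simp add: component_def)
  then show "y \<in> H" using \<open>v \<in> H\<close> by (induction rule: rtrancl_induct) auto
qed

lemma component_mono: "H' \<subseteq> H \<Longrightarrow> component H' v \<subseteq> component H v"
  unfolding component_def
  by (auto elim!: rtrancl_mono[THEN subsetD, rotated])

lemma component_closed: "x \<in> component H v \<Longrightarrow> v \<in> H \<Longrightarrow> adj x y \<Longrightarrow> y \<in> H \<Longrightarrow> y \<in> component H v"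
  using component_subset[of v H] unfolding component_def by (auto intro: rtrancl_into_rtrancl)

lemma component_least:
  assumes "v \<in> Q" "\<And>x w. x \<in> Q \<Longrightarrow> w \<in> component H v \<Longrightarrow> adj x w \<Longrightarrow> w \<in> Q"
  shows "component H v \<subseteq> Q"
proof
  fix y assume "y \<in> component H v"
  then have "(v, y) \<in> {(x, y). x \<in> H \<and> y \<in> H \<and> adj x y}\<^sup>*" by (simp add: component_def)
  then show "y \<in> Q"
  proof (induction rule: rtrancl_induct)
    case (step y z)
    then have "z \<in> component H v" by (auto simp: component_def intro: rtrancl_into_rtrancl)
    with step assms(2) show ?case by auto
  qed (rule assms(1))
qed

text \<open>The exploration keeps to the component, so it either fills up with \<open>p\<close>
  vertices or stops at a closed set. The former provides the seed \<open>K\<close> inside a large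
  component, the latter describes a small one completely.\<close>

lemma expl_component:
  assumes "v \<in> H" "H \<subseteq> {..<n}" "0 < p"
  obtains Q where "\<And>X'. \<exists>X. expl p v X = (Q, X') \<and> X < Suc X' * 2 ^ (p * (D - 1))" "set Q \<subseteq> component H v"
    "length Q \<le> p" "card (set Q) = p \<or> set Q = component H v"
proof -
  have "component H v \<subseteq> {..<n}" using component_subset[OF assms(1)] assms(2) by auto
  from expl_oracle[OF component_self this assms(3)] obtain Q where
    1: "\<And>X'. \<exists>X. expl p v X = (Q, X') \<and> X < Suc X' * 2 ^ (p * (D - 1))" "set Q \<subseteq> component H v"
    "length Q = p \<or> (\<forall>x\<in>set Q. \<forall>w\<in>component H v. adj x w \<longrightarrow> w \<in> set Q)" by metis
  obtain X where "expl p v X = (Q, 0)" using 1(1) by blast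
  then have Q: "v \<in> set Q" "distinct Q" "length Q \<le> p" using expl_props[of v p X] assms by auto
  then have "card (set Q) = p \<or> component H v \<subseteq> set Q"
    using 1(3) component_least[of v "set Q" H] distinct_card[OF Q(2)] by metis
  then show ?thesis using that 1(1,2) Q(3) by blast
qed

lemma piece_small_component:
  assumes "v \<in> H" "H \<subseteq> {..<n}" "0 < p" "card (component H v) < p"
  obtains M where "M < 2 ^ (p * D)" "set (piece p v M) = component H v"
    "piece_anchors p v M = component H v \<inter> A"
proof -
  have D: "0 < D" using degree_less[of v] assms by auto
  obtain Q where Q: "\<And>X'. \<exists>X. expl p v X = (Q, X') \<and> X < Suc X' * 2 ^ (p * (D - 1))"
    "length Q \<le> p" "set Q = component H v"
  proof (rule expl_component[OF assms(1-3)])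
    fix Q assume "set Q \<subseteq> component H v" "card (set Q) = p \<or> set Q = component H v"
    moreover have "finite (component H v)"
      using component_subset[OF assms(1)] assms(2) finite_subset_V by blast
    ultimately have "set Q = component H v" using assms(4) card_mono[of "component H v" "set Q"] by auto
    moreover assume "\<And>X'. \<exists>X. expl p v X = (Q, X') \<and> X < Suc X' * 2 ^ (p * (D - 1))" "length Q \<le> p"
    ultimately show ?thesis using that by blast
  qed
  obtain X1 where X1: "marks p Q X1 = (set Q \<inter> A, 0)" "X1 < Suc 0 * 2 ^ p" using marks_oracle[OF Q(2)] .
  obtain M where M: "expl p v M = (Q, X1)" "M < Suc X1 * 2 ^ (p * (D - 1))" using Q(1) by blast
  \<comment> \<open>\<open>p * (D - 1)\<close> bits steer the exploration and \<open>p\<close> bits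
    mark anchors, which makes \<open>p * D\<close>.\<close>
  have "M < 2 ^ p * 2 ^ (p * (D - 1))"
    by (rule less_le_trans[OF M(2)]) (use X1(2) in \<open>intro mult_le_mono1; simp\<close>)
  also have "\<dots> = 2 ^ (p * D)" using D by (cases D) (simp_all add: power_add[symmetric])
  finally show ?thesis using that[of M] M(1) X1 Q(3) by (simp add: piece_def piece_anchors_def)
qed


subsection \<open>Small components\<close>

definition valid :: "nat \<Rightarrow> nat \<Rightarrow> nat \<Rightarrow> nat \<Rightarrow> nat \<Rightarrow> bool" where
  "valid p s j M v \<longleftrightarrow> length (piece p v M) = s \<and> card (piece_anchors p v M) = j
     \<and> sol (piece_anchors p v M) (set (piece p v M))"

text \<open>A rank out of range yields the empty set, which makes it possible to pad a list of
  choices.\<close>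

definition pick :: "nat \<Rightarrow> nat \<times> nat \<times> nat \<times> nat \<Rightarrow> nat set" where
  "pick p = (\<lambda>(i, s, j, M). let F = filter (valid p s j M) [0..<n] in
     if i < length F then piece_anchors p (F ! i) M else {})"

text \<open>No arc inside \<open>H\<close> joins a component to the rest, so in-degrees are
  unchanged on both sides.\<close>

lemma split_component:
  assumes "sol A H" "a \<in> H"
  defines "Y \<equiv> component H a"
  shows "sol (A \<inter> Y) Y" "sol (A - Y) (H - Y)" "Y \<subseteq> H"
proof -
  show Y: "Y \<subseteq> H" unfolding Y_def by (rule component_subset[OF assms(2)])
  have clo: "x \<in> Y \<longleftrightarrow> y \<in> Y" if "x \<in> H" "y \<in> H" "E x y" for x y
    using component_closed[OF _ assms(2), of x y] component_closed[OF _ assms(2), of y x] that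
    by (auto simp: Y_def adj_def)
  have "indeg Y v = indeg H v" if "v \<in> Y" for v
    unfolding indeg_def by (rule arg_cong[of _ _ card]) (use clo Y that in blast)
  then show "sol (A \<inter> Y) Y" using assms(1) Y by (auto simp: sol_def)
  have "indeg (H - Y) v = indeg H v" if "v \<in> H - Y" for v
    unfolding indeg_def by (rule arg_cong[of _ _ card]) (use clo Y that in blast)
  then show "sol (A - Y) (H - Y)" using assms(1) by (auto simp: sol_def)
qed

text \<open>Pigeonhole: \<open>T\<close> distinct entries cannot all lie in \<open>S\<close>. If
  \<open>F\<close> has at most \<open>T\<close> entries, the index of \<open>v\<close> itself is
  early enough.\<close>

lemma early_index:
  assumes "card S < T" "finite S" "v \<in> set F" "distinct F"
  obtains i where "i < length F" "i < T" "F ! i \<notin> S \<or> F ! i = v"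
proof (cases "length F \<le> T")
  case True
  then show ?thesis using that assms(3) by (metis in_set_conv_nth less_le_trans)
next
  case False
  then have "card (set (take T F)) = T" using distinct_card[of "take T F"] assms(4) by simp
  then have "\<not> set (take T F) \<subseteq> S" using card_mono[OF assms(2), of "set (take T F)"] assms(1) by auto
  then obtain x where "x \<in> set (take T F)" "x \<notin> S" by blast
  then obtain i where "i < length (take T F)" "take T F ! i \<notin> S" by (metis in_set_conv_nth)
  then have "i < T" "i < length F" "F ! i \<notin> S" by auto
  then show ?thesis using that by blast
qed

text \<open>
  A component is replaced by the piece of one of the first vertices with a piece of the same
  kind; only few vertices are close enough to the rest of the solution to be in its way.
\<close>

lemma picks_exist:
  assumes "0 < p" "m * D ^ p < B" "p \<le> B" "2 ^ (p * D) \<le> B"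
    "sol A0 H0" "sol A1 H1" "H0 \<inter> H1 = {}" "card H0 + card H1 \<le> m"
    "\<And>v. v \<in> H1 \<Longrightarrow> card (component H1 v) < p"
  shows "\<exists>ds H. length ds \<le> card A1 \<and> (\<forall>(i, s, j, M)\<in>set ds. i < B \<and> s < B \<and> j < B \<and> M < B)
     \<and> sol (A0 \<union> \<Union>(pick p ` set ds)) H \<and> card H = card H0 + card H1
     \<and> card (\<Union>(pick p ` set ds)) \<le> card A1"
  using assms(5-)
\<comment> \<open>\<open>(A0, H0)\<close> is the part already exchanged and \<open>(A1, H1)\<close>
  the original part still to be processed. Exchanges preserve the total size, so the bound
  \<open>m\<close> persists.\<close>
proof (induction "card A1" arbitrary: A0 H0 A1 H1 rule: less_induct)
  case less
  have fin: "finite H0" "finite H1" "finite A1" "A1 \<subseteq> H1" "H0 \<subseteq> {..<n}" "H1 \<subseteq> {..<n}"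
    using less.prems(1,2) finite_subset_V[of H0] finite_subset_V[of H1] finite_subset[of A1 H1] by (auto simp: sol_def)
  show ?case
  proof (cases "A1 = {}")
    \<comment> \<open>The remaining components have no anchors and stay where they are, so choices
      are spent on anchored components only and \<open>card A1\<close> of them suffice.\<close>
    case True
    then have "sol A0 (H0 \<union> H1)" using sol_Un[OF less.prems(1,2)] by simp
    moreover have "card (H0 \<union> H1) = card H0 + card H1" using fin less.prems(3) by (intro card_Un_disjoint)
    ultimately show ?thesis by (intro exI[of _ "[]"] exI[of _ "H0 \<union> H1"]) simp
  next
    case False
    then obtain a where a: "a \<in> A1" "a \<in> H1" using fin by auto
    define Y where "Y = component H1 a"
    note Y = split_component[OF less.prems(2) a(2), folded Y_def]
    have aY: "a \<in> Y" unfolding Y_def by (rule component_self)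
    obtain M where M: "M < 2 ^ (p * D)" "set (piece p a M) = Y" "piece_anchors p a M = Y \<inter> A1"
      using piece_small_component[OF a(2) fin(6) assms(1) less.prems(5)[OF a(2)], of A1] unfolding Y_def by metis
    define s where "s = length (piece p a M)"
    define j where "j = card (Y \<inter> A1)"
    define F where "F = filter (valid p s j M) [0..<n]"
    have finY: "finite Y" using Y(3) fin(2) by (rule finite_subset)
    have card_piece: "card (set (piece p v M)) = length (piece p v M)" if "v < n" for v
      using expl_props(1)[OF that assms(1)] distinct_card by (auto simp: piece_def)
    have an: "a < n" using a fin by auto
    have s: "s = card Y" using card_piece[OF an] M(2) by (simp add: s_def)
    have "card Y < p" using less.prems(5)[OF a(2)] by (simp add: Y_def)
    moreover have "j \<le> card Y" unfolding j_def by (rule card_mono[OF finY]) auto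
    ultimately have sj: "s < B" "j < B" using assms(3) s by auto
    have "valid p s j M a" using Y(1) M by (simp add: valid_def s_def j_def Int_commute)
    then have aF: "a \<in> set F" using an by (simp add: F_def)
    \<comment> \<open>A piece stays within distance \<open>p\<close> of its start, so it can touch
      \<open>H0\<close> or \<open>H1\<close> only if it starts in \<open>S\<close>.\<close>
    define S where "S = (near ^^ p) `` (H0 \<union> H1)"
    have sub: "H0 \<union> H1 \<subseteq> {..<n}" using fin by auto
    have "card S \<le> card (H0 \<union> H1) * D ^ p" using card_near_relpow[OF sub] by (simp add: S_def)
    also have "\<dots> \<le> m * D ^ p" using card_Un_le[of H0 H1] less.prems(4) by (intro mult_le_mono1) simp
    finally have cS: "card S < B" using assms(2) by simp
    have "finite S" unfolding S_def using card_near_relpow[OF sub] finite_subset_V by blast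
    from early_index[OF cS this aF] obtain i where i: "i < length F" "i < B" "F ! i \<notin> S \<or> F ! i = a"
      unfolding F_def by auto
    define v where "v = F ! i"
    have "v \<in> set F" using i by (simp add: v_def)
    then have v: "v < n" "valid p s j M v" by (auto simp: F_def)
    define Y' where "Y' = set (piece p v M)"
    define S' where "S' = piece_anchors p v M"
    have Y': "sol S' Y'" "card Y' = card Y" "card S' = j"
      using v card_piece[OF v(1)] s by (auto simp: valid_def Y'_def S'_def)
    \<comment> \<open>Either the piece is the component \<open>Y\<close> itself, left in place, or
      its start is too far away to meet anything.\<close>
    have disj: "Y' \<inter> (H0 \<union> (H1 - Y)) = {}"
    proof (cases "v = a")
      case True
      then show ?thesis using M(2) less.prems(3) Y(3) by (auto simp: Y'_def)
    next
      case False
      then have "v \<notin> S" using i by (simp add: v_def)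
      moreover have "v \<in> S" if "y \<in> Y'" "y \<in> H0 \<union> H1" for y
        using expl_props(5)[OF v(1) assms(1)] near_relpow_sym that unfolding S_def Y'_def piece_def by blast
      ultimately show ?thesis by blast
    qed
    have cA: "card A1 = card (A1 - Y) + j"
      using card_Int_Diff[OF fin(3), of Y] by (simp add: j_def Int_commute)
    have "j \<noteq> 0" using a aY finY unfolding j_def by auto
    then have "card (A1 - Y) < card A1" using cA by simp
    have cH: "card (H0 \<union> Y') + card (H1 - Y) = card H0 + card H1"
    proof -
      have "finite Y'" by (simp add: Y'_def)
      then have "card (H0 \<union> Y') = card H0 + card Y'" using disj fin by (intro card_Un_disjoint) auto
      moreover have "card (H1 - Y) = card H1 - card Y" using Y(3) finY by (simp add: card_Diff_subset)
      moreover have "card Y \<le> card H1" using Y(3) fin(2) by (rule card_mono[rotated])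
      ultimately show ?thesis using Y'(2) by simp
    qed
    have cmp: "card (component (H1 - Y) v) < p" if "v \<in> H1 - Y" for v
    proof -
      have "card (component (H1 - Y) v) \<le> card (component H1 v)"
        using that fin(2) component_subset[of v H1] by (intro card_mono component_mono finite_subset[of "component H1 v" H1]) auto
      then show ?thesis using less.prems(5)[of v] that by auto
    qed
    from less.hyps[OF \<open>card (A1 - Y) < card A1\<close> sol_Un[OF less.prems(1) Y'(1)] Y(2) _ _ cmp]
    obtain ds H where ds: "length ds \<le> card (A1 - Y)" "\<forall>(i, s, j, M)\<in>set ds. i < B \<and> s < B \<and> j < B \<and> M < B"
      "sol ((A0 \<union> S') \<union> \<Union>(pick p ` set ds)) H" "card H = card (H0 \<union> Y') + card (H1 - Y)"
      "card (\<Union>(pick p ` set ds)) \<le> card (A1 - Y)"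
      using disj less.prems(3,4) cH by auto
    have pk: "pick p (i, s, j, M) = S'" using i by (simp add: pick_def F_def S'_def v_def)
    have "card (S' \<union> \<Union>(pick p ` set ds)) \<le> card A1"
      using card_Un_le[of S' "\<Union>(pick p ` set ds)"] ds(5) Y'(3) cA by simp
    moreover have "length ((i, s, j, M) # ds) \<le> card A1" using ds(1) \<open>card (A1 - Y) < card A1\<close> by simp
    ultimately show ?thesis
      using ds i(2) sj M(1) assms(4) cH pk
      by (intro exI[of _ "(i, s, j, M) # ds"] exI[of _ H]) (auto simp: Un_assoc)
  qed
qed

text \<open>At most \<open>card A\<close> components contain anchors, each with fewer than
  \<open>p\<close> vertices; the union of the others is an anchor-free solution and hence small too.
  The resulting bound limits the ranks that have to be guessed.\<close>

lemma card_le_of_small_components: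
  assumes "sol A H" "\<And>v. v \<in> H \<Longrightarrow> card (component H v) < p" "\<And>Z. sol {} Z \<Longrightarrow> card Z < p"
  shows "card H \<le> (card A + 1) * p"
  using assms(1,2)
proof (induction "card A" arbitrary: A H rule: less_induct)
  case less
  have fin: "finite H" "finite A" "A \<subseteq> H" "H \<subseteq> {..<n}"
    using less.prems finite_subset_V[of H] finite_subset[of A H] by (auto simp: sol_def)
  show ?case
  proof (cases "A = {}")
    case True
    then show ?thesis using assms(3)[of H] less.prems by auto
  next
    case False
    then obtain a where a: "a \<in> A" "a \<in> H" using fin by auto
    define Y where "Y = component H a"
    note Y = split_component[OF less.prems(1) a(2), folded Y_def]
    have "a \<in> Y" unfolding Y_def by (rule component_self)
    then have lt: "card (A - Y) < card A" using a fin by (intro psubset_card_mono) auto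
    have cmp: "card (component (H - Y) v) < p" if "v \<in> H - Y" for v
    proof -
      have "card (component (H - Y) v) \<le> card (component H v)"
        using that fin(1) component_subset[of v H] by (intro card_mono component_mono finite_subset[of "component H v" H]) auto
      then show ?thesis using less.prems(2)[of v] that by auto
    qed
    have "card H = card Y + card (H - Y)" using card_Int_Diff[OF fin(1), of Y] Y(3) by (simp add: Int_absorb1)
    also have "\<dots> \<le> p + (card (A - Y) + 1) * p"
      using less.hyps[OF lt Y(2) cmp] less.prems(2)[OF a(2)] by (auto simp: Y_def)
    also have "\<dots> = (card (A - Y) + 2) * p" by simp
    also have "\<dots> \<le> (card A + 1) * p" using lt by (intro mult_le_mono1) simp
    finally show ?thesis .
  qed
qed

definition accepts :: "nat \<Rightarrow> nat \<Rightarrow> nat set \<Rightarrow> bool" where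
  "accepts b p A \<longleftrightarrow> card A \<le> b \<and> (\<exists>H. sol A H \<and> p \<le> card H)"

text \<open>A piece contains its starting vertex and so never has length 0. This is the tuple used
  for padding.\<close>

lemma pick_zero: "0 < p \<Longrightarrow> pick p (0, 0, 0, 0) = {}"
proof -
  assume p: "0 < p"
  have "\<not> valid p 0 0 0 v" if "v < n" for v
    using expl_props(4)[OF that p, of 0] by (auto simp: valid_def piece_def)
  then have "filter (valid p 0 0 0) [0..<n] = []" by (auto simp: filter_empty_conv)
  then show ?thesis by (simp add: pick_def)
qed

lemma small_components_picks:
  assumes "0 < p" "(b + 1) * p * D ^ p < B" "p \<le> B" "2 ^ (p * D) \<le> B"
    "sol A H" "card A \<le> b" "p \<le> card H" "\<And>v. v \<in> H \<Longrightarrow> card (component H v) < p"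
    "\<And>Z. sol {} Z \<Longrightarrow> card Z < p"
  obtains ds where "length ds = b" "\<And>i s j M. (i, s, j, M) \<in> set ds \<Longrightarrow> i < B \<and> s < B \<and> j < B \<and> M < B"
    "accepts b p (\<Union>(pick p ` set ds))"
proof -
  have "card H \<le> (card A + 1) * p" by (rule card_le_of_small_components[OF assms(5,8,9)])
  also have "\<dots> \<le> (b + 1) * p" using assms(6) by (intro mult_le_mono1) simp
  finally have "card {} + card H \<le> (b + 1) * p" by simp
  from picks_exist[OF assms(1-4) _ assms(5) _ this assms(8), of "{}"]
  obtain ds H' where ds: "length ds \<le> card A" "\<forall>(i, s, j, M)\<in>set ds. i < B \<and> s < B \<and> j < B \<and> M < B"
     "sol (\<Union>(pick p ` set ds)) H'" "card H' = card H" "card (\<Union>(pick p ` set ds)) \<le> card A"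
    by (auto simp: sol_def[of "{}" "{}"])
  \<comment> \<open>The program always reads exactly \<open>b\<close> tuples, so a shorter list is
    padded with neutral ones.\<close>
  define ds' where "ds' = ds @ replicate (b - length ds) (0, 0, 0, 0)"
  have "\<Union>(pick p ` set ds') = \<Union>(pick p ` set ds)"
    using pick_zero[OF assms(1)] by (auto simp: ds'_def)
  moreover have "length ds' = b" using ds(1) assms(6) by (simp add: ds'_def)
  moreover have "i < B \<and> s < B \<and> j < B \<and> M < B" if "(i, s, j, M) \<in> set ds'" for i s j M
    using that ds(2) assms(1,3) by (auto simp: ds'_def)
  moreover have "accepts b p (\<Union>(pick p ` set ds))" using ds assms(6,7) by (auto simp: accepts_def)
  ultimately show ?thesis using that[of ds'] by metis
qed

end


section \<open>Loop programs, their compilation and syntactic time bounds\<close>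

section \<open>A loop language compiled to the machine\<close>

text \<open>
  Programs have scalar variables and sixteen one-dimensional arrays. The number of iterations of
  a loop is the value of a variable that the loop does not change, so execution times have
  bounds that depend only on the syntax and on the values of such variables.
\<close>

type_synonym st = "(nat \<Rightarrow> nat) \<times> (nat \<Rightarrow> nat \<Rightarrow> nat)"

datatype ex = Num nat | Var nat | Arr nat ex | Plus ex ex | Minus ex ex | Times ex nat

primrec ev :: "ex \<Rightarrow> st \<Rightarrow> nat" where
  "ev (Num c) s = c"
| "ev (Var x) s = fst s x"
| "ev (Arr a e) s = snd s a (ev e s)"
| "ev (Plus e f) s = ev e s + ev f s"
| "ev (Minus e f) s = ev e s - ev f s"
| "ev (Times e x) s = ev e s * fst s x"

datatype stm =
    Nop
  | Asg nat ex
  | Wr nat ex ex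
  | Sq stm stm
  | Cond ex stm stm
  | For nat nat stm

primrec sem :: "stm \<Rightarrow> st \<Rightarrow> st" where
  "sem Nop s = s"
| "sem (Asg x e) s = ((fst s)(x := ev e s), snd s)"
| "sem (Wr a i e) s = (fst s, (snd s)(a := (snd s a)(ev i s := ev e s)))"
| "sem (Sq P Q) s = sem Q (sem P s)"
| "sem (Cond e P Q) s = (if ev e s \<noteq> 0 then sem P s else sem Q s)"
| "sem (For x c P) s = fold (\<lambda>i s. sem P ((fst s)(x := i), snd s)) [0..<fst s c] s"

text \<open>The variables that a program may assign; \<open>ma\<close> does the same for arrays.
  Everything else is covered by the frame lemmas.\<close>

primrec mv :: "stm \<Rightarrow> nat set" where
  "mv Nop = {}"
| "mv (Asg x e) = {x}"
| "mv (Wr a i e) = {}"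
| "mv (Sq P Q) = mv P \<union> mv Q"
| "mv (Cond e P Q) = mv P \<union> mv Q"
| "mv (For x c P) = insert x (mv P)"

primrec ma :: "stm \<Rightarrow> nat set" where
  "ma Nop = {}"
| "ma (Asg x e) = {}"
| "ma (Wr a i e) = {a}"
| "ma (Sq P Q) = ma P \<union> ma Q"
| "ma (Cond e P Q) = ma P \<union> ma Q"
| "ma (For x c P) = ma P"

lemma sem_frame_var: "x \<notin> mv P \<Longrightarrow> fst (sem P s) x = fst s x"
proof (induction P arbitrary: s)
  case (For y c P)
  have "fst (fold (\<lambda>i s. sem P ((fst s)(y := i), snd s)) xs s) x = fst s x" for xs
    using For by (induction xs arbitrary: s) auto
  then show ?case by simp
qed auto

lemma sem_frame_arr: "a \<notin> ma P \<Longrightarrow> snd (sem P s) a = snd s a"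
proof (induction P arbitrary: s)
  case (For y c P)
  have "snd (fold (\<lambda>i s. sem P ((fst s)(y := i), snd s)) xs s) a = snd s a" for xs
    using For by (induction xs arbitrary: s) auto
  then show ?case by simp
qed auto

text \<open>The step hands back what the loop leaves unchanged, so an invariant has to mention only
  what the body modifies.\<close>

lemma sem_For_inv [consumes 1]:
  assumes "I 0 s"
    and "\<And>i s'. \<lbrakk>i < fst s c; I i s'; \<And>y. y \<noteq> x \<Longrightarrow> y \<notin> mv P \<Longrightarrow> fst s' y = fst s y;
           \<And>a. a \<notin> ma P \<Longrightarrow> snd s' a = snd s a\<rbrakk> \<Longrightarrow> I (Suc i) (sem P ((fst s')(x := i), snd s'))"
  shows "I (fst s c) (sem (For x c P) s)"
proof -
  define f where "f m = fold (\<lambda>i s. sem P ((fst s)(x := i), snd s)) [0..<m] s" for m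
  have "m \<le> fst s c \<Longrightarrow> I m (f m) \<and> (\<forall>y. y \<noteq> x \<longrightarrow> y \<notin> mv P \<longrightarrow> fst (f m) y = fst s y)
      \<and> (\<forall>a. a \<notin> ma P \<longrightarrow> snd (f m) a = snd s a)" for m
  proof (induction m)
    case 0
    then show ?case using assms(1) by (simp add: f_def)
  next
    case (Suc m)
    then have IH: "I m (f m)" "\<And>y. y \<noteq> x \<Longrightarrow> y \<notin> mv P \<Longrightarrow> fst (f m) y = fst s y"
      "\<And>a. a \<notin> ma P \<Longrightarrow> snd (f m) a = snd s a" by auto
    have f: "f (Suc m) = sem P ((fst (f m))(x := m), snd (f m))" by (simp add: f_def)
    show ?case unfolding f using assms(2)[OF _ IH] Suc.prems IH
      by (simp add: sem_frame_var sem_frame_arr)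
  qed
  then show ?thesis by (simp add: f_def)
qed

text \<open>\<open>C\<close> contains the variables that control the running time.\<close>

primrec wfe :: "nat set \<Rightarrow> ex \<Rightarrow> bool" where
  "wfe C (Num c) = True"
| "wfe C (Var x) = True"
| "wfe C (Arr a e) = (a < 16 \<and> wfe C e)"
| "wfe C (Plus e f) = (wfe C e \<and> wfe C f)"
| "wfe C (Minus e f) = (wfe C e \<and> wfe C f)"
| "wfe C (Times e x) = (x \<in> C \<and> wfe C e)"

primrec wfs :: "nat set \<Rightarrow> stm \<Rightarrow> bool" where
  "wfs C Nop = True"
| "wfs C (Asg x e) = (x \<notin> C \<and> wfe C e)"
| "wfs C (Wr a i e) = (a < 16 \<and> wfe C i \<and> wfe C e)"
| "wfs C (Sq P Q) = (wfs C P \<and> wfs C Q)"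
| "wfs C (Cond e P Q) = (wfe C e \<and> wfs C P \<and> wfs C Q)"
| "wfs C (For x c P) = (x \<notin> C \<and> c \<in> C \<and> wfs C P)"

lemma wfs_mv: "wfs C P \<Longrightarrow> x \<in> C \<Longrightarrow> x \<notin> mv P"
  by (induction P) auto

text \<open>Weights for the time bound \<open>we e * (Z + 1)\<close>, where \<open>Z\<close> bounds
  the controlling variables. The factor \<open>Z + 1\<close> pays for \<open>Times\<close>, which is
  executed by repeated addition.\<close>

primrec we :: "ex \<Rightarrow> nat" where
  "we (Num c) = 1"
| "we (Var x) = 1"
| "we (Arr a e) = we e + 8"
| "we (Plus e f) = we e + we f + 1"
| "we (Minus e f) = we e + we f + 1"
| "we (Times e x) = we e + 8"

primrec ws :: "stm \<Rightarrow> nat" where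
  "ws Nop = 1"
| "ws (Asg x e) = we e + 1"
| "ws (Wr a i e) = we i + we e + 8"
| "ws (Sq P Q) = ws P + ws Q"
| "ws (Cond e P Q) = we e + ws P + ws Q + 1"
| "ws (For x c P) = ws P + 9"

text \<open>The exponent of \<open>Z + 1\<close> in the time bound. It starts at 1 because loop-free
  code may already contain \<open>Times\<close>.\<close>

primrec dp :: "stm \<Rightarrow> nat" where
  "dp Nop = 1"
| "dp (Asg x e) = 1"
| "dp (Wr a i e) = 1"
| "dp (Sq P Q) = max (dp P) (dp Q)"
| "dp (Cond e P Q) = max (dp P) (dp Q)"
| "dp (For x c P) = Suc (dp P)"

text \<open>
  Register 0 holds the start of the array area, even registers hold the variables, odd
  registers are temporaries; entry \<open>i\<close> of array \<open>a\<close> is stored at offset \<open>16 i + a\<close>.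
\<close>

definition rep :: "st \<Rightarrow> nat \<Rightarrow> ram_state \<Rightarrow> bool" where
  "rep s off \<sigma> \<longleftrightarrow> fst \<sigma> 0 = off \<and> (\<forall>x. fst \<sigma> (2 * x + 2) = fst s x)
     \<and> (\<forall>a<16. \<forall>i. snd \<sigma> (off + 16 * i + a) = snd s a i)"

abbreviation tmp :: "nat \<Rightarrow> nat" where "tmp d \<equiv> 2 * d + 1"

text \<open>Four doublings multiply the index by 16, as the machine cannot multiply.\<close>

definition addr :: "nat \<Rightarrow> nat \<Rightarrow> ram" where
  "addr a d = Seq (Add (tmp d) (tmp d) (tmp d)) (Seq (Add (tmp d) (tmp d) (tmp d))
     (Seq (Add (tmp d) (tmp d) (tmp d)) (Seq (Add (tmp d) (tmp d) (tmp d))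
     (Seq (Const (tmp (Suc d)) a) (Seq (Add (tmp d) (tmp d) (tmp (Suc d))) (Add (tmp d) (tmp d) 0))))))"

text \<open>Temporaries form a stack: code compiled at level \<open>d\<close> preserves the odd
  registers below \<open>tmp d\<close>, so the values of enclosing expressions and loops
  survive.\<close>

primrec cex :: "ex \<Rightarrow> nat \<Rightarrow> ram" where
  "cex (Num c) d = Const (tmp d) c"
| "cex (Var x) d = Copy (tmp d) (2 * x + 2)"
| "cex (Arr a e) d = Seq (cex e d) (Seq (addr a d) (Load (tmp d) (tmp d)))"
| "cex (Plus e f) d = Seq (cex e d) (Seq (cex f (Suc d)) (Add (tmp d) (tmp d) (tmp (Suc d))))"
| "cex (Minus e f) d = Seq (cex e d) (Seq (cex f (Suc d)) (Sub (tmp d) (tmp d) (tmp (Suc d))))"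
| "cex (Times e x) d = Seq (cex e d) (Seq (Copy (tmp (d + 1)) (2 * x + 2))
     (Seq (Const (tmp (d + 2)) 0) (Seq (Const (tmp (d + 3)) 1)
     (Seq (WhileNZ (tmp (d + 1)) (Seq (Add (tmp (d + 2)) (tmp (d + 2)) (tmp d))
        (Sub (tmp (d + 1)) (tmp (d + 1)) (tmp (d + 3))))) (Copy (tmp d) (tmp (d + 2)))))))"

text \<open>A loop keeps its remaining count and its index in temporaries, so its body may overwrite
  the loop variable, in agreement with \<open>sem\<close>.\<close>

primrec cst :: "stm \<Rightarrow> nat \<Rightarrow> ram" where
  "cst Nop d = Skip"
| "cst (Asg x e) d = Seq (cex e d) (Copy (2 * x + 2) (tmp d))"
| "cst (Wr a i e) d = Seq (cex i d) (Seq (addr a d) (Seq (cex e (Suc d)) (Store (tmp d) (tmp (Suc d)))))"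
| "cst (Sq P Q) d = Seq (cst P d) (cst Q d)"
| "cst (Cond e P Q) d = Seq (cex e d) (IfNZ (tmp d) (cst P d) (cst Q d))"
| "cst (For x c P) d = Seq (Copy (tmp d) (2 * c + 2)) (Seq (Const (tmp (d + 1)) 0)
     (WhileNZ (tmp d) (Seq (Copy (2 * x + 2) (tmp (d + 1))) (Seq (cst P (d + 2))
        (Seq (Const (tmp (d + 2)) 1) (Seq (Add (tmp (d + 1)) (tmp (d + 1)) (tmp (d + 2)))
           (Sub (tmp d) (tmp d) (tmp (d + 2)))))))))"

lemma exec_while_count:
  assumes "I 0 s"
    and step: "\<And>i \<sigma>. i < m \<Longrightarrow> I i \<sigma> \<Longrightarrow> fst \<sigma> r \<noteq> 0 \<and> (\<exists>t \<sigma>'. exec B \<sigma> t \<sigma>' \<and> I (Suc i) \<sigma>' \<and> t \<le> T)"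
    and stop: "\<And>\<sigma>. I m \<sigma> \<Longrightarrow> fst \<sigma> r = 0"
  shows "\<exists>t \<sigma>. exec (WhileNZ r B) s t \<sigma> \<and> I m \<sigma> \<and> t \<le> m * (T + 1) + 1"
proof -
  have "I i \<sigma> \<Longrightarrow> i \<le> m \<Longrightarrow> \<exists>t \<sigma>'. exec (WhileNZ r B) \<sigma> t \<sigma>' \<and> I m \<sigma>' \<and> t \<le> (m - i) * (T + 1) + 1" for i \<sigma>
  proof (induction "m - i" arbitrary: i \<sigma>)
    case 0
    then have "I m \<sigma>" by simp
    with stop[of \<sigma>] exec.WhileFalse[of "fst \<sigma>" r B "snd \<sigma>"] show ?case
      by (intro exI[of _ 1] exI[of _ \<sigma>]) auto
  next
    case (Suc q)
    then have "i < m" by simp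
    from step[OF this Suc.prems(1)] obtain t \<sigma>' where 1: "fst \<sigma> r \<noteq> 0" "exec B \<sigma> t \<sigma>'" "I (Suc i) \<sigma>'" "t \<le> T"
      by auto
    have "q = m - Suc i" "Suc i \<le> m" using Suc.hyps(2) by auto
    with Suc.hyps(1)[OF _ 1(3)] obtain u \<sigma>2 where 2: "exec (WhileNZ r B) \<sigma>' u \<sigma>2" "I m \<sigma>2"
      "u \<le> q * (T + 1) + 1" by auto
    have "exec (WhileNZ r B) \<sigma> (1 + t + u) \<sigma>2"
      using exec.WhileTrue[of "fst \<sigma>" r B "snd \<sigma>" t \<sigma>' u \<sigma>2] 1 2 by simp
    moreover have "1 + t + u \<le> (m - i) * (T + 1) + 1"
      using 1 2 unfolding Suc.hyps(2)[symmetric] by simp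
    ultimately show ?case using 2 by blast
  qed
  from this[OF assms(1)] show ?thesis by simp
qed

lemma two_mult_neq_Suc_two_mult [simp]: "2 * x \<noteq> Suc (2 * y)" "Suc (2 * y) \<noteq> 2 * x"
  "2 * x \<noteq> Suc (Suc (Suc (2 * y)))" "Suc (Suc (Suc (2 * y))) \<noteq> 2 * x"
  by presburger+

lemma exec_addr: "exec (addr a d) (R, M) 7 (R(tmp d := R 0 + 16 * R (tmp d) + a, tmp (Suc d) := a), M)"
proof -
  have "\<exists>t R'. exec (addr a d) (R, M) t (R', M) \<and> t = 7 \<and> R' = R(tmp d := R 0 + 16 * R (tmp d) + a, tmp (Suc d) := a)"
    unfolding addr_def
    by (intro exI conjI, (rule exec.intros)+) (auto simp: fun_eq_iff)
  then show ?thesis by auto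
qed

lemma exec_cex:
  assumes "rep s off (R, M)" "wfe C e" "\<forall>x\<in>C. fst s x \<le> Z"
  shows "\<exists>t R'. exec (cex e d) (R, M) t (R', M) \<and> R' (tmp d) = ev e s
     \<and> (\<forall>r. r < tmp d \<or> even r \<longrightarrow> R' r = R r) \<and> t \<le> we e * (Z + 1)"
  using assms
proof (induction e arbitrary: d R)
  case (Num c)
  have "exec (cex (Num c) d) (R, M) 1 (R(tmp d := c), M)" unfolding cex.simps by (rule exec.Const)
  moreover have "(R(tmp d := c)) (tmp d) = ev (Num c) s" "\<forall>r. r < tmp d \<or> even r \<longrightarrow> (R(tmp d := c)) r = R r"
    "1 \<le> we (Num c) * (Z + 1)" by auto
  ultimately show ?case by blast
next
  case (Var x)
  then have "R (2 * x + 2) = fst s x" by (simp add: rep_def)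
  moreover have "exec (cex (Var x) d) (R, M) 1 (R(tmp d := R (2 * x + 2)), M)"
    unfolding cex.simps by (rule exec.Copy)
  moreover have "(R(tmp d := R (2 * x + 2))) (tmp d) = ev (Var x) s"
    "\<forall>r. r < tmp d \<or> even r \<longrightarrow> (R(tmp d := R (2 * x + 2))) r = R r" "1 \<le> we (Var x) * (Z + 1)"
    using \<open>R (2 * x + 2) = fst s x\<close> by auto
  ultimately show ?case by blast
next
  case (Arr a e)
  then have wf: "wfe C e" by auto
  from Arr.IH(1)[OF Arr.prems(1) wf Arr.prems(3), of d] obtain t R' where 1: "exec (cex e d) (R, M) t (R', M)" "R' (tmp d) = ev e s"
    "\<forall>r. r < tmp d \<or> even r \<longrightarrow> R' r = R r" "t \<le> we e * (Z + 1)" by blast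
  let ?R = "R'(tmp d := R' 0 + 16 * R' (tmp d) + a, tmp (Suc d) := a)"
  have "exec (cex (Arr a e) d) (R, M) (t + (7 + 1)) (?R(tmp d := M (?R (tmp d))), M)"
    unfolding cex.simps by (rule exec.Seq[OF 1(1) exec.Seq[OF exec_addr exec.Load]])
  moreover have "M (?R (tmp d)) = ev (Arr a e) s"
    using 1(2,3) Arr.prems by (simp add: rep_def)
  then have "(?R(tmp d := M (?R (tmp d)))) (tmp d) = ev (Arr a e) s" by simp
  moreover have "\<forall>r. r < tmp d \<or> even r \<longrightarrow> (?R(tmp d := M (?R (tmp d)))) r = R r" using 1(3) by auto
  moreover have "t + (7 + 1) \<le> we (Arr a e) * (Z + 1)" using 1(4) by (simp add: add_mult_distrib)
  ultimately show ?case by blast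
next
  case (Plus e f)
  then have wf: "wfe C e" "wfe C f" by auto
  from Plus.IH(1)[OF Plus.prems(1) wf(1) Plus.prems(3), of d] obtain t R' where 1: "exec (cex e d) (R, M) t (R', M)" "R' (tmp d) = ev e s"
    "\<forall>r. r < tmp d \<or> even r \<longrightarrow> R' r = R r" "t \<le> we e * (Z + 1)" by blast
  have "rep s off (R', M)" using Plus.prems(1) 1(3) by (auto simp: rep_def)
  from Plus.IH(2)[OF this wf(2) Plus.prems(3), of "Suc d"] obtain u R2 where 2: "exec (cex f (Suc d)) (R', M) u (R2, M)" "R2 (tmp (Suc d)) = ev f s"
    "\<forall>r. r < tmp (Suc d) \<or> even r \<longrightarrow> R2 r = R' r" "u \<le> we f * (Z + 1)" by blast
  have "exec (cex (Plus e f) d) (R, M) (t + (u + 1)) (R2(tmp d := R2 (tmp d) + R2 (tmp (Suc d))), M)"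
    unfolding cex.simps by (rule exec.Seq[OF 1(1) exec.Seq[OF 2(1) exec.Add]])
  moreover have "R2 (tmp d) = ev e s" using 1(2) 2(3) by simp
  then have "(R2(tmp d := R2 (tmp d) + R2 (tmp (Suc d)))) (tmp d) = ev (Plus e f) s" using 2(2) by simp
  moreover have "\<forall>r. r < tmp d \<or> even r \<longrightarrow> (R2(tmp d := R2 (tmp d) + R2 (tmp (Suc d)))) r = R r" using 1(3) 2(3) by auto
  moreover have "t + (u + 1) \<le> we (Plus e f) * (Z + 1)" using 1(4) 2(4) by (simp add: add_mult_distrib)
  ultimately show ?case by blast
next
  case (Minus e f)
  then have wf: "wfe C e" "wfe C f" by auto
  from Minus.IH(1)[OF Minus.prems(1) wf(1) Minus.prems(3), of d] obtain t R' where 1: "exec (cex e d) (R, M) t (R', M)" "R' (tmp d) = ev e s"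
    "\<forall>r. r < tmp d \<or> even r \<longrightarrow> R' r = R r" "t \<le> we e * (Z + 1)" by blast
  have "rep s off (R', M)" using Minus.prems(1) 1(3) by (auto simp: rep_def)
  from Minus.IH(2)[OF this wf(2) Minus.prems(3), of "Suc d"] obtain u R2 where 2: "exec (cex f (Suc d)) (R', M) u (R2, M)" "R2 (tmp (Suc d)) = ev f s"
    "\<forall>r. r < tmp (Suc d) \<or> even r \<longrightarrow> R2 r = R' r" "u \<le> we f * (Z + 1)" by blast
  have "exec (cex (Minus e f) d) (R, M) (t + (u + 1)) (R2(tmp d := R2 (tmp d) - R2 (tmp (Suc d))), M)"
    unfolding cex.simps by (rule exec.Seq[OF 1(1) exec.Seq[OF 2(1) exec.Sub]])
  moreover have "R2 (tmp d) = ev e s" using 1(2) 2(3) by simp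
  then have "(R2(tmp d := R2 (tmp d) - R2 (tmp (Suc d)))) (tmp d) = ev (Minus e f) s" using 2(2) by simp
  moreover have "\<forall>r. r < tmp d \<or> even r \<longrightarrow> (R2(tmp d := R2 (tmp d) - R2 (tmp (Suc d)))) r = R r" using 1(3) 2(3) by auto
  moreover have "t + (u + 1) \<le> we (Minus e f) * (Z + 1)" using 1(4) 2(4) by (simp add: add_mult_distrib)
  ultimately show ?case by blast
next
  case (Times e x)
  then have wf: "wfe C e" by auto
  from Times.IH(1)[OF Times.prems(1) wf Times.prems(3), of d] obtain t R' where 1: "exec (cex e d) (R, M) t (R', M)" "R' (tmp d) = ev e s"
    "\<forall>r. r < tmp d \<or> even r \<longrightarrow> R' r = R r" "t \<le> we e * (Z + 1)" by blast
  define m where "m = fst s x"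
  have m: "R' (2 * x + 2) = m" "m \<le> Z" using Times.prems 1(3) by (auto simp: rep_def m_def)
  let ?R = "R'(tmp (d + 1) := m, tmp (d + 2) := 0, tmp (d + 3) := 1)"
  let ?W = "WhileNZ (tmp (d + 1)) (Seq (Add (tmp (d + 2)) (tmp (d + 2)) (tmp d))
        (Sub (tmp (d + 1)) (tmp (d + 1)) (tmp (d + 3))))"
  define I where "I i \<sigma> \<longleftrightarrow> snd \<sigma> = M \<and> fst \<sigma> (tmp (d + 1)) = m - i \<and> fst \<sigma> (tmp (d + 2)) = ev e s * i
     \<and> fst \<sigma> (tmp (d + 3)) = 1 \<and> (\<forall>r. r \<le> tmp d \<or> even r \<longrightarrow> fst \<sigma> r = R' r)" for i and \<sigma> :: ram_state
  have "\<exists>t \<sigma>. exec ?W (?R, M) t \<sigma> \<and> I m \<sigma> \<and> t \<le> m * (2 + 1) + 1"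
  proof (rule exec_while_count)
    show "I 0 (?R, M)" by (auto simp: I_def)
  next
    fix i and \<sigma> :: ram_state assume i: "i < m" "I i \<sigma>"
    obtain Ra Ma where \<sigma>: "\<sigma> = (Ra, Ma)" by (cases \<sigma>)
    let ?Rb = "Ra(tmp (d + 2) := Ra (tmp (d + 2)) + Ra (tmp d))"
    let ?Rc = "?Rb(tmp (d + 1) := ?Rb (tmp (d + 1)) - ?Rb (tmp (d + 3)))"
    have E: "exec (Seq (Add (tmp (d + 2)) (tmp (d + 2)) (tmp d))
        (Sub (tmp (d + 1)) (tmp (d + 1)) (tmp (d + 3)))) \<sigma> (1 + 1) (?Rc, Ma)"
      unfolding \<sigma> by (rule exec.Seq[OF exec.Add exec.Sub])
    have I': "I (Suc i) (?Rc, Ma)" using i 1(2) by (auto simp: I_def \<sigma>)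
    have nz: "fst \<sigma> (tmp (d + 1)) \<noteq> 0" using i by (auto simp: I_def)
    show "fst \<sigma> (tmp (d + 1)) \<noteq> 0 \<and> (\<exists>t \<sigma>'. exec (Seq (Add (tmp (d + 2)) (tmp (d + 2)) (tmp d))
        (Sub (tmp (d + 1)) (tmp (d + 1)) (tmp (d + 3)))) \<sigma> t \<sigma>' \<and> I (Suc i) \<sigma>' \<and> t \<le> 2)"
      by (intro conjI nz exI[of _ "1 + 1"] exI[of _ "(?Rc, Ma)"] E I') simp
  qed (simp add: I_def)
  then obtain u R2 where 2: "exec ?W (?R, M) u (R2, M)" "I m (R2, M)" "u \<le> m * (2 + 1) + 1"
    by (auto simp: I_def)
  have "exec (cex (Times e x) d) (R, M) (t + (1 + (1 + (1 + (u + 1))))) (R2(tmp d := R2 (tmp (d + 2))), M)"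
    unfolding cex.simps
    apply (rule exec.Seq[OF 1(1)], rule exec.Seq, rule exec.Copy, rule exec.Seq, rule exec.Const,
        rule exec.Seq, rule exec.Const, rule exec.Seq)
    using 2(1) m apply simp
    by (rule exec.Copy)
  moreover have "t + (1 + (1 + (1 + (u + 1)))) \<le> we (Times e x) * (Z + 1)"
    using 1(4) 2(3) m(2) by (simp add: add_mult_distrib)
  moreover have "(R2(tmp d := R2 (tmp (d + 2)))) (tmp d) = ev (Times e x) s"
    using 2(2) by (simp add: I_def m_def)
  moreover have "\<forall>r. r < tmp d \<or> even r \<longrightarrow> (R2(tmp d := R2 (tmp (d + 2)))) r = R r"
  proof (intro allI impI)
    fix r assume r: "r < tmp d \<or> even r"
    then have "r \<noteq> tmp d" by auto
    moreover have "R2 r = R' r" using 2(2) r unfolding I_def fst_conv by (metis less_imp_le)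
    ultimately show "(R2(tmp d := R2 (tmp (d + 2)))) r = R r" using r 1(3) by auto
  qed
  ultimately show ?case by blast
qed

theorem exec_cst:
  assumes "rep s off \<sigma>" "wfs C P" "\<forall>x\<in>C. fst s x \<le> Z"
  shows "\<exists>t \<sigma>'. exec (cst P d) \<sigma> t \<sigma>' \<and> rep (sem P s) off \<sigma>'
     \<and> (\<forall>r < d. fst \<sigma>' (tmp r) = fst \<sigma> (tmp r)) \<and> t \<le> ws P * (Z + 1) ^ dp P"
  using assms
proof (induction P arbitrary: d s \<sigma>)
  case Nop
  then show ?case using exec.Skip[of \<sigma>] by (intro exI[of _ 1] exI[of _ \<sigma>]) auto
next
  case (Asg x e)
  obtain R M where \<sigma>: "\<sigma> = (R, M)" by (cases \<sigma>)
  from Asg exec_cex[of s off R M C e Z d] obtain t R' where 1: "exec (cex e d) (R, M) t (R', M)" "R' (tmp d) = ev e s"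
    "\<forall>r. r < tmp d \<or> even r \<longrightarrow> R' r = R r" "t \<le> we e * (Z + 1)" unfolding \<sigma> wfs.simps by blast
  have "exec (cst (Asg x e) d) \<sigma> (t + 1) (R'(2 * x + 2 := R' (tmp d)), M)"
    unfolding cst.simps \<sigma> by (rule exec.Seq[OF 1(1) exec.Copy])
  moreover have "rep (sem (Asg x e) s) off (R'(2 * x + 2 := R' (tmp d)), M)"
    using Asg.prems(1) 1(2,3) by (auto simp: rep_def \<sigma>)
  moreover have "\<forall>r < d. (R'(2 * x + 2 := R' (tmp d))) (tmp r) = R (tmp r)"
  proof (intro allI impI)
    fix r assume "r < d"
    moreover have "tmp r \<noteq> 2 * x + 2" by presburger
    ultimately show "(R'(2 * x + 2 := R' (tmp d))) (tmp r) = R (tmp r)" using 1(3) by auto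
  qed
  ultimately show ?case using 1(4)
    by (intro exI[of _ "t + 1"] exI[of _ "(R'(2 * x + 2 := R' (tmp d)), M)"]) (auto simp: \<sigma>)
next
  case (Wr a i e)
  obtain R M where \<sigma>: "\<sigma> = (R, M)" by (cases \<sigma>)
  from Wr exec_cex[of s off R M C i Z d] obtain t R' where 1: "exec (cex i d) (R, M) t (R', M)" "R' (tmp d) = ev i s"
    "\<forall>r. r < tmp d \<or> even r \<longrightarrow> R' r = R r" "t \<le> we i * (Z + 1)" unfolding \<sigma> wfs.simps by blast
  let ?R = "R'(tmp d := R' 0 + 16 * R' (tmp d) + a, tmp (Suc d) := a)"
  have ne: "2 * x + 2 \<noteq> tmp y" for x y by presburger
  have "rep s off (?R, M)" using Wr.prems(1) 1(3) ne by (auto simp: rep_def \<sigma>)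
  with Wr exec_cex[of s off ?R M C e Z "Suc d"] obtain u R2 where 2: "exec (cex e (Suc d)) (?R, M) u (R2, M)"
    "R2 (tmp (Suc d)) = ev e s"
    "\<forall>r. r < tmp (Suc d) \<or> even r \<longrightarrow> R2 r = ?R r" "u \<le> we e * (Z + 1)"
    unfolding wfs.simps by blast
  have R2: "R2 (tmp d) = off + 16 * ev i s + a" using 2(3) 1(2,3) Wr.prems(1) by (auto simp: rep_def \<sigma>)
  have "exec (cst (Wr a i e) d) \<sigma> (t + (7 + (u + 1))) (R2, M(R2 (tmp d) := R2 (tmp (Suc d))))"
    unfolding cst.simps \<sigma> by (rule exec.Seq[OF 1(1) exec.Seq[OF exec_addr exec.Seq[OF 2(1) exec.Store]]])
  moreover have "rep (sem (Wr a i e) s) off (R2, M(R2 (tmp d) := R2 (tmp (Suc d))))"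
  proof -
    \<comment> \<open>An address determines index and array, since the array number is a remainder
      modulo 16; a write therefore disturbs no other cell.\<close>
    have "off + 16 * x + y = off + 16 * x' + y' \<longleftrightarrow> x = x' \<and> y = y'" if "y < 16" "y' < 16" for x y x' y' :: nat
    proof
      assume "off + 16 * x + y = off + 16 * x' + y'"
      then have "16 * x + y = 16 * x' + y'" by simp
      moreover have "(16 * x + y) div 16 = x" "(16 * x' + y') div 16 = x'" using that by auto
      ultimately have "x = x'" by metis
      with \<open>16 * x + y = 16 * x' + y'\<close> show "x = x' \<and> y = y'" by simp
    qed simp
    moreover have "R2 0 = off" using 2(3) 1(3) Wr.prems(1) by (auto simp: rep_def \<sigma>)
    moreover have "R2 (2 * x + 2) = fst s x" for x
      using 2(3) 1(3) Wr.prems(1) ne by (auto simp: rep_def \<sigma>)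
    ultimately show ?thesis
      using Wr.prems(1,2) unfolding R2 2(2) by (auto simp: rep_def \<sigma>)
  qed
  moreover have "\<forall>r < d. R2 (tmp r) = R (tmp r)" using 2(3) 1(3) by auto
  ultimately show ?case using 1(4) 2(4)
    by (intro exI[of _ "t + (7 + (u + 1))"] exI[of _ "(R2, M(R2 (tmp d) := R2 (tmp (Suc d))))"])
       (auto simp: \<sigma> add_mult_distrib)
next
  case (Sq P Q)
  then obtain t \<sigma>' where 1: "exec (cst P d) \<sigma> t \<sigma>'" "rep (sem P s) off \<sigma>'"
    "\<forall>r < d. fst \<sigma>' (tmp r) = fst \<sigma> (tmp r)" "t \<le> ws P * (Z + 1) ^ dp P" unfolding wfs.simps by meson
  have "\<forall>x\<in>C. fst (sem P s) x \<le> Z" using Sq.prems wfs_mv[of C P] by (auto simp: sem_frame_var)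
  with Sq 1(2) obtain u \<sigma>2 where 2: "exec (cst Q d) \<sigma>' u \<sigma>2" "rep (sem Q (sem P s)) off \<sigma>2"
    "\<forall>r < d. fst \<sigma>2 (tmp r) = fst \<sigma>' (tmp r)" "u \<le> ws Q * (Z + 1) ^ dp Q" unfolding wfs.simps by meson
  have "t \<le> ws P * (Z + 1) ^ max (dp P) (dp Q)"
    by (rule order_trans[OF 1(4)]) (intro mult_le_mono2 power_increasing; simp)
  moreover have "u \<le> ws Q * (Z + 1) ^ max (dp P) (dp Q)"
    by (rule order_trans[OF 2(4)]) (intro mult_le_mono2 power_increasing; simp)
  ultimately have "t + u \<le> ws (Sq P Q) * (Z + 1) ^ dp (Sq P Q)" by (simp add: add_mult_distrib)
  with exec.Seq[OF 1(1) 2(1)] 1(3) 2(2,3) show ?case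
    by (intro exI[of _ "t + u"] exI[of _ \<sigma>2]) auto
next
  case (Cond e P Q)
  obtain R M where \<sigma>: "\<sigma> = (R, M)" by (cases \<sigma>)
  from Cond.prems exec_cex[of s off R M C e Z d] obtain t R' where 1: "exec (cex e d) (R, M) t (R', M)" "R' (tmp d) = ev e s"
    "\<forall>r. r < tmp d \<or> even r \<longrightarrow> R' r = R r" "t \<le> we e * (Z + 1)" unfolding \<sigma> wfs.simps by blast
  have rep': "rep s off (R', M)" using Cond.prems(1) 1(3) by (auto simp: rep_def \<sigma>)
  have te: "t \<le> we e * (Z + 1) ^ max (dp P) (dp Q)"
  proof -
    have "dp P \<ge> 1" by (induction P) auto
    then have "(Z + 1) ^ 1 \<le> (Z + 1) ^ max (dp P) (dp Q)" by (intro power_increasing) auto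
    then show ?thesis by (intro order_trans[OF 1(4)] mult_le_mono2) simp
  qed
  have one: "1 \<le> (Z + 1) ^ max (dp P) (dp Q)" by simp
  show ?case
  proof (cases "ev e s = 0")
    case False
    from Cond.prems Cond.IH(1)[OF rep'] obtain u \<sigma>2 where 2: "exec (cst P d) (R', M) u \<sigma>2" "rep (sem P s) off \<sigma>2"
    "\<forall>r < d. fst \<sigma>2 (tmp r) = fst (R', M) (tmp r)" "u \<le> ws P * (Z + 1) ^ dp P" unfolding wfs.simps by meson
    have "u \<le> ws P * (Z + 1) ^ max (dp P) (dp Q)"
      by (rule order_trans[OF 2(4)]) (intro mult_le_mono2 power_increasing; simp)
    with te one have "t + (1 + u) \<le> ws (Cond e P Q) * (Z + 1) ^ dp (Cond e P Q)"
      unfolding ws.simps dp.simps add_mult_distrib by linarith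
    moreover have "exec (cst (Cond e P Q) d) \<sigma> (t + (1 + u)) \<sigma>2" unfolding cst.simps \<sigma>
      by (rule exec.Seq[OF 1(1) exec.IfTrue[OF _ 2(1)]]) (use 1(2) False in simp)
    moreover have "\<forall>r < d. fst \<sigma>2 (tmp r) = fst \<sigma> (tmp r)" using 2(3) 1(3) by (auto simp: \<sigma>)
    ultimately show ?thesis using 2(2) False
      by (intro exI[of _ "t + (1 + u)"] exI[of _ \<sigma>2]) (simp only: sem.simps if_True HOL.simp_thms not_False_eq_True)
  next
    case True
    from Cond.prems Cond.IH(2)[OF rep'] obtain u \<sigma>2 where 2: "exec (cst Q d) (R', M) u \<sigma>2" "rep (sem Q s) off \<sigma>2"
    "\<forall>r < d. fst \<sigma>2 (tmp r) = fst (R', M) (tmp r)" "u \<le> ws Q * (Z + 1) ^ dp Q" unfolding wfs.simps by meson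
    have "u \<le> ws Q * (Z + 1) ^ max (dp P) (dp Q)"
      by (rule order_trans[OF 2(4)]) (intro mult_le_mono2 power_increasing; simp)
    with te one have "t + (1 + u) \<le> ws (Cond e P Q) * (Z + 1) ^ dp (Cond e P Q)"
      unfolding ws.simps dp.simps add_mult_distrib by linarith
    moreover have "exec (cst (Cond e P Q) d) \<sigma> (t + (1 + u)) \<sigma>2" unfolding cst.simps \<sigma>
      by (rule exec.Seq[OF 1(1) exec.IfFalse[OF _ 2(1)]]) (use 1(2) True in simp)
    moreover have "\<forall>r < d. fst \<sigma>2 (tmp r) = fst \<sigma> (tmp r)" using 2(3) 1(3) by (auto simp: \<sigma>)
    ultimately show ?thesis using 2(2) True
      by (intro exI[of _ "t + (1 + u)"] exI[of _ \<sigma>2]) (simp only: sem.simps if_False HOL.simp_thms not_False_eq_True)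
  qed
next
  case (For x c P)
  obtain R M where \<sigma>: "\<sigma> = (R, M)" by (cases \<sigma>)
  define m where "m = fst s c"
  define f where "f i = fold (\<lambda>i s. sem P ((fst s)(x := i), snd s)) [0..<i] s" for i
  have fS: "f (Suc i) = sem P ((fst (f i))(x := i), snd (f i))" for i by (simp add: f_def)
  have wfP: "wfs C P" "x \<notin> C" "c \<in> C" using For.prems by auto
  have fC: "\<forall>y\<in>C. fst (f i) y \<le> Z" for i
  proof (induction i)
    case 0
    then show ?case using For.prems by (simp add: f_def)
  next
    case (Suc i)
    then show ?case using Suc wfs_mv[OF wfP(1)] wfP(2) unfolding fS by (auto simp: sem_frame_var)
  qed
  have m: "R (2 * c + 2) = m" "m \<le> Z" using For.prems by (auto simp: rep_def \<sigma> m_def)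
  have ne: "2 * x + 2 \<noteq> tmp y" for x y by presburger
  let ?R = "R(tmp d := m, tmp (d + 1) := 0)"
  let ?B = "Seq (Copy (2 * x + 2) (tmp (d + 1))) (Seq (cst P (d + 2))
        (Seq (Const (tmp (d + 2)) 1) (Seq (Add (tmp (d + 1)) (tmp (d + 1)) (tmp (d + 2)))
           (Sub (tmp d) (tmp d) (tmp (d + 2))))))"
  let ?T = "ws P * (Z + 1) ^ dp P + 4"
  define I where "I i \<sigma>' \<longleftrightarrow> rep (f i) off \<sigma>' \<and> fst \<sigma>' (tmp d) = m - i \<and> fst \<sigma>' (tmp (d + 1)) = i
     \<and> (\<forall>r<d. fst \<sigma>' (tmp r) = R (tmp r))" for i and \<sigma>' :: ram_state
  have "\<exists>t \<sigma>'. exec (WhileNZ (tmp d) ?B) (?R, M) t \<sigma>' \<and> I m \<sigma>' \<and> t \<le> m * (?T + 1) + 1"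
  proof (rule exec_while_count)
    show "I 0 (?R, M)" using For.prems(1) ne by (auto simp: I_def f_def rep_def \<sigma>)
  next
    fix i and \<sigma>1 :: ram_state assume i: "i < m" "I i \<sigma>1"
    obtain Ra Ma where \<sigma>1: "\<sigma>1 = (Ra, Ma)" by (cases \<sigma>1)
    have "rep ((fst (f i))(x := i), snd (f i)) off (Ra(2 * x + 2 := Ra (tmp (d + 1))), Ma)"
      using i(2) by (auto simp: I_def rep_def \<sigma>1)
    moreover have "\<forall>y\<in>C. fst ((fst (f i))(x := i), snd (f i)) y \<le> Z" using fC[of i] wfP(2) by auto
    ultimately obtain t \<sigma>2
      where 2: "exec (cst P (d + 2)) (Ra(2 * x + 2 := Ra (tmp (d + 1))), Ma) t \<sigma>2"
        "rep (f (Suc i)) off \<sigma>2"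
        "\<forall>r < d + 2. fst \<sigma>2 (tmp r) = fst (Ra(2 * x + 2 := Ra (tmp (d + 1))), Ma) (tmp r)" "t \<le> ws P * (Z + 1) ^ dp P"
      unfolding fS using For.IH[OF _ wfP(1), of _ _ "d + 2"] by blast
    obtain Rb Mb where \<sigma>2: "\<sigma>2 = (Rb, Mb)" by (cases \<sigma>2)
    let ?R1 = "Rb(tmp (d + 2) := 1)"
    let ?R2 = "?R1(tmp (d + 1) := ?R1 (tmp (d + 1)) + ?R1 (tmp (d + 2)))"
    let ?R3 = "?R2(tmp d := ?R2 (tmp d) - ?R2 (tmp (d + 2)))"
    have E: "exec ?B \<sigma>1 (1 + (t + (1 + (1 + 1)))) (?R3, Mb)"
      unfolding \<sigma>1
      by (rule exec.Seq[OF exec.Copy exec.Seq[OF 2(1)[unfolded \<sigma>2] exec.Seq[OF exec.Const exec.Seq[OF exec.Add exec.Sub]]]])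
    have Rb: "Rb (tmp r) = Ra (tmp r)" if "r < d + 2" for r
      using 2(3) that ne[symmetric] by (auto simp: \<sigma>2)
    have I': "I (Suc i) (?R3, Mb)"
      unfolding I_def using i 2(2) Rb[of d] Rb[of "d+1"] Rb ne
      by (auto simp: \<sigma>2 rep_def I_def \<sigma>1)
    have nz: "fst \<sigma>1 (tmp d) \<noteq> 0" using i by (auto simp: I_def)
    show "fst \<sigma>1 (tmp d) \<noteq> 0 \<and> (\<exists>t \<sigma>'. exec ?B \<sigma>1 t \<sigma>' \<and> I (Suc i) \<sigma>' \<and> t \<le> ?T)"
      by (intro conjI nz exI[of _ "1 + (t + (1 + (1 + 1)))"] exI[of _ "(?R3, Mb)"] E I') (use 2(4) in simp)
  qed (simp add: I_def)
  then obtain t \<sigma>' where 1: "exec (WhileNZ (tmp d) ?B) (?R, M) t \<sigma>'" "I m \<sigma>'" "t \<le> m * (?T + 1) + 1" by auto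
  have "exec (cst (For x c P) d) \<sigma> (1 + (1 + t)) \<sigma>'"
    unfolding cst.simps \<sigma>
    apply (rule exec.Seq, rule exec.Copy, rule exec.Seq, rule exec.Const)
    using 1(1) m(1) by simp
  moreover have "1 + (1 + t) \<le> ws (For x c P) * (Z + 1) ^ dp (For x c P)"
  proof -
    define Y where "Y = (Z + 1) ^ dp P"
    have Y: "Y \<ge> 1" by (simp add: Y_def)
    have "t \<le> Z * (ws P * Y + 5) + 1" 
      by (rule order_trans[OF 1(3)]) (use mult_le_mono1[OF m(2), of "?T + 1"] in \<open>simp add: Y_def add.commute\<close>)
    moreover have "Z * (ws P * Y + 5) + 3 \<le> (Z + 1) * (ws P * Y + 9 * Y)"
    proof -
      have "Z * (ws P * Y + 5) + 3 \<le> Z * (ws P * Y + 9 * Y) + (ws P * Y + 9 * Y)"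
        using Y by (intro add_le_mono mult_le_mono2) auto
      then show ?thesis by simp
    qed
    ultimately show ?thesis by (simp add: Y_def algebra_simps)
  qed
  moreover have "rep (sem (For x c P) s) off \<sigma>'" using 1(2) by (simp add: I_def f_def m_def)
  ultimately show ?case using 1(2)
    by (intro exI[of _ "1 + (1 + t)"] exI[of _ \<sigma>']) (auto simp: I_def \<sigma>)
qed


section \<open>Boolean expressions and the routines for pieces and verification\<close>

section \<open>Programs\<close>

definition tt :: "ex \<Rightarrow> st \<Rightarrow> bool" where "tt e s \<longleftrightarrow> ev e s \<noteq> 0"

text \<open>With truncated subtraction \<open>e - (e - f)\<close> is the minimum of \<open>e\<close>
  and \<open>f\<close>, which is nonzero exactly if both are.\<close>

definition And :: "ex \<Rightarrow> ex \<Rightarrow> ex" where "And e f = Minus e (Minus e f)"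
definition Not :: "ex \<Rightarrow> ex" where "Not e = Minus (Num 1) e"
definition Le :: "ex \<Rightarrow> ex \<Rightarrow> ex" where "Le e f = Minus (Plus f (Num 1)) e"
definition Eq :: "ex \<Rightarrow> ex \<Rightarrow> ex" where "Eq e f = Minus (Num 1) (Plus (Minus e f) (Minus f e))"

lemma tt_simps [simp]:
  "tt (Num c) s \<longleftrightarrow> c \<noteq> 0"
  "tt (Var x) s \<longleftrightarrow> fst s x \<noteq> 0"
  "tt (Arr a e) s \<longleftrightarrow> snd s a (ev e s) \<noteq> 0"
  "tt (Plus e f) s \<longleftrightarrow> tt e s \<or> tt f s"
  "tt (And e f) s \<longleftrightarrow> tt e s \<and> tt f s"
  "tt (Not e) s \<longleftrightarrow> \<not> tt e s"
  "tt (Le e f) s \<longleftrightarrow> ev e s \<le> ev f s"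
  "tt (Eq e f) s \<longleftrightarrow> ev e s = ev f s"
  by (auto simp: tt_def And_def Not_def Le_def Eq_def)

lemma sem_Cond [simp]: "sem (Cond e P Q) s = (if tt e s then sem P s else sem Q s)"
  by (simp add: tt_def)

declare sem.simps(5) [simp del]
declare sem.simps(6) [simp del]
declare sem_frame_var [simp] sem_frame_arr [simp]

abbreviation "inc x \<equiv> Asg x (Plus (Var x) (Num 1))"

abbreviation (input) vAns :: nat where "vAns \<equiv> 0"
abbreviation (input) vN :: nat where "vN \<equiv> 35"
abbreviation (input) vb :: nat where "vb \<equiv> 2"
abbreviation (input) vk :: nat where "vk \<equiv> 3"
abbreviation (input) vp :: nat where "vp \<equiv> 4"
abbreviation (input) vBl :: nat where "vBl \<equiv> 5"
abbreviation (input) vPl :: nat where "vPl \<equiv> 6"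
abbreviation (input) vD :: nat where "vD \<equiv> 7"
abbreviation (input) vB :: nat where "vB \<equiv> 8"
abbreviation (input) vNN :: nat where "vNN \<equiv> 9"
abbreviation (input) vW :: nat where "vW \<equiv> 10"
abbreviation (input) vC :: nat where "vC \<equiv> 11"
abbreviation (input) vU :: nat where "vU \<equiv> 12"
abbreviation (input) vV :: nat where "vV \<equiv> 13"
abbreviation (input) vR :: nat where "vR \<equiv> 14"
abbreviation (input) vSz :: nat where "vSz \<equiv> 15"
abbreviation (input) vAsz :: nat where "vAsz \<equiv> 16"
abbreviation (input) vX :: nat where "vX \<equiv> 17"
abbreviation (input) vBit :: nat where "vBit \<equiv> 18"
abbreviation (input) vHalf :: nat where "vHalf \<equiv> 19"
abbreviation (input) vZ :: nat where "vZ \<equiv> 20"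
abbreviation (input) vLen :: nat where "vLen \<equiv> 21"
abbreviation (input) vT :: nat where "vT \<equiv> 22"
abbreviation (input) vY :: nat where "vY \<equiv> 23"
abbreviation (input) vS :: nat where "vS \<equiv> 24"
abbreviation (input) vG :: nat where "vG \<equiv> 25"
abbreviation (input) vIt :: nat where "vIt \<equiv> 26"
abbreviation (input) vI :: nat where "vI \<equiv> 28"
abbreviation (input) vSi :: nat where "vSi \<equiv> 29"
abbreviation (input) vJ :: nat where "vJ \<equiv> 30"
abbreviation (input) vM :: nat where "vM \<equiv> 31"
abbreviation (input) vCnt :: nat where "vCnt \<equiv> 32"
abbreviation (input) vOk :: nat where "vOk \<equiv> 34"
abbreviation (input) vG1 :: nat where "vG1 \<equiv> 27"
abbreviation (input) vQuo :: nat where "vQuo \<equiv> 37"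

abbreviation (input) aA :: nat where "aA \<equiv> 11"
abbreviation (input) aH :: nat where "aH \<equiv> 2"
abbreviation (input) aQ :: nat where "aQ \<equiv> 3"
abbreviation (input) aInq :: nat where "aInq \<equiv> 4"
abbreviation (input) aM :: nat where "aM \<equiv> 5"

text \<open>Array 0 holds the input: four numbers, then the adjacency matrix row by row.\<close>

definition Adj :: "ex \<Rightarrow> ex \<Rightarrow> ex" where
  "Adj e f = Arr 0 (Plus (Num 4) (Plus (Times e vN) f))"

definition DEG :: "nat \<Rightarrow> nat \<Rightarrow> stm" where
  "DEG a x = Sq (Asg vC (Num 0)) (For vU vN
     (Cond (And (Arr a (Var vU)) (Adj (Var vU) (Var x))) (inc vC) Nop))"

definition DEL :: stm where
  "DEL = For vV vN (Cond (And (Arr aH (Var vV)) (Not (Arr aA (Var vV))))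
     (Sq (DEG aH vV) (Cond (Le (Var vk) (Var vC)) Nop (Wr aH (Var vV) (Num 0)))) Nop)"

definition COUNT :: stm where
  "COUNT = Sq (Asg vSz (Num 0)) (Sq (Asg vAsz (Num 0)) (For vV vN
     (Sq (Cond (Arr aH (Var vV)) (inc vSz) Nop) (Cond (Arr aA (Var vV)) (inc vAsz) Nop))))"

definition VER :: stm where
  "VER = Sq (For vV vN (Wr aH (Var vV) (Num 1))) (Sq (For vR vN DEL) (Sq COUNT
     (Cond (And (Le (Var vp) (Var vSz)) (Le (Var vAsz) (Var vb))) (Asg vAns (Num 1)) Nop)))"

text \<open>Halving by repeated subtraction. \<open>vNN\<close> iterations suffice as long as the
  number is below \<open>vNN\<close>, as all guesses are.\<close>

definition POP :: stm where
  "POP = Sq (Asg vHalf (Num 0)) (Sq (For vZ vNN (Cond (Le (Num 2) (Var vX))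
     (Sq (Asg vX (Minus (Var vX) (Num 2))) (inc vHalf)) Nop))
     (Sq (Asg vBit (Var vX)) (Asg vX (Var vHalf))))"

definition DIGIT :: "nat \<Rightarrow> stm" where
  "DIGIT y = Sq (Asg vQuo (Num 0)) (Sq (For vZ vNN (Cond (Le (Var vB) (Var vG1))
     (Sq (Asg vG1 (Minus (Var vG1) (Var vB))) (inc vQuo)) Nop))
     (Sq (Asg y (Var vG1)) (Asg vG1 (Var vQuo))))"

definition CLEAR :: "nat \<Rightarrow> stm" where
  "CLEAR a = For vV vN (Wr a (Var vV) (Num 0))"

definition ESTEP :: stm where
  "ESTEP = Cond (And (Not (Le (Var vLen) (Var vT))) (And (Not (Le (Var vPl) (Var vLen)))
       (And (Not (Arr aInq (Var vY)))
         (Plus (Adj (Arr aQ (Var vT)) (Var vY)) (Adj (Var vY) (Arr aQ (Var vT)))))))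
     (Sq POP (Cond (Var vBit)
       (Sq (Wr aQ (Var vLen) (Var vY)) (Sq (Wr aInq (Var vY) (Num 1)) (inc vLen))) Nop)) Nop"

definition EXPL :: stm where
  "EXPL = Sq (CLEAR aInq) (Sq (Wr aQ (Num 0) (Var vS)) (Sq (Wr aInq (Var vS) (Num 1)) (Sq (Asg vLen (Num 1))
     (For vT vPl (For vY vN ESTEP)))))"

definition MARK :: stm where
  "MARK = Sq (CLEAR aM) (For vT vPl (Cond (Le (Var vLen) (Var vT)) Nop
     (Sq POP (Cond (Var vBit) (Wr aM (Arr aQ (Var vT)) (Num 1)) Nop))))"

definition VALID :: stm where
  "VALID = Sq (Asg vOk (Num 1)) (Sq (Asg vAsz (Num 0)) (Sq (For vV vN
     (Sq (Cond (Arr aM (Var vV)) (inc vAsz) Nop)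
       (Cond (And (Arr aInq (Var vV)) (Not (Arr aM (Var vV))))
         (Sq (DEG aInq vV) (Cond (Le (Var vk) (Var vC)) Nop (Asg vOk (Num 0)))) Nop)))
     (Cond (And (Eq (Var vLen) (Var vSi)) (Eq (Var vAsz) (Var vJ))) Nop (Asg vOk (Num 0)))))"

definition PICK :: stm where
  "PICK = Sq (Asg vCnt (Num 0)) (For vS vN (Sq (Asg vX (Var vM)) (Sq EXPL (Sq MARK (Sq VALID
     (Cond (Var vOk) (Sq (Cond (Eq (Var vCnt) (Var vI))
        (For vV vN (Cond (Arr aM (Var vV)) (Wr aA (Var vV) (Num 1)) Nop)) Nop) (inc vCnt)) Nop))))))"

definition SMALL :: stm where
  "SMALL = For vG vNN (Sq (CLEAR aA) (Sq (Asg vG1 (Var vG)) (Sq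
     (For vIt vBl (Sq (DIGIT vI) (Sq (DIGIT vSi) (Sq (DIGIT vJ) (Sq (DIGIT vM) PICK))))) VER)))"

lemma mv_simps [simp]:
  "mv (DEG a x) = {vC, vU}" "mv DEL = {vC, vU, vV}" "mv COUNT = {vSz, vAsz, vV}"
  "mv VER = {vC, vU, vV, vR, vSz, vAsz, vAns}" "mv POP = {vHalf, vZ, vX, vBit}"
  "mv (DIGIT y) = {vQuo, vZ, vG1, y}" "mv (CLEAR a) = {vV}"
  "mv ESTEP = {vHalf, vZ, vX, vBit, vLen}" "mv EXPL = {vHalf, vZ, vX, vBit, vLen, vV, vT, vY}"
  "mv MARK = {vHalf, vZ, vX, vBit, vV, vT}" "mv VALID = {vOk, vAsz, vV, vC, vU}"
  "mv PICK = {vHalf, vZ, vX, vBit, vLen, vV, vT, vY, vOk, vAsz, vC, vU, vS, vCnt}"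
  by (simp_all add: DEG_def DEL_def COUNT_def VER_def POP_def DIGIT_def CLEAR_def ESTEP_def EXPL_def
      MARK_def VALID_def PICK_def, auto)

lemma ma_simps [simp]:
  "ma (DEG a x) = {}" "ma DEL = {aH}" "ma COUNT = {}" "ma VER = {aH}" "ma POP = {}"
  "ma (DIGIT y) = {}" "ma (CLEAR a) = {a}" "ma ESTEP = {aQ, aInq}" "ma EXPL = {aQ, aInq}"
  "ma MARK = {aM}" "ma VALID = {}" "ma PICK = {aQ, aInq, aM, aA}"
  by (simp_all add: DEG_def DEL_def COUNT_def VER_def POP_def DIGIT_def CLEAR_def ESTEP_def EXPL_def
      MARK_def VALID_def PICK_def, auto)

lemma snd_sem_eq: "ma P = {} \<Longrightarrow> snd (sem P s) = snd s"
  by (rule ext) simp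

lemma card_less_Suc_Collect:
  "card {u. u < Suc i \<and> P u} = card {u. u < i \<and> P u} + (if P i then 1 else 0)"
proof -
  have "{u. u < Suc i \<and> P u} = (if P i then insert i {u. u < i \<and> P u} else {u. u < i \<and> P u})"
    by (auto simp: less_Suc_eq)
  then show ?thesis by simp
qed

definition aset :: "nat \<Rightarrow> (nat \<Rightarrow> nat) \<Rightarrow> nat set" where
  "aset m f = {v. v < m \<and> f v \<noteq> 0}"

lemma aset_upd: "v < m \<Longrightarrow> aset m (f(v := c)) = (if c = 0 then aset m f - {v} else insert v (aset m f))"
  by (auto simp: aset_def)

lemma finite_aset [simp]: "finite (aset m f)"
  by (simp add: aset_def)

lemma sem_POP:
  assumes "fst s vX < fst s vNN"
  shows "fst (sem POP s) vBit = fst s vX mod 2" "fst (sem POP s) vX = fst s vX div 2"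
proof -
  define X where "X = fst s vX"
  let ?P = "Cond (Le (Num 2) (Var vX)) (Sq (Asg vX (Minus (Var vX) (Num 2))) (inc vHalf)) Nop"
  define s0 where "s0 = ((fst s)(vHalf := 0), snd s)"
  \<comment> \<open>After \<open>X div 2\<close> subtractions the remaining iterations are idle,
    hence the \<open>min\<close>.\<close>
  define I where "I i s' \<longleftrightarrow> fst s' vX = X - 2 * min i (X div 2) \<and> fst s' vHalf = min i (X div 2)" for i and s' :: st
  have "I (fst s0 vNN) (sem (For vZ vNN ?P) s0)"
  proof (rule sem_For_inv)
    show "I 0 s0" by (simp add: I_def s0_def X_def)
  next
    fix i s' assume "I i s'"
    then show "I (Suc i) (sem ?P ((fst s')(vZ := i), snd s'))"
      by (cases "i < X div 2") (auto simp: I_def min_def)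
  qed
  moreover have "min (fst s vNN) (X div 2) = X div 2" using assms by (simp add: X_def)
  moreover have "X - 2 * (X div 2) = X mod 2" by (rule minus_mult_div_eq_mod)
  ultimately show "fst (sem POP s) vBit = fst s vX mod 2" "fst (sem POP s) vX = fst s vX div 2"
    by (simp_all add: POP_def s0_def I_def X_def)
qed

lemma sem_DIGIT:
  assumes "fst s vG1 < fst s vNN" "0 < fst s vB" "y \<notin> {vQuo, vZ, vG1, vB, vNN}"
  shows "fst (sem (DIGIT y) s) y = fst s vG1 mod fst s vB" "fst (sem (DIGIT y) s) vG1 = fst s vG1 div fst s vB"
proof -
  define X B where "X = fst s vG1" and "B = fst s vB"
  let ?P = "Cond (Le (Var vB) (Var vG1)) (Sq (Asg vG1 (Minus (Var vG1) (Var vB))) (inc vQuo)) Nop"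
  define s0 where "s0 = ((fst s)(vQuo := 0), snd s)"
  define I where "I i s' \<longleftrightarrow> fst s' vG1 = X - B * min i (X div B) \<and> fst s' vQuo = min i (X div B)" for i and s' :: st
  have B: "0 < B" using assms(2) by (simp add: B_def)
  have le: "B * Suc i \<le> X \<longleftrightarrow> i < X div B" for i
    by (metis B Suc_le_eq less_eq_div_iff_mult_less_eq mult.commute)
  have "I (fst s0 vNN) (sem (For vZ vNN ?P) s0)"
  proof (rule sem_For_inv)
    show "I 0 s0" by (simp add: I_def s0_def X_def)
  next
    fix i s' assume i: "I i s'" "\<And>y. y \<noteq> vZ \<Longrightarrow> y \<notin> mv ?P \<Longrightarrow> fst s' y = fst s0 y"
    then have sB: "fst s' vB = B" by (simp add: s0_def B_def)
    have "X - B * (X div B) < B" using B by (simp add: minus_mult_div_eq_mod)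
    then show "I (Suc i) (sem ?P ((fst s')(vZ := i), snd s'))"
      using i(1) sB le[of i] by (cases "i < X div B") (auto simp: I_def min_def)
  qed
  moreover have "min (fst s vNN) (X div B) = X div B"
    using assms(1) div_le_dividend[of X B] unfolding X_def by linarith
  moreover have "X - B * (X div B) = X mod B" by (rule minus_mult_div_eq_mod)
  ultimately show "fst (sem (DIGIT y) s) y = fst s vG1 mod fst s vB" "fst (sem (DIGIT y) s) vG1 = fst s vG1 div fst s vB"
    using assms(3) by (simp_all add: DIGIT_def s0_def I_def X_def B_def)
qed

lemma sem_CLEAR: "v < fst s vN \<Longrightarrow> snd (sem (CLEAR a) s) a v = 0"
proof -
  define I where "I i s' \<longleftrightarrow> (\<forall>v<i. snd s' a v = 0)" for i and s' :: st
  have "I (fst s vN) (sem (CLEAR a) s)" unfolding CLEAR_def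
    by (rule sem_For_inv) (auto simp: I_def less_Suc_eq)
  then show "v < fst s vN \<Longrightarrow> snd (sem (CLEAR a) s) a v = 0" by (simp add: I_def)
qed

lemma aset_CLEAR: "fst s vN = m \<Longrightarrow> aset m (snd (sem (CLEAR a) s) a) = {}"
  using sem_CLEAR by (auto simp: aset_def)


section \<open>Greatest solutions for given anchors, by greedy deletion\<close>

subsection \<open>Checking a set of anchors\<close>

locale core_instance = loopfree_graph n E k D for n E k D +
  fixes b p :: nat
begin

definition env :: "st \<Rightarrow> bool" where
  "env s \<longleftrightarrow> fst s vN = n \<and> fst s vb = b \<and> fst s vk = k \<and> fst s vp = p
     \<and> (\<forall>i<n. \<forall>j<n. snd s 0 (4 + (i * n + j)) \<noteq> 0 \<longleftrightarrow> E i j)"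

text \<open>2, 3, 4 and 35 are the numbers of \<open>vb\<close>, \<open>vk\<close>,
  \<open>vp\<close> and \<open>vN\<close>.\<close>

lemma env_upd [simp]:
  "x \<notin> {2, 3, 4, 35} \<Longrightarrow> env ((fst s)(x := c), snd s) = env s"
  "a \<noteq> 0 \<Longrightarrow> env (fst s, (snd s)(a := g)) = env s"
  by (auto simp: env_def)

lemma env_sem: "mv P \<inter> {2, 3, 4, 35} = {} \<Longrightarrow> 0 \<notin> ma P \<Longrightarrow> env (sem P s) = env s"
proof -
  assume "mv P \<inter> {2, 3, 4, 35} = {}" "0 \<notin> ma P"
  then have "fst (sem P s) 35 = fst s 35" "fst (sem P s) 2 = fst s 2" "fst (sem P s) 3 = fst s 3"
    "fst (sem P s) 4 = fst s 4" "snd (sem P s) 0 = snd s 0" by auto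
  then show ?thesis by (simp add: env_def)
qed

lemma env_cong:
  "\<lbrakk>\<And>y. y \<in> {2, 3, 4, 35} \<Longrightarrow> fst s' y = fst s y; snd s' 0 = snd s 0\<rbrakk> \<Longrightarrow> env s' = env s"
  by (simp add: env_def)

lemma envD: "env s \<Longrightarrow> fst s vN = n" "env s \<Longrightarrow> fst s vb = b" "env s \<Longrightarrow> fst s vk = k" "env s \<Longrightarrow> fst s vp = p"
  by (auto simp: env_def)

lemma tt_Adj: "env s \<Longrightarrow> ev e s < n \<Longrightarrow> ev f s < n \<Longrightarrow> tt (Adj e f) s \<longleftrightarrow> E (ev e s) (ev f s)"
  by (simp add: Adj_def env_def)

lemma sem_DEG:
  assumes "env s" "x \<noteq> vC" "x \<noteq> vU" "fst s x < n"
  shows "fst (sem (DEG a x) s) vC = indeg (aset n (snd s a)) (fst s x)"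
proof -
  let ?P = "Cond (And (Arr a (Var vU)) (Adj (Var vU) (Var x))) (inc vC) Nop"
  define s0 where "s0 = ((fst s)(vC := 0), snd s)"
  define I where "I i s' \<longleftrightarrow> fst s' vC = card {u. u < i \<and> snd s a u \<noteq> 0 \<and> E u (fst s x)}" for i and s' :: st
  have "I (fst s0 vN) (sem (For vU vN ?P) s0)"
  proof (rule sem_For_inv)
    show "I 0 s0" by (simp add: I_def s0_def)
  next
    fix i s' assume i: "i < fst s0 vN" "I i s'" "\<And>y. y \<noteq> vU \<Longrightarrow> y \<notin> mv ?P \<Longrightarrow> fst s' y = fst s0 y"
      "\<And>a. a \<notin> ma ?P \<Longrightarrow> snd s' a = snd s0 a"
    have env': "env s'" using assms(1) i(3,4) by (simp add: env_def s0_def)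
    have "i < n" using i(1) envD(1)[OF assms(1)] by (simp add: s0_def)
    moreover have "fst s' x = fst s x" "snd s' a = snd s a" using i(3,4) assms(2,3) by (auto simp: s0_def)
    ultimately show "I (Suc i) (sem ?P ((fst s')(vU := i), snd s'))"
      using i(2) env' assms(2-4) by (simp add: I_def tt_Adj card_less_Suc_Collect)
  qed
  then show ?thesis using envD(1)[OF assms(1)]
    by (simp add: DEG_def s0_def I_def indeg_def aset_def conj_assoc)
qed

definition del :: "nat set \<Rightarrow> nat \<Rightarrow> nat set \<Rightarrow> nat set" where
  "del A v S = (if v \<in> S \<and> v \<notin> A \<and> indeg S v < k then S - {v} else S)"

definition sweep :: "nat set \<Rightarrow> nat set \<Rightarrow> nat set" where
  "sweep A S = fold (del A) [0..<n] S"

lemma fold_del_subset: "fold (del A) vs S \<subseteq> S"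
proof (induction vs arbitrary: S)
  case (Cons v vs)
  have "del A v S \<subseteq> S" by (auto simp: del_def)
  then show ?case using Cons[of "del A v S"] by simp
qed simp

lemma fold_del_fixed: "fold (del A) vs S = S \<Longrightarrow> v \<in> set vs \<Longrightarrow> v \<in> S - A \<Longrightarrow> k \<le> indeg S v"
proof (induction vs)
  case (Cons w vs)
  have "del A w S \<subseteq> S" by (auto simp: del_def)
  then have "del A w S = S" using Cons.prems(1) fold_del_subset[of A vs "del A w S"] by auto
  then show ?case using Cons by (auto simp: del_def split: if_splits)
qed simp

lemma sol_subset_fold_del: "sol A H \<Longrightarrow> H \<subseteq> S \<Longrightarrow> H \<subseteq> fold (del A) vs S"
proof (induction vs arbitrary: S)
  case (Cons v vs)
  have "v \<notin> H - A" if "indeg S v < k"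
  proof
    assume "v \<in> H - A"
    then have "k \<le> indeg H v" using Cons.prems(1) by (auto simp: sol_def)
    with that indeg_mono[OF Cons.prems(2), of v] show False by simp
  qed
  then have "H \<subseteq> del A v S" using Cons.prems by (auto simp: del_def sol_def)
  then show ?case using Cons by simp
qed simp

text \<open>Every iteration that changes the set removes an element, so a fixed point is reached
  after at most \<open>card S\<close> of them.\<close>

lemma funpow_shrinking_fixed:
  assumes "\<And>S. f S \<subseteq> S" "finite S" "card S \<le> m"
  shows "f ((f ^^ m) S) = (f ^^ m) (S :: 'a set)"
  using assms(2,3)
proof (induction m arbitrary: S)
  case 0
  then show ?case using assms(1)[of "{}"] by simp
next
  case (Suc m)
  show ?case
  proof (cases "f S = S")
    case True
    then have "(f ^^ i) S = S" for i by (induction i) auto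
    with True show ?thesis by metis
  next
    case False
    then have "card (f S) < card S" using assms(1)[of S] Suc.prems by (intro psubset_card_mono) auto
    then have "f ((f ^^ m) (f S)) = (f ^^ m) (f S)"
      using Suc finite_subset[OF assms(1)[of S]] by auto
    then show ?thesis by (simp only: funpow_Suc_right comp_def)
  qed
qed

text \<open>For \<open>A \<subseteq> {..<n}\<close> this is the greatest solution with anchors
  \<open>A\<close>: no deletion can touch another solution, and \<open>n\<close> sweeps reach a
  fixed point.\<close>

definition kernel :: "nat set \<Rightarrow> nat set" where
  "kernel A = (sweep A ^^ n) {..<n}"

lemma sol_subset_kernel:
  assumes "sol A H"
  shows "H \<subseteq> kernel A"
proof -
  have "H \<subseteq> (sweep A ^^ i) {..<n}" for i
    by (induction i) (use assms sol_subset_fold_del in \<open>auto simp: sol_def sweep_def\<close>)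
  then show ?thesis by (simp add: kernel_def)
qed

lemma sol_kernel:
  assumes "A \<subseteq> {..<n}"
  shows "sol A (kernel A)"
proof -
  have sub: "sweep A S \<subseteq> S" for S unfolding sweep_def by (rule fold_del_subset)
  have "A \<subseteq> (sweep A ^^ i) {..<n} \<and> (sweep A ^^ i) {..<n} \<subseteq> {..<n}" for i
  proof (induction i)
    case (Suc i)
    have step: "A \<subseteq> del A v S" if "A \<subseteq> S" for v S using that by (auto simp: del_def)
    have "A \<subseteq> fold (del A) vs S" if "A \<subseteq> S" for vs S
      using that by (induction vs arbitrary: S) (simp_all add: step)
    then have "A \<subseteq> sweep A ((sweep A ^^ i) {..<n})" using Suc unfolding sweep_def by blast
    then show ?case using Suc sub[of "(sweep A ^^ i) {..<n}"] by auto
  qed (simp add: assms)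
  then have "A \<subseteq> kernel A" "kernel A \<subseteq> {..<n}" by (auto simp: kernel_def)
  moreover have "sweep A (kernel A) = kernel A"
    unfolding kernel_def by (rule funpow_shrinking_fixed[OF sub]) auto
  ultimately show ?thesis
    using fold_del_fixed[of A "[0..<n]" "kernel A"] by (auto simp: sol_def sweep_def)
qed

lemma accepts_iff_kernel:
  assumes "A \<subseteq> {..<n}"
  shows "accepts b p A \<longleftrightarrow> card A \<le> b \<and> p \<le> card (kernel A)"
proof -
  have "card H \<le> card (kernel A)" if "sol A H" for H
    using sol_subset_kernel[OF that] sol_kernel[OF assms] finite_subset_V by (intro card_mono) (auto simp: sol_def)
  then show ?thesis using sol_kernel[OF assms] by (auto simp: accepts_def intro: order_trans)
qed

lemma sem_DEL:
  assumes "env s"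
  shows "aset n (snd (sem DEL s) aH) = sweep (aset n (snd s aA)) (aset n (snd s aH))"
proof -
  let ?A = "aset n (snd s aA)" and ?S = "aset n (snd s aH)"
  let ?P = "Cond (And (Arr aH (Var vV)) (Not (Arr aA (Var vV))))
     (Sq (DEG aH vV) (Cond (Le (Var vk) (Var vC)) Nop (Wr aH (Var vV) (Num 0)))) Nop"
  define I where "I i s' \<longleftrightarrow> aset n (snd s' aH) = fold (del ?A) [0..<i] ?S" for i and s' :: st
  have "I (fst s vN) (sem (For vV vN ?P) s)"
  proof (rule sem_For_inv)
    show "I 0 s" by (simp add: I_def)
  next
    fix i s' assume i: "i < fst s vN" "I i s'" "\<And>y. y \<noteq> vV \<Longrightarrow> y \<notin> mv ?P \<Longrightarrow> fst s' y = fst s y"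
      "\<And>a. a \<notin> ma ?P \<Longrightarrow> snd s' a = snd s a"
    have env': "env s'" using assms i(3,4) by (simp add: env_def)
    have iN: "i < n" using i(1) envD(1)[OF assms] by simp
    have A: "snd s' aA = snd s aA" using i(4) by simp
    let ?T = "aset n (snd s' aH)"
    have "aset n (snd (sem ?P ((fst s')(vV := i), snd s')) aH) = del ?A i ?T"
    proof -
      have "fst (sem (DEG aH vV) ((fst s')(vV := i), snd s')) vC = indeg ?T i"
        using sem_DEG[of "((fst s')(vV := i), snd s')" vV aH] env' iN by simp
      moreover have "i \<in> ?T \<longleftrightarrow> snd s' aH i \<noteq> 0" "i \<in> ?A \<longleftrightarrow> snd s aA i \<noteq> 0" using iN by (auto simp: aset_def)
      ultimately show ?thesis
        using iN env' A envD(3)[OF env'] by (auto simp: del_def snd_sem_eq aset_upd)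
    qed
    then show "I (Suc i) (sem ?P ((fst s')(vV := i), snd s'))" using i(2) by (simp add: I_def)
  qed
  then show ?thesis using envD(1)[OF assms] by (simp add: I_def DEL_def sweep_def)
qed

lemma sem_COUNT:
  assumes "env s"
  shows "fst (sem COUNT s) vSz = card (aset n (snd s aH))" "fst (sem COUNT s) vAsz = card (aset n (snd s aA))"
proof -
  let ?P = "Sq (Cond (Arr aH (Var vV)) (inc vSz) Nop) (Cond (Arr aA (Var vV)) (inc vAsz) Nop)"
  define s0 where "s0 = ((fst s)(vSz := 0, vAsz := 0), snd s)"
  define I where "I i s' \<longleftrightarrow> fst s' vSz = card {u. u < i \<and> snd s aH u \<noteq> 0}
     \<and> fst s' vAsz = card {u. u < i \<and> snd s aA u \<noteq> 0}" for i and s' :: st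
  have "I (fst s0 vN) (sem (For vV vN ?P) s0)"
  proof (rule sem_For_inv)
    show "I 0 s0" by (simp add: I_def s0_def)
  next
    fix i s' assume i: "I i s'" "\<And>a. a \<notin> ma ?P \<Longrightarrow> snd s' a = snd s0 a"
    then show "I (Suc i) (sem ?P ((fst s')(vV := i), snd s'))"
      by (auto simp: I_def s0_def card_less_Suc_Collect)
  qed
  then show "fst (sem COUNT s) vSz = card (aset n (snd s aH))" "fst (sem COUNT s) vAsz = card (aset n (snd s aA))"
    using envD(1)[OF assms] by (simp_all add: COUNT_def s0_def I_def aset_def)
qed

lemma sem_VER:
  assumes "env s"
  shows "fst (sem VER s) vAns = (if accepts b p (aset n (snd s aA)) then 1 else fst s vAns)"
proof -
  let ?A = "aset n (snd s aA)"
  define s1 where "s1 = sem (For vV vN (Wr aH (Var vV) (Num 1))) s"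
  define I where "I i s' \<longleftrightarrow> (\<forall>v<i. snd s' aH v \<noteq> 0)" for i and s' :: st
  have "I (fst s vN) s1" unfolding s1_def
    by (rule sem_For_inv) (auto simp: I_def less_Suc_eq)
  then have s1: "aset n (snd s1 aH) = {..<n}" using envD(1)[OF assms] by (auto simp: I_def aset_def)
  have env1: "env s1" using assms unfolding s1_def by (subst env_sem) auto
  have A1: "snd s1 aA = snd s aA" by (simp add: s1_def)
  define s2 where "s2 = sem (For vR vN DEL) s1"
  define J where "J i s' \<longleftrightarrow> aset n (snd s' aH) = (sweep ?A ^^ i) {..<n}" for i and s' :: st
  have "J (fst s1 vN) s2" unfolding s2_def
  proof (rule sem_For_inv)
    show "J 0 s1" by (simp add: J_def s1)
  next
    fix i s' assume i: "J i s'" "\<And>y. y \<noteq> vR \<Longrightarrow> y \<notin> mv DEL \<Longrightarrow> fst s' y = fst s1 y"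
      "\<And>a. a \<notin> ma DEL \<Longrightarrow> snd s' a = snd s1 a"
    have "env s'" using env1 i(2,3) by (simp add: env_def)
    then show "J (Suc i) (sem DEL ((fst s')(vR := i), snd s'))"
      using i(1,3) A1 by (simp add: J_def sem_DEL)
  qed
  then have s2: "aset n (snd s2 aH) = kernel ?A" using envD(1)[OF env1] by (simp add: J_def kernel_def)
  have env2: "env s2" using env1 unfolding s2_def by (subst env_sem) auto
  have A2: "snd s2 aA = snd s aA" by (simp add: s2_def A1)
  have "sem VER s = sem (Cond (And (Le (Var vp) (Var vSz)) (Le (Var vAsz) (Var vb))) (Asg vAns (Num 1)) Nop) (sem COUNT s2)"
    by (simp add: VER_def s2_def s1_def)
  moreover have "fst (sem COUNT s2) vAns = fst s vAns" by (simp add: s2_def s1_def)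
  moreover have "?A \<subseteq> {..<n}" by (auto simp: aset_def)
  ultimately show ?thesis
    using sem_COUNT[OF env2] s2 A2 envD[OF env2] accepts_iff_kernel[of ?A] by auto
qed


section \<open>Programs that decode pieces and their anchors\<close>

subsection \<open>Exploration and marking\<close>

definition qrep :: "nat list \<Rightarrow> nat \<Rightarrow> st \<Rightarrow> bool" where
  "qrep Q X s \<longleftrightarrow> fst s vLen = length Q \<and> (\<forall>t<length Q. snd s aQ t = Q ! t)
     \<and> aset n (snd s aInq) = set Q \<and> fst s vX = X"

lemma sem_ESTEP:
  assumes "env s" "fst s vPl = p" "qrep Q X s" "set Q \<subseteq> {..<n}" "fst s vY = w" "w < n" "fst s vT = t" "X < fst s vNN"
  shows "qrep (fst (estep p t w (Q, X))) (snd (estep p t w (Q, X))) (sem ESTEP s)"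
proof -
  have len: "fst s vLen = length Q" and Q: "\<And>i. i < length Q \<Longrightarrow> snd s aQ i = Q ! i"
    and S: "aset n (snd s aInq) = set Q" and X: "fst s vX = X"
    using assms(3) by (auto simp: qrep_def)
  let ?c = "And (Not (Le (Var vLen) (Var vT))) (And (Not (Le (Var vPl) (Var vLen)))
       (And (Not (Arr aInq (Var vY)))
         (Plus (Adj (Arr aQ (Var vT)) (Var vY)) (Adj (Var vY) (Arr aQ (Var vT))))))"
  have c: "tt ?c s \<longleftrightarrow> t < length Q \<and> length Q < p \<and> w \<notin> set Q \<and> adj (Q ! t) w"
  proof (cases "t < length Q")
    case True
    then have "Q ! t < n" using assms(4) nth_mem by blast
    moreover have "w \<in> set Q \<longleftrightarrow> snd s aInq w \<noteq> 0" using S[symmetric] assms(6) by (simp add: aset_def)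
    ultimately show ?thesis
      using True assms len Q by (auto simp: tt_Adj adj_def)
  qed (use assms len in simp)
  show ?thesis
  proof (cases "tt ?c s")
    case False
    then have "sem ESTEP s = s" unfolding ESTEP_def by (simp only: sem_Cond if_False sem.simps(1))
    moreover have "estep p t w (Q, X) = (Q, X)" using False unfolding c by (auto simp: estep_def)
    ultimately show ?thesis using assms(3) by simp
  next
    case True
    let ?s = "sem POP s"
    have pop: "fst ?s vBit = X mod 2" "fst ?s vX = X div 2" using sem_POP[of s] assms(8) X by auto
    have sem: "sem ESTEP s = sem (Cond (Var vBit)
       (Sq (Wr aQ (Var vLen) (Var vY)) (Sq (Wr aInq (Var vY) (Num 1)) (inc vLen))) Nop) ?s"
      unfolding ESTEP_def using True by simp
    have "odd X \<longleftrightarrow> X mod 2 \<noteq> 0" by (metis even_iff_mod_2_eq_zero)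
    then show ?thesis unfolding sem using True c pop len Q S assms(5,6)
      by (auto simp: qrep_def estep_def snd_sem_eq aset_upd nth_append less_Suc_eq)
  qed
qed

lemma estep_le: "set (fst \<tau>) \<subseteq> {..<n} \<and> snd \<tau> \<le> X \<Longrightarrow>
  set (fst (estep q t w \<tau>)) \<subseteq> {..<n} \<and> snd (estep q t w \<tau>) \<le> X"
  using adj_less by (cases \<tau>) (auto simp: estep_def)

text \<open>The number being decoded never grows, so it stays below \<open>vNN\<close> and every
  later \<open>POP\<close> is exact.\<close>

lemma expl_le:
  assumes "v < n"
  shows "snd (expl q v X) \<le> X"
proof -
  define I where "I \<tau> \<longleftrightarrow> set (fst \<tau>) \<subseteq> {..<n} \<and> snd \<tau> \<le> X" for \<tau> :: "nat list \<times> nat"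
  have step: "I (estep q t w \<tau>)" if "I \<tau>" for t w \<tau> using that estep_le unfolding I_def by blast
  have inner: "I (fold (estep q t) ws \<tau>)" if "I \<tau>" for t ws \<tau>
    using that by (induction ws arbitrary: \<tau>) (simp_all add: step)
  have "I (fold (\<lambda>t. fold (estep q t) [0..<n]) ts \<tau>)" if "I \<tau>" for ts \<tau>
    using that by (induction ts arbitrary: \<tau>) (simp_all add: inner)
  moreover have "I ([v], X)" using assms by (simp add: I_def)
  ultimately show ?thesis by (auto simp: expl_def I_def)
qed

lemma sem_EXPL:
  assumes "env s" "fst s vPl = p" "fst s vS = v" "v < n" "fst s vX = X" "X < fst s vNN"
  shows "qrep (fst (expl p v X)) (snd (expl p v X)) (sem EXPL s)"
proof -
  define s0 where "s0 = sem (Sq (CLEAR aInq) (Sq (Wr aQ (Num 0) (Var vS)) (Sq (Wr aInq (Var vS) (Num 1)) (Asg vLen (Num 1))))) s"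
  have v0: "fst s0 y = fst s y" if "y \<noteq> vV" "y \<noteq> vLen" for y using that by (simp add: s0_def)
  have a0: "snd s0 0 = snd s 0" by (simp add: s0_def)
  have N: "fst s vN = n" using envD(1)[OF assms(1)] .
  have q0: "qrep [v] X s0"
    using assms aset_CLEAR[OF N, of aInq] by (auto simp: qrep_def s0_def aset_upd)
  have env0: "env s0" using assms(1) v0 a0 by (simp add: env_def)
  define J where "J \<tau> s' \<longleftrightarrow> qrep (fst \<tau>) (snd \<tau>) s' \<and> set (fst \<tau>) \<subseteq> {..<n} \<and> snd \<tau> \<le> X" for \<tau> and s' :: st
  define I where "I i = J (fold (\<lambda>t. fold (estep p t) [0..<n]) [0..<i] ([v], X))" for i
  have "I (fst s0 vPl) (sem (For vT vPl (For vY vN ESTEP)) s0)"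
  proof (rule sem_For_inv)
    show "I 0 s0" using q0 assms(4) by (simp add: I_def J_def)
  next
    fix i s' assume i: "I i s'" "\<And>y. y \<noteq> vT \<Longrightarrow> y \<notin> mv (For vY vN ESTEP) \<Longrightarrow> fst s' y = fst s0 y"
      "\<And>a. a \<notin> ma (For vY vN ESTEP) \<Longrightarrow> snd s' a = snd s0 a"
    define \<tau> where "\<tau> = fold (\<lambda>t. fold (estep p t) [0..<n]) [0..<i] ([v], X)"
    define s1 where "s1 = ((fst s')(vT := i), snd s')"
    have v1: "fst s1 y = fst s0 y" if "y \<notin> {vT, vY, vHalf, vZ, vX, vBit, vLen}" for y
      using i(2) that by (simp add: s1_def)
    have a1: "snd s1 0 = snd s0 0" using i(3) by (simp add: s1_def)
    have env1: "env s1" using env0 v1 a1 by (simp add: env_def)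
    define K where "K j = J (fold (estep p i) [0..<j] \<tau>)" for j
    have "K (fst s1 vN) (sem (For vY vN ESTEP) s1)"
    proof (rule sem_For_inv)
      show "K 0 s1" using i(1) by (simp add: K_def I_def J_def \<tau>_def s1_def qrep_def)
    next
      fix j s2 assume j: "j < fst s1 vN" "K j s2" "\<And>y. y \<noteq> vY \<Longrightarrow> y \<notin> mv ESTEP \<Longrightarrow> fst s2 y = fst s1 y"
        "\<And>a. a \<notin> ma ESTEP \<Longrightarrow> snd s2 a = snd s1 a"
      have env2: "env s2" using env1 j(3,4) by (simp add: env_def)
      define \<tau>2 where "\<tau>2 = fold (estep p i) [0..<j] \<tau>"
      let ?s = "((fst s2)(vY := j), snd s2)"
      have "qrep (fst \<tau>2) (snd \<tau>2) ?s" "set (fst \<tau>2) \<subseteq> {..<n}" "snd \<tau>2 \<le> X"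
        using j(2) by (simp_all add: K_def J_def \<tau>2_def qrep_def)
      moreover have "j < n" using j(1) envD(1)[OF env1] by simp
      moreover have "fst ?s vPl = p" "fst ?s vT = i" "X < fst ?s vNN"
        using j(3) v1 v0 assms(2,6) by (simp_all add: s1_def)
      ultimately have "qrep (fst (estep p i j \<tau>2)) (snd (estep p i j \<tau>2)) (sem ESTEP ?s)"
        using sem_ESTEP[of ?s "fst \<tau>2" "snd \<tau>2" j i] env2 by simp
      moreover have "set (fst (estep p i j \<tau>2)) \<subseteq> {..<n} \<and> snd (estep p i j \<tau>2) \<le> X"
        by (rule estep_le) (use \<open>set (fst \<tau>2) \<subseteq> {..<n}\<close> \<open>snd \<tau>2 \<le> X\<close> in simp)
      ultimately show "K (Suc j) (sem ESTEP ?s)" by (simp add: K_def J_def \<tau>2_def)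
    qed
    then show "I (Suc i) (sem (For vY vN ESTEP) ((fst s')(vT := i), snd s'))"
      using envD(1)[OF env1] by (simp add: K_def I_def s1_def \<tau>_def)
  qed
  moreover have "fst s0 vPl = p" using v0 assms(2) by simp
  moreover have "sem EXPL s = sem (For vT vPl (For vY vN ESTEP)) s0" by (simp add: EXPL_def s0_def)
  ultimately show ?thesis by (simp add: I_def J_def expl_def)
qed

lemma mstep_le: "snd \<tau> \<le> X \<Longrightarrow> snd (mstep Q t \<tau>) \<le> X"
  by (cases \<tau>) (auto simp: mstep_def)

lemma sem_MARK:
  assumes "env s" "fst s vPl = p" "qrep Q X s" "set Q \<subseteq> {..<n}" "X < fst s vNN"
  shows "aset n (snd (sem MARK s) aM) = fst (marks p Q X)"
proof -
  let ?P = "Cond (Le (Var vLen) (Var vT)) Nop (Sq POP (Cond (Var vBit) (Wr aM (Arr aQ (Var vT)) (Num 1)) Nop))"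
  define s0 where "s0 = sem (CLEAR aM) s"
  have v0: "fst s0 y = fst s y" if "y \<noteq> vV" for y using that by (simp add: s0_def)
  have a0: "snd s0 a = snd s a" if "a \<noteq> aM" for a using that by (simp add: s0_def)
  have M0: "aset n (snd s0 aM) = {}" using aset_CLEAR[OF envD(1)[OF assms(1)], of aM] by (simp add: s0_def)
  define I where "I i s' \<longleftrightarrow> (let \<tau> = fold (mstep Q) [0..<i] ({}, X) in aset n (snd s' aM) = fst \<tau> \<and> fst s' vX = snd \<tau> \<and> snd \<tau> \<le> X)"
    for i and s' :: st
  have "I (fst s0 vPl) (sem (For vT vPl ?P) s0)"
  proof (rule sem_For_inv)
    show "I 0 s0" using M0 v0 assms(3) by (simp add: I_def qrep_def)
  next
    fix i s' assume i: "I i s'" "\<And>y. y \<noteq> vT \<Longrightarrow> y \<notin> mv ?P \<Longrightarrow> fst s' y = fst s0 y"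
      "\<And>a. a \<notin> ma ?P \<Longrightarrow> snd s' a = snd s0 a"
    define \<tau> where "\<tau> = fold (mstep Q) [0..<i] ({}, X)"
    have \<tau>: "aset n (snd s' aM) = fst \<tau>" "fst s' vX = snd \<tau>" "snd \<tau> \<le> X"
      using i(1) by (simp_all add: I_def \<tau>_def Let_def)
    let ?s = "((fst s')(vT := i), snd s')"
    have len: "fst ?s vLen = length Q" and Q: "\<And>t. t < length Q \<Longrightarrow> snd ?s aQ t = Q ! t"
      using i(2,3) v0 a0 assms(3) by (simp_all add: qrep_def)
    have NN: "snd \<tau> < fst ?s vNN" using i(2) v0 assms(5) \<tau>(3) by simp
    have "aset n (snd (sem ?P ?s) aM) = fst (mstep Q i \<tau>) \<and> fst (sem ?P ?s) vX = snd (mstep Q i \<tau>)"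
    proof (cases "i < length Q")
      case False
      then show ?thesis using len \<tau> by (cases \<tau>) (simp add: mstep_def)
    next
      case True
      then have "Q ! i < n" using assms(4) nth_mem by blast
      moreover have "odd (snd \<tau>) \<longleftrightarrow> snd \<tau> mod 2 \<noteq> 0" by (metis even_iff_mod_2_eq_zero)
      moreover have "fst (sem POP ?s) vBit = snd \<tau> mod 2" "fst (sem POP ?s) vX = snd \<tau> div 2"
        using sem_POP[of ?s] NN \<tau>(2) by auto
      ultimately show ?thesis using True len Q \<tau>
        by (cases \<tau>) (auto simp: mstep_def snd_sem_eq aset_upd)
    qed
    then show "I (Suc i) (sem ?P ?s)" using mstep_le[OF \<tau>(3), of Q i] by (simp add: I_def \<tau>_def Let_def)
  qed
  then show ?thesis using v0 assms(2) by (simp add: MARK_def s0_def[symmetric] I_def marks_def Let_def)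
qed

lemma sem_VALID:
  assumes "env s" "fst s vLen = length Q" "aset n (snd s aInq) = set Q" "aset n (snd s aM) = S" "set Q \<subseteq> {..<n}" "S \<subseteq> set Q"
  shows "fst (sem VALID s) vOk \<noteq> 0 \<longleftrightarrow> length Q = fst s vSi \<and> card S = fst s vJ \<and> sol S (set Q)"
proof -
  let ?P = "Sq (Cond (Arr aM (Var vV)) (inc vAsz) Nop)
       (Cond (And (Arr aInq (Var vV)) (Not (Arr aM (Var vV))))
         (Sq (DEG aInq vV) (Cond (Le (Var vk) (Var vC)) Nop (Asg vOk (Num 0)))) Nop)"
  define s0 where "s0 = ((fst s)(vOk := 1, vAsz := 0), snd s)"
  define I where "I i s' \<longleftrightarrow> fst s' vAsz = card {u. u < i \<and> snd s aM u \<noteq> 0}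
     \<and> (fst s' vOk \<noteq> 0 \<longleftrightarrow> (\<forall>v<i. v \<in> set Q - S \<longrightarrow> k \<le> indeg (set Q) v))" for i and s' :: st
  have N: "fst s0 vN = n" using envD(1)[OF assms(1)] by (simp add: s0_def)
  define s1 where "s1 = sem (For vV vN ?P) s0"
  have "I (fst s0 vN) s1" unfolding s1_def
  proof (rule sem_For_inv)
    show "I 0 s0" by (simp add: I_def s0_def)
  next
    fix i s' assume i: "i < fst s0 vN" "I i s'" "\<And>y. y \<noteq> vV \<Longrightarrow> y \<notin> mv ?P \<Longrightarrow> fst s' y = fst s0 y"
      "\<And>a. a \<notin> ma ?P \<Longrightarrow> snd s' a = snd s0 a"
    have env': "env s'" using assms(1) i(3,4) by (simp add: env_def s0_def)
    have arr: "snd s' = snd s" by (rule ext) (use i(4) in \<open>simp add: s0_def\<close>)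
    have iN: "i < n" using i(1) N by simp
    have ii: "i \<in> set Q \<longleftrightarrow> snd s aInq i \<noteq> 0" "i \<in> S \<longleftrightarrow> snd s aM i \<noteq> 0"
      using iN assms(3,4) by (auto simp: aset_def)
    let ?s = "\<lambda>c. ((fst s')(vV := i, vAsz := c), snd s')"
    have e: "env (?s c)" for c
      using env_upd(1)[of vAsz "((fst s')(vV := i), snd s')" c] env' by simp
    have deg: "fst (sem (DEG aInq vV) (?s c)) vC = indeg (set Q) i" for c
      using sem_DEG[of "?s c" vV aInq, OF e] iN assms(3) by (simp add: arr)
    have e': "env ((fst s')(vV := i), snd s')" using env' by simp
    have deg': "fst (sem (DEG aInq vV) ((fst s')(vV := i), snd s')) vC = indeg (set Q) i"
      using sem_DEG[of "((fst s')(vV := i), snd s')" vV aInq, OF e'] iN assms(3) by (simp add: arr)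
    show "I (Suc i) (sem ?P ((fst s')(vV := i), snd s'))"
      using i(2) deg deg' ii envD(3)[OF env'] arr
      by (cases "snd s aM i = 0"; cases "snd s aInq i = 0"; cases "k \<le> indeg (set Q) i")
        (simp_all add: I_def card_less_Suc_Collect All_less_Suc)
  qed
  moreover have "card S = card {u. u < n \<and> snd s aM u \<noteq> 0}" using assms(4) by (simp add: aset_def)
  moreover have "sol S (set Q) \<longleftrightarrow> (\<forall>v<n. v \<in> set Q - S \<longrightarrow> k \<le> indeg (set Q) v)"
    using assms(5,6) by (auto simp: sol_def)
  moreover have "sem VALID s = sem (Cond (And (Eq (Var vLen) (Var vSi)) (Eq (Var vAsz) (Var vJ))) Nop (Asg vOk (Num 0))) s1"
    by (simp add: VALID_def s1_def s0_def)
  moreover have "fst s1 vLen = length Q" "fst s1 vSi = fst s vSi" "fst s1 vJ = fst s vJ"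
    using assms(2) by (simp_all add: s1_def s0_def)
  ultimately show ?thesis unfolding I_def N by auto
qed

lemma sem_copy_marks:
  assumes "env s"
  shows "aset n (snd (sem (For vV vN (Cond (Arr aM (Var vV)) (Wr aA (Var vV) (Num 1)) Nop)) s) aA)
    = aset n (snd s aA) \<union> aset n (snd s aM)"
proof -
  let ?P = "Cond (Arr aM (Var vV)) (Wr aA (Var vV) (Num 1)) Nop"
  define I where "I i s' \<longleftrightarrow> aset n (snd s' aA) = aset n (snd s aA) \<union> {v. v < i \<and> snd s aM v \<noteq> 0}" for i and s' :: st
  have "I (fst s vN) (sem (For vV vN ?P) s)"
  proof (rule sem_For_inv)
    show "I 0 s" by (simp add: I_def)
  next
    fix i s' assume i: "i < fst s vN" "I i s'" "\<And>a. a \<notin> ma ?P \<Longrightarrow> snd s' a = snd s a"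
    have "i < n" using i(1) envD(1)[OF assms] by simp
    then show "I (Suc i) (sem ?P ((fst s')(vV := i), snd s'))"
      using i(2,3) by (auto simp: I_def aset_upd less_Suc_eq)
  qed
  then show ?thesis using envD(1)[OF assms] by (simp add: I_def aset_def)
qed

lemma sem_PICK:
  assumes "env s" "fst s vPl = p" "0 < p" "fst s vM < fst s vNN"
  shows "aset n (snd (sem PICK s) aA) = aset n (snd s aA) \<union> pick p (fst s vI, fst s vSi, fst s vJ, fst s vM)"
proof -
  let ?body = "\<lambda>Q. Sq (Asg vX (Var vM)) (Sq EXPL (Sq MARK (Sq VALID Q)))"
  let ?Q = "Cond (Var vOk) (Sq (Cond (Eq (Var vCnt) (Var vI))
        (For vV vN (Cond (Arr aM (Var vV)) (Wr aA (Var vV) (Num 1)) Nop)) Nop) (inc vCnt)) Nop"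
  define s0 where "s0 = ((fst s)(vCnt := 0), snd s)"
  define M where "M = fst s vM"
  define F where "F i = filter (valid p (fst s vSi) (fst s vJ) M) [0..<i]" for i
  define pk where "pk i = (if fst s vI < length (F i) then piece_anchors p (F i ! fst s vI) M else {})" for i
  define I where "I i s' \<longleftrightarrow> fst s' vCnt = length (F i) \<and> aset n (snd s' aA) = aset n (snd s aA) \<union> pk i" for i and s' :: st
  have N: "fst s0 vN = n" using envD(1)[OF assms(1)] by (simp add: s0_def)
  have "I (fst s0 vN) (sem (For vS vN (?body ?Q)) s0)"
  proof (rule sem_For_inv)
    show "I 0 s0" by (simp add: I_def s0_def F_def pk_def)
  next
    fix i s' assume i: "i < fst s0 vN" "I i s'" "\<And>y. y \<noteq> vS \<Longrightarrow> y \<notin> mv (?body ?Q) \<Longrightarrow> fst s' y = fst s0 y"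
      "\<And>a. a \<notin> ma (?body ?Q) \<Longrightarrow> snd s' a = snd s0 a"
    have iN: "i < n" using i(1) N by simp
    define s1 where "s1 = ((fst s')(vS := i, vX := fst s' vM), snd s')"
    have v1: "fst s1 y = fst s y" if "y \<notin> {vS, vX, vHalf, vZ, vBit, vLen, vV, vT, vY, vOk, vAsz, vC, vU, vCnt}" for y
      using i(3) that by (simp add: s1_def s0_def)
    have c1: "fst s1 vCnt = length (F i)" and A1: "aset n (snd s1 aA) = aset n (snd s aA) \<union> pk i"
      using i(2) by (simp_all add: s1_def I_def)
    have env1: "env s1" using assms(1) v1 i(4) by (simp add: env_def s1_def s0_def)
    define Q where "Q = piece p i M"
    define X where "X = snd (expl p i M)"
    define s2 where "s2 = sem EXPL s1"
    have M1: "fst s1 vX = M" using i(3) by (simp add: s1_def M_def s0_def)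
    have q2: "qrep Q X s2" unfolding s2_def Q_def X_def piece_def
      by (rule sem_EXPL) (use env1 v1 assms iN M1 in \<open>simp_all add: s1_def M_def\<close>)
    have env2: "env s2" using env1 unfolding s2_def by (subst env_sem) auto
    have v2: "fst s2 y = fst s1 y" if "y \<notin> {vHalf, vZ, vX, vBit, vLen, vV, vT, vY}" for y using that by (simp add: s2_def)
    have Qn: "set Q \<subseteq> {..<n}" using expl_props(3)[OF iN assms(3), of M] by (simp add: Q_def piece_def)
    have "X \<le> M" unfolding X_def by (rule expl_le[OF iN])
    then have NN: "X < fst s2 vNN" using v2 v1 assms(4) by (simp add: M_def)
    define s3 where "s3 = sem MARK s2"
    have S3: "aset n (snd s3 aM) = piece_anchors p i M" unfolding s3_def piece_anchors_def Q_def[symmetric] X_def[symmetric]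
      by (rule sem_MARK[OF env2 _ q2 Qn NN]) (use v2 v1 assms(2) in simp)
    have env3: "env s3" using env2 unfolding s3_def by (subst env_sem) auto
    have v3: "fst s3 y = fst s2 y" if "y \<notin> {vHalf, vZ, vX, vBit, vV, vT}" for y using that by (simp add: s3_def)
    have a3: "snd s3 a = snd s2 a" if "a \<noteq> aM" for a using that by (simp add: s3_def)
    define s4 where "s4 = sem VALID s3"
    have "piece_anchors p i M \<subseteq> set Q" unfolding piece_anchors_def Q_def by (rule marks_subset)
    then have ok: "fst s4 vOk \<noteq> 0 \<longleftrightarrow> valid p (fst s vSi) (fst s vJ) M i"
      unfolding s4_def using sem_VALID[OF env3 _ _ S3 Qn] q2 v3 a3 v2 v1
      by (simp add: qrep_def valid_def Q_def)
    have env4: "env s4" using env3 unfolding s4_def by (subst env_sem) auto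
    have a4: "snd s4 = snd s3" by (simp add: s4_def snd_sem_eq)
    have v4: "fst s4 vCnt = length (F i)" "fst s4 vI = fst s vI" using v3 v2 v1 c1 by (simp_all add: s4_def)
    have A4: "aset n (snd s4 aA) = aset n (snd s aA) \<union> pk i" using A1 by (simp add: a4 a3 s2_def)
    have "sem (?body ?Q) ((fst s')(vS := i), snd s') = sem ?Q s4"
      by (simp add: s4_def s3_def s2_def s1_def)
    moreover have "I (Suc i) (sem ?Q s4)"
    proof (cases "fst s4 vOk = 0")
      case True
      then have "F (Suc i) = F i" using ok by (simp add: F_def)
      then show ?thesis using True A4 v4 by (simp add: I_def pk_def)
    next
      case False
      then have F: "F (Suc i) = F i @ [i]" using ok by (simp add: F_def)
      show ?thesis
      proof (cases "length (F i) = fst s vI")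
        case True
        then have pk: "pk i = {}" "pk (Suc i) = piece_anchors p i M" by (simp_all add: pk_def F nth_append)
        show ?thesis using False True v4 A4 sem_copy_marks[OF env4] S3 pk F by (simp add: I_def a4)
      next
        case ne: False
        then have "pk (Suc i) = pk i" by (auto simp: pk_def F nth_append less_Suc_eq)
        then show ?thesis using False ne v4 A4 F by (simp add: I_def)
      qed
    qed
    ultimately show "I (Suc i) (sem (?body ?Q) ((fst s')(vS := i), snd s'))" by simp
  qed
  then have "I n (sem PICK s)" by (simp add: PICK_def s0_def[symmetric] N)
  then show ?thesis by (simp add: I_def pk_def F_def pick_def Let_def M_def)
qed


section \<open>Guesses as numerals in base \<open>B\<close>, and one-sided correctness of a
  search\<close>

subsection \<open>Enumerating choices\<close>

definition digs :: "nat \<Rightarrow> nat \<Rightarrow> nat \<times> nat \<times> nat \<times> nat" where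
  "digs B N = (N mod B, N div B mod B, N div B div B mod B, N div B div B div B mod B)"

lemma digs_exist:
  assumes "\<And>i s j M. (i, s, j, M) \<in> set ds \<Longrightarrow> i < B \<and> s < B \<and> j < B \<and> M < B" "0 < B"
  shows "\<exists>N < B ^ (4 * length ds). \<forall>i < length ds. digs B (N div B ^ (4 * i)) = ds ! i"
  using assms(1)
proof (induction ds)
  case Nil
  then show ?case by simp
next
  case (Cons d ds)
  obtain i s j M where d: "d = (i, s, j, M)" by (cases d) auto
  then have lt: "i < B" "s < B" "j < B" "M < B" using Cons.prems by auto
  obtain N where N: "N < B ^ (4 * length ds)" "\<And>i. i < length ds \<Longrightarrow> digs B (N div B ^ (4 * i)) = ds ! i"
    using Cons.IH Cons.prems by force
  \<comment> \<open>\<open>c x a\<close> puts the digit \<open>a\<close> below the numeral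
    \<open>x\<close>.\<close>
  define c where "c x a = a + B * x" for x a
  have c: "c x a div B = x" "c x a mod B = a" "c x a < B * Suc x" if "a < B" for x a
    using that by (simp_all add: c_def)
  define N4 where "N4 = c (c (c (c N M) j) s) i"
  have "N4 div B div B div B div B = N" using c lt by (simp add: N4_def)
  then have div4: "N4 div B ^ 4 = N" by (simp add: power4_eq_xxxx div_mult2_eq)
  have bnd: "c x a < B * y" if "a < B" "x < y" for x a y
    using c(3)[OF that(1), of x] that(2) by (meson Suc_leI less_le_trans mult_le_mono2)
  have "N4 < B * (B * (B * (B * B ^ (4 * length ds))))"
    unfolding N4_def by (intro bnd lt N(1))
  also have "\<dots> = B ^ (4 * length (d # ds))" by (simp add: power_add numeral_eq_Suc)
  finally have "N4 < B ^ (4 * length (d # ds))" .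
  moreover have "digs B (N4 div B ^ (4 * t)) = (d # ds) ! t" if "t < length (d # ds)" for t
  proof (cases t)
    case 0
    then show ?thesis using c lt by (simp add: digs_def N4_def d)
  next
    case (Suc t')
    have "N4 div B ^ (4 * t) = N4 div B ^ 4 div B ^ (4 * t')"
      by (simp add: Suc power_add div_mult2_eq)
    then show ?thesis using N(2)[of t'] that Suc by (simp add: div4)
  qed
  ultimately show ?case by blast
qed

text \<open>An answer that changes must become 1 and be justified by an accepted set. Soundness
  composes without regard to what is being guessed, so completeness needs one good iteration
  only.\<close>

definition sound :: "stm \<Rightarrow> bool" where
  "sound P \<longleftrightarrow> (\<forall>s. env s \<longrightarrow> env (sem P s)
     \<and> (fst (sem P s) vAns = fst s vAns \<or> fst (sem P s) vAns = 1 \<and> (\<exists>A. accepts b p A)))"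

lemma sound_frame: "vAns \<notin> mv P \<Longrightarrow> mv P \<inter> {2, 3, 4, 35} = {} \<Longrightarrow> 0 \<notin> ma P \<Longrightarrow> sound P"
  by (auto simp: sound_def env_sem)

lemma sound_Sq:
  assumes "sound P" "sound Q"
  shows "sound (Sq P Q)"
  unfolding sound_def
proof (intro allI impI)
  fix s assume s: "env s"
  from assms(1) s have "env (sem P s)" "fst (sem P s) vAns = fst s vAns \<or> fst (sem P s) vAns = 1 \<and> (\<exists>A. accepts b p A)"
    unfolding sound_def by blast+
  moreover from assms(2) this(1) have "env (sem Q (sem P s))"
    "fst (sem Q (sem P s)) vAns = fst (sem P s) vAns \<or> fst (sem Q (sem P s)) vAns = 1 \<and> (\<exists>A. accepts b p A)"
    unfolding sound_def by blast+
  ultimately show "env (sem (Sq P Q) s) \<and> (fst (sem (Sq P Q) s) vAns = fst s vAns \<or>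
      fst (sem (Sq P Q) s) vAns = 1 \<and> (\<exists>A. accepts b p A))"
    by (simp only: sem.simps(4)) presburger
qed

lemma sound_VER: "sound VER"
  by (auto simp: sound_def env_sem sem_VER)

lemma sound_For:
  assumes "sound P" "x \<notin> {0, 2, 3, 4, 35}"
  shows "sound (For x c P)"
  unfolding sound_def
proof (intro allI impI)
  fix s assume s: "env s"
  define I where "I i s' \<longleftrightarrow> env s' \<and> (fst s' vAns = fst s vAns \<or> fst s' vAns = 1 \<and> (\<exists>A. accepts b p A))"
    for i :: nat and s' :: st
  have "I (fst s c) (sem (For x c P) s)"
  proof (rule sem_For_inv)
    show "I 0 s" using s by (simp add: I_def)
  next
    fix i s' assume "I i s'"
    moreover have "env ((fst s')(x := i), snd s') = env s'" by (rule env_upd(1)) (use assms(2) in auto)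
    moreover have "fst ((fst s')(x := i), snd s') vAns = fst s' vAns" using assms(2) by auto
    ultimately show "I (Suc i) (sem P ((fst s')(x := i), snd s'))"
      using assms(1) unfolding I_def sound_def by metis
  qed
  then show "env (sem (For x c P) s) \<and> (fst (sem (For x c P) s) vAns = fst s vAns \<or>
      fst (sem (For x c P) s) vAns = 1 \<and> (\<exists>A. accepts b p A))" by (simp add: I_def)
qed

text \<open>Iteration \<open>j\<close> sets the answer, and later iterations keep it because a sound
  body changes the answer only to 1. All other iterations can be ignored.\<close>

lemma sem_For_hit:
  assumes "sound P" "x \<notin> {0, 2, 3, 4, 35}" "env s" "j < fst s c"
    "\<And>s'. \<lbrakk>env s'; \<And>y. y \<noteq> x \<Longrightarrow> y \<notin> mv P \<Longrightarrow> fst s' y = fst s y; \<And>a. a \<notin> ma P \<Longrightarrow> snd s' a = snd s a;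
      fst s' x = j\<rbrakk> \<Longrightarrow> fst (sem P s') vAns = 1"
  shows "fst (sem (For x c P) s) vAns = 1"
proof -
  define I where "I i s' \<longleftrightarrow> env s' \<and> (j < i \<longrightarrow> fst s' vAns = 1)" for i :: nat and s' :: st
  have "I (fst s c) (sem (For x c P) s)"
  proof (rule sem_For_inv)
    show "I 0 s" using assms(3) by (simp add: I_def)
  next
    fix i s' assume i: "I i s'" "\<And>y. y \<noteq> x \<Longrightarrow> y \<notin> mv P \<Longrightarrow> fst s' y = fst s y"
      "\<And>a. a \<notin> ma P \<Longrightarrow> snd s' a = snd s a"
    let ?s = "((fst s')(x := i), snd s')"
    have e: "env ?s" using i(1) assms(2) env_upd(1)[of x s' i] by (auto simp: I_def)
    then have "env (sem P ?s)" "fst (sem P ?s) vAns = fst ?s vAns \<or> fst (sem P ?s) vAns = 1"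
      using assms(1) unfolding sound_def by blast+
    moreover have "fst (sem P ?s) vAns = 1" if "i = j"
      by (rule assms(5)) (use e i(2,3) that in auto)
    moreover have "fst ?s vAns = fst s' vAns" using assms(2) by auto
    ultimately show "I (Suc i) (sem P ?s)" using i(1) by (auto simp: I_def less_Suc_eq)
  qed
  then show ?thesis using assms(4) by (simp add: I_def)
qed

lemma sound_SMALL: "sound SMALL"
  unfolding SMALL_def
  by (intro sound_For sound_Sq sound_VER sound_frame) auto

lemma sem_SMALL:
  assumes "env s" "fst s vPl = p" "0 < p" "fst s vBl = b" "fst s vB = B" "0 < B" "N < fst s vNN"
    "accepts b p (\<Union>i<b. pick p (digs B (N div B ^ (4 * i))))"
  shows "fst (sem SMALL s) vAns = 1"
  unfolding SMALL_def
proof (rule sem_For_hit[OF _ _ assms(1,7)])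
  let ?P = "Sq (DIGIT vI) (Sq (DIGIT vSi) (Sq (DIGIT vJ) (Sq (DIGIT vM) PICK)))"
  let ?Q = "Sq (CLEAR aA) (Sq (Asg vG1 (Var vG)) (Sq (For vIt vBl ?P) VER))"
  show "sound ?Q" by (intro sound_Sq sound_For sound_VER sound_frame) auto
  fix s' assume s': "env s'" "\<And>y. y \<noteq> vG \<Longrightarrow> y \<notin> mv ?Q \<Longrightarrow> fst s' y = fst s y" "fst s' vG = N"
  define s1 where "s1 = sem (Asg vG1 (Var vG)) (sem (CLEAR aA) s')"
  have v1: "fst s1 y = fst s y" if "y \<in> {vPl, vBl, vB, vNN}" for y
    using s'(2)[of y] that by (auto simp: s1_def)
  have env1: "env s1" using s'(1) unfolding s1_def by (subst env_sem; simp)+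
  have A1: "aset n (snd s1 aA) = {}" using aset_CLEAR[OF envD(1)[OF s'(1)], of aA] by (simp add: s1_def)
  have G1: "fst s1 vG1 = N" using s'(3) by (simp add: s1_def)
  define I where "I i s2 \<longleftrightarrow> fst s2 vG1 = N div B ^ (4 * i) \<and>
    aset n (snd s2 aA) = (\<Union>j<i. pick p (digs B (N div B ^ (4 * j))))" for i and s2 :: st
  have "I (fst s1 vBl) (sem (For vIt vBl ?P) s1)"
  proof (rule sem_For_inv)
    show "I 0 s1" using A1 G1 by (simp add: I_def)
  next
    fix i s2 assume i: "I i s2" "\<And>y. y \<noteq> vIt \<Longrightarrow> y \<notin> mv ?P \<Longrightarrow> fst s2 y = fst s1 y"
      "\<And>a. a \<notin> ma ?P \<Longrightarrow> snd s2 a = snd s1 a"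
    define X where "X = N div B ^ (4 * i)"
    have X: "X < fst s vNN" unfolding X_def by (rule le_less_trans[OF div_le_dividend assms(7)])
    have Xd: "X div B < fst s vNN" "X div B div B < fst s vNN" "X div B div B div B < fst s vNN"
      using X by (auto intro: le_less_trans[OF div_le_dividend])
    define t0 where "t0 = ((fst s2)(vIt := i), snd s2)"
    have c0: "fst t0 vNN = fst s vNN" "fst t0 vB = B" "fst t0 vPl = p" "fst t0 vG1 = X"
      using i(1,2) v1 assms(2,5) by (simp_all add: t0_def I_def X_def)
    define t1 where "t1 = sem (DIGIT vI) t0"
    define t2 where "t2 = sem (DIGIT vSi) t1"
    define t3 where "t3 = sem (DIGIT vJ) t2"
    define t4 where "t4 = sem (DIGIT vM) t3"
    have c1: "fst t1 vNN = fst s vNN" "fst t1 vB = B" "fst t1 vPl = p" "fst t1 vG1 = X div B" "fst t1 vI = X mod B"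
      using c0 X assms(6) sem_DIGIT[of t0 vI] by (simp_all add: t1_def)
    have c2: "fst t2 vNN = fst s vNN" "fst t2 vB = B" "fst t2 vPl = p" "fst t2 vG1 = X div B div B" "fst t2 vI = X mod B"
      "fst t2 vSi = X div B mod B"
      using c1 X Xd assms(6) sem_DIGIT[of t1 vSi] by (simp_all add: t2_def)
    have c3: "fst t3 vNN = fst s vNN" "fst t3 vB = B" "fst t3 vPl = p" "fst t3 vG1 = X div B div B div B" "fst t3 vI = X mod B"
      "fst t3 vSi = X div B mod B" "fst t3 vJ = X div B div B mod B"
      using c2 X Xd assms(6) sem_DIGIT[of t2 vJ] by (simp_all add: t3_def)
    have c4: "fst t4 vNN = fst s vNN" "fst t4 vPl = p" "fst t4 vG1 = X div B div B div B div B" "fst t4 vI = X mod B"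
      "fst t4 vSi = X div B mod B" "fst t4 vJ = X div B div B mod B" "fst t4 vM = X div B div B div B mod B"
      using c3 X Xd assms(6) sem_DIGIT[of t3 vM] by (simp_all add: t4_def)
    have "env t0" using env1 i(2,3) by (simp add: env_def t0_def)
    then have env4: "env t4" unfolding t4_def t3_def t2_def t1_def by (simp add: env_sem)
    have a4: "snd t4 = snd s2" by (simp add: t4_def t3_def t2_def t1_def t0_def snd_sem_eq)
    have M: "fst t4 vM < fst t4 vNN"
      unfolding c4 by (rule le_less_trans[OF mod_less_eq_dividend Xd(3)])
    have "sem ?P ((fst s2)(vIt := i), snd s2) = sem PICK t4" by (simp add: t4_def t3_def t2_def t1_def t0_def)
    moreover have "N div B ^ (4 * Suc i) = X div B div B div B div B"
    proof -
      have "B ^ (4 * Suc i) = B ^ (4 * i) * B * B * B * B" by (simp add: power_add power4_eq_xxxx)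
      then show ?thesis by (simp only: X_def div_mult2_eq)
    qed
    moreover have "pick p (fst t4 vI, fst t4 vSi, fst t4 vJ, fst t4 vM) = pick p (digs B X)" by (simp add: digs_def c4)
    ultimately show "I (Suc i) (sem ?P ((fst s2)(vIt := i), snd s2))"
      using sem_PICK[OF env4 c4(2) assms(3) M] i(1) a4 c4(3) by (simp add: I_def X_def lessThan_Suc Un_commute)
  qed
  then have "aset n (snd (sem (For vIt vBl ?P) s1) aA) = (\<Union>i<b. pick p (digs B (N div B ^ (4 * i))))"
    using v1 assms(4) by (simp add: I_def)
  moreover have "env (sem (For vIt vBl ?P) s1)" using env1 by (subst env_sem) auto
  ultimately show "fst (sem ?Q s') vAns = 1"
    using assms(8) by (simp add: s1_def sem_VER)
qed auto

end


section \<open>Residual networks and the least minimum cut\<close>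

section \<open>Minimum cuts by reversing paths\<close>

definition cut :: "nat \<Rightarrow> (nat \<Rightarrow> nat \<Rightarrow> nat) \<Rightarrow> nat set \<Rightarrow> nat" where
  "cut w c Z = (\<Sum>x\<in>Z. \<Sum>y\<in>{..<w} - Z. c x y)"

definition closed_set :: "nat \<Rightarrow> (nat \<Rightarrow> nat \<Rightarrow> nat) \<Rightarrow> nat set \<Rightarrow> bool" where
  "closed_set w c Z \<longleftrightarrow> (\<forall>x\<in>Z. \<forall>y<w. c x y \<noteq> 0 \<longrightarrow> y \<in> Z)"

lemma cut_cong:
  assumes "\<And>x y. x < w \<Longrightarrow> y < w \<Longrightarrow> c x y = c' x y" "Z \<subseteq> {..<w}"
  shows "cut w c Z = cut w c' Z"
  unfolding cut_def by (intro sum.cong refl) (use assms in auto)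

lemma cut_eq_0_iff:
  assumes "Z \<subseteq> {..<w}"
  shows "cut w c Z = 0 \<longleftrightarrow> closed_set w c Z"
proof -
  have "finite Z" using assms finite_subset by blast
  then have "cut w c Z = 0 \<longleftrightarrow> (\<forall>x\<in>Z. \<forall>y\<in>{..<w} - Z. c x y = 0)" by (simp add: cut_def sum_eq_0_iff)
  also have "\<dots> \<longleftrightarrow> closed_set w c Z" unfolding closed_set_def by (metis DiffE DiffI lessThan_iff)
  finally show ?thesis .
qed

lemma cut_ge_arc:
  assumes "Z \<subseteq> {..<w}" "x \<in> Z" "y \<notin> Z" "y < w"
  shows "c x y \<le> cut w c Z"
proof -
  have "finite Z" using assms(1) finite_subset by blast
  have "c x y \<le> (\<Sum>y\<in>{..<w} - Z. c x y)" using assms by (intro member_le_sum) auto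
  also have "\<dots> \<le> cut w c Z" unfolding cut_def using \<open>finite Z\<close> assms(2)
    by (intro member_le_sum[of x Z "\<lambda>x. \<Sum>y\<in>{..<w} - Z. c x y"]) auto
  finally show ?thesis .
qed

text \<open>Only the cells of the two opposite arcs change. Along a path from source to sink the two
  correction terms telescope; the additive form avoids subtraction.\<close>

lemma cut_reverse:
  assumes "x < w" "y < w" "x \<noteq> y" "c x y \<noteq> 0" "Z \<subseteq> {..<w}"
    and "\<And>u v. u < w \<Longrightarrow> v < w \<Longrightarrow> c' u v = (if (u, v) = (x, y) then c u v - 1 else if (u, v) = (y, x) then c u v + 1 else c u v)"
  shows "cut w c' Z + of_bool (x \<in> Z \<and> y \<notin> Z) = cut w c Z + of_bool (y \<in> Z \<and> x \<notin> Z)"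
proof -
  have fin: "finite Z" using assms(5) finite_subset by blast
  let ?P = "Z \<times> ({..<w} - Z)"
  have cut: "cut w d Z = (\<Sum>(u, v)\<in>?P. d u v)" for d
    unfolding cut_def by (rule sum.cartesian_product)
  have one: "(\<Sum>q\<in>?P. of_bool (q = r)) = (of_bool (r \<in> ?P) :: nat)" for r
    using fin by (simp add: of_bool_def)
  have "(\<Sum>q\<in>?P. (case q of (u, v) \<Rightarrow> c' u v) + of_bool (q = (x, y)))
      = (\<Sum>q\<in>?P. (case q of (u, v) \<Rightarrow> c u v) + of_bool (q = (y, x)))"
  proof (intro sum.cong refl)
    fix q assume "q \<in> ?P"
    then obtain u v where q: "q = (u, v)" "u < w" "v < w" using assms(5) by auto
    then show "(case q of (u, v) \<Rightarrow> c' u v) + of_bool (q = (x, y)) = (case q of (u, v) \<Rightarrow> c u v) + of_bool (q = (y, x))"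
      using assms(6)[OF q(2,3)] assms(3,4) by auto
  qed
  then have "cut w c' Z + of_bool ((x, y) \<in> ?P) = cut w c Z + of_bool ((y, x) \<in> ?P)"
    by (simp only: sum.distrib one cut)
  then show ?thesis using assms(1,2) by simp
qed

lemma cell_eq_iff: "y < w \<Longrightarrow> y' < w \<Longrightarrow> x * w + y = x' * w + y' \<longleftrightarrow> x = x' \<and> y = (y' :: nat)"
proof
  assume lt: "y < w" "y' < w" and eq: "x * w + y = x' * w + y'"
  have "x = (x * w + y) div w" using lt by simp
  also have "\<dots> = x'" using lt by (simp add: eq)
  finally show "x = x' \<and> y = y'" using eq by simp
qed simp

abbreviation (input) vSrc :: nat where "vSrc \<equiv> 38"
abbreviation (input) vSnk :: nat where "vSnk \<equiv> 39"
abbreviation (input) vI1 :: nat where "vI1 \<equiv> 40"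
abbreviation (input) vI2 :: nat where "vI2 \<equiv> 41"
abbreviation (input) vCv :: nat where "vCv \<equiv> 42"
abbreviation (input) vTs :: nat where "vTs \<equiv> 43"
abbreviation (input) vRr :: nat where "vRr \<equiv> 44"
abbreviation (input) vCur :: nat where "vCur \<equiv> 45"
abbreviation (input) vPr :: nat where "vPr \<equiv> 46"
abbreviation (input) vAug :: nat where "vAug \<equiv> 47"
abbreviation (input) vFu :: nat where "vFu \<equiv> 48"
abbreviation (input) vRd :: nat where "vRd \<equiv> 49"

abbreviation (input) aCap :: nat where "aCap \<equiv> 6"
abbreviation (input) aVis :: nat where "aVis \<equiv> 7"
abbreviation (input) aPar :: nat where "aPar \<equiv> 8"
abbreviation (input) aSt :: nat where "aSt \<equiv> 9"
abbreviation (input) aDg :: nat where "aDg \<equiv> 10"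

definition cell :: "nat \<Rightarrow> nat \<Rightarrow> ex" where "cell x y = Plus (Times (Var x) vW) (Var y)"

definition VISIT :: stm where
  "VISIT = Cond (And (And (Arr aVis (Var vI1)) (Arr aCap (cell vI1 vI2))) (Not (Arr aVis (Var vI2))))
     (Sq (inc vTs) (Sq (Wr aVis (Var vI2) (Var vTs)) (Wr aPar (Var vI2) (Var vI1)))) Nop"

definition REACH :: stm where
  "REACH = Sq (For vV vW (Wr aVis (Var vV) (Num 0))) (Sq (Wr aVis (Var vSrc) (Num 1)) (Sq (Asg vTs (Num 1))
     (For vRr vW (For vI1 vW (For vI2 vW VISIT)))))"

definition BACK :: stm where
  "BACK = Cond (Eq (Var vCur) (Var vSrc)) Nop (Sq (Asg vPr (Arr aPar (Var vCur)))
     (Sq (Wr aCap (cell vPr vCur) (Minus (Arr aCap (cell vPr vCur)) (Num 1)))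
     (Sq (Wr aCap (cell vCur vPr) (Plus (Arr aCap (cell vCur vPr)) (Num 1))) (Asg vCur (Var vPr)))))"

definition AUG :: stm where
  "AUG = Sq (Asg vCur (Var vSnk)) (For vRr vW BACK)"

text \<open>\<open>vBl\<close> attempts to augment are enough, because only networks with a cut of
  value at most \<open>b\<close> matter. The final \<open>REACH\<close> produces the least minimum
  cut.\<close>

definition MINCUT :: stm where
  "MINCUT = Sq (For vAug vBl (Sq REACH (Cond (Arr aVis (Var vSnk)) AUG Nop))) REACH"

lemma mv_flow [simp]:
  "mv VISIT = {vTs}" "mv REACH = {vV, vTs, vRr, vI1, vI2}" "mv BACK = {vPr, vCur}" "mv AUG = {vCur, vRr, vPr}"
  "mv MINCUT = {vV, vTs, vRr, vI1, vI2, vCur, vPr, vAug}"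
  by (simp_all add: VISIT_def REACH_def BACK_def AUG_def MINCUT_def, auto)

lemma ma_flow [simp]:
  "ma VISIT = {aVis, aPar}" "ma REACH = {aVis, aPar}" "ma BACK = {aCap}" "ma AUG = {aCap}"
  "ma MINCUT = {aVis, aPar, aCap}"
  by (simp_all add: VISIT_def REACH_def BACK_def AUG_def MINCUT_def, auto)

locale network =
  fixes w src snk :: nat
  assumes src: "src < w" and snk: "snk < w" and src_snk: "src \<noteq> snk"
begin

definition capf :: "st \<Rightarrow> nat \<Rightarrow> nat \<Rightarrow> nat" where
  "capf s x y = snd s aCap (x * w + y)"

lemma capf_snd [simp]: "capf (v, snd s) = capf s"
  by (simp add: capf_def fun_eq_iff)

definition nenv :: "st \<Rightarrow> bool" where
  "nenv s \<longleftrightarrow> fst s vW = w \<and> fst s vSrc = src \<and> fst s vSnk = snk"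

text \<open>
  \<open>f\<close> holds the times at which vertices were reached from the source, \<open>g\<close> their predecessors.
\<close>

definition search_tree :: "(nat \<Rightarrow> nat \<Rightarrow> nat) \<Rightarrow> (nat \<Rightarrow> nat) \<Rightarrow> (nat \<Rightarrow> nat) \<Rightarrow> nat \<Rightarrow> bool" where
  "search_tree c f g T \<longleftrightarrow> f src = 1 \<and> T = card (aset w f) \<and> (\<forall>y<w. f y \<le> T)
     \<and> (\<forall>y<w. y \<noteq> src \<longrightarrow> f y \<noteq> 0 \<longrightarrow> g y < w \<and> f (g y) \<noteq> 0 \<and> f (g y) < f y \<and> c (g y) y \<noteq> 0)
     \<and> (\<forall>Z. src \<in> Z \<longrightarrow> closed_set w c Z \<longrightarrow> aset w f \<subseteq> Z)"

definition tree_rep :: "(nat \<Rightarrow> nat \<Rightarrow> nat) \<Rightarrow> st \<Rightarrow> bool" where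
  "tree_rep c s \<longleftrightarrow> nenv s \<and> (\<forall>x<w. \<forall>y<w. capf s x y = c x y)
     \<and> search_tree c (snd s aVis) (snd s aPar) (fst s vTs)"

lemma search_tree_step:
  assumes "search_tree c f g T" "x < w" "y < w" "f x \<noteq> 0" "c x y \<noteq> 0" "f y = 0"
  shows "search_tree c (f(y := Suc T)) (g(y := x)) (Suc T)"
  unfolding search_tree_def
proof (intro conjI allI impI)
  have T: "T = card (aset w f)" "\<And>z. z < w \<Longrightarrow> f z \<le> T" "f src = 1"
    and g: "\<And>z. z < w \<Longrightarrow> z \<noteq> src \<Longrightarrow> f z \<noteq> 0 \<Longrightarrow> g z < w \<and> f (g z) \<noteq> 0 \<and> f (g z) < f z \<and> c (g z) z \<noteq> 0"
    and Z: "\<And>Z. src \<in> Z \<Longrightarrow> closed_set w c Z \<Longrightarrow> aset w f \<subseteq> Z"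
    using assms(1) unfolding search_tree_def by blast+
  show "(f(y := Suc T)) src = 1" using T(3) assms(6) by auto
  have "y \<notin> aset w f" using assms(6) by (simp add: aset_def)
  then show "Suc T = card (aset w (f(y := Suc T)))" using assms(3) T(1) by (simp add: aset_upd)
  fix z
  show "z < w \<Longrightarrow> (f(y := Suc T)) z \<le> Suc T" using T(2)[of z] by auto
  assume z: "z < w" "z \<noteq> src" "(f(y := Suc T)) z \<noteq> 0"
  have "(g(y := x)) z < w \<and> (f(y := Suc T)) ((g(y := x)) z) \<noteq> 0 \<and> (f(y := Suc T)) ((g(y := x)) z) < (f(y := Suc T)) z
      \<and> c ((g(y := x)) z) z \<noteq> 0"
  proof (cases "z = y")
    case True
    have "x \<noteq> y" using assms(4,6) by auto
    then show ?thesis using True assms T(2)[OF assms(2)] by simp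
  next
    case False
    then have "g z < w \<and> f (g z) \<noteq> 0 \<and> f (g z) < f z \<and> c (g z) z \<noteq> 0" using g z by simp
    then show ?thesis using False assms(6) by auto
  qed
  then show "(g(y := x)) z < w" "(f(y := Suc T)) ((g(y := x)) z) \<noteq> 0"
    "(f(y := Suc T)) ((g(y := x)) z) < (f(y := Suc T)) z" "c ((g(y := x)) z) z \<noteq> 0" by blast+
next
  fix Z assume Z: "src \<in> Z" "closed_set w c Z"
  then have "aset w f \<subseteq> Z" using assms(1) unfolding search_tree_def by blast
  moreover have "x \<in> aset w f" using assms(2,4) by (simp add: aset_def)
  ultimately have "y \<in> Z" using Z(2) assms(3,5) unfolding closed_set_def by blast
  then show "aset w (f(y := Suc T)) \<subseteq> Z" using \<open>aset w f \<subseteq> Z\<close> assms(3) by (simp add: aset_upd)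
qed

lemma sem_VISIT:
  assumes "tree_rep c s" "fst s vI1 = x" "fst s vI2 = y" "x < w" "y < w"
  shows "tree_rep c (sem VISIT s)"
    "fst s vTs < fst (sem VISIT s) vTs \<or> sem VISIT s = s \<and> (x \<in> aset w (snd s aVis) \<longrightarrow> c x y \<noteq> 0 \<longrightarrow> y \<in> aset w (snd s aVis))"
proof -
  let ?c = "And (And (Arr aVis (Var vI1)) (Arr aCap (cell vI1 vI2))) (Not (Arr aVis (Var vI2)))"
  have c: "tt ?c s \<longleftrightarrow> snd s aVis x \<noteq> 0 \<and> c x y \<noteq> 0 \<and> snd s aVis y = 0"
    using assms by (simp add: tree_rep_def nenv_def capf_def cell_def)
  show "tree_rep c (sem VISIT s)"
  proof (cases "tt ?c s")
    case True
    then show ?thesis using assms c search_tree_step[of c "snd s aVis" "snd s aPar" "fst s vTs" x y]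
      by (simp add: VISIT_def tree_rep_def nenv_def capf_def del: tt_simps)
  next
    case False
    then show ?thesis using assms(1) by (simp add: VISIT_def del: tt_simps)
  qed
  show "fst s vTs < fst (sem VISIT s) vTs \<or> sem VISIT s = s \<and> (x \<in> aset w (snd s aVis) \<longrightarrow> c x y \<noteq> 0 \<longrightarrow> y \<in> aset w (snd s aVis))"
    using c assms(4,5) by (cases "tt ?c s") (auto simp: VISIT_def aset_def simp del: tt_simps)
qed

text \<open>A round over all pairs visits a new vertex or shows the visited set to be closed.
  \<open>vTs\<close> counts the visited vertices, starting at 1, so after \<open>w\<close> rounds
  only closedness is possible.\<close>

lemma sem_REACH:
  assumes "nenv s" "\<And>x y. x < w \<Longrightarrow> y < w \<Longrightarrow> capf s x y = c x y"
  shows "tree_rep c (sem REACH s)" "closed_set w c (aset w (snd (sem REACH s) aVis))"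
proof -
  define s0 where "s0 = sem (Sq (For vV vW (Wr aVis (Var vV) (Num 0))) (Sq (Wr aVis (Var vSrc) (Num 1)) (Asg vTs (Num 1)))) s"
  define I0 where "I0 i s' \<longleftrightarrow> (\<forall>v<i. snd s' aVis v = 0)" for i and s' :: st
  have "I0 (fst s vW) (sem (For vV vW (Wr aVis (Var vV) (Num 0))) s)"
    by (rule sem_For_inv) (auto simp: I0_def less_Suc_eq)
  then have vis0: "snd s0 aVis v = (if v = src then 1 else 0)" if "v < w" for v
    using assms(1) that by (simp add: I0_def s0_def nenv_def)
  have "aset w (snd s0 aVis) = {src}" using vis0 src by (auto simp: aset_def split: if_splits)
  then have "search_tree c (snd s0 aVis) (snd s0 aPar) (fst s0 vTs)"
    using vis0 src unfolding search_tree_def by (auto simp: s0_def split: if_splits)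
  then have t0: "tree_rep c s0" using assms by (simp add: tree_rep_def nenv_def capf_def s0_def)
  define Vis where "Vis s' = aset w (snd s' aVis)" for s' :: st
  have TV: "fst s' vTs = card (Vis s')" if "tree_rep c s'" for s' :: st
    using that by (simp add: tree_rep_def search_tree_def Vis_def)
  define I where "I i s' \<longleftrightarrow> tree_rep c s' \<and> (i < fst s' vTs \<or> closed_set w c (Vis s'))" for i and s' :: st
  have W: "fst s0 vW = w" using t0 by (simp add: tree_rep_def nenv_def)
  have rep_upd: "tree_rep c ((fst s')(x := i), snd s') = tree_rep c s'" if "x \<in> {vRr, vI1, vI2}" for s' :: st and x i
    using that by (auto simp: tree_rep_def nenv_def capf_def)
  have "I (fst s0 vW) (sem (For vRr vW (For vI1 vW (For vI2 vW VISIT))) s0)"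
  proof (rule sem_For_inv)
    show "I 0 s0" using t0 unfolding I_def by (simp add: s0_def)
  next
    fix r s' assume r: "I r s'"
    define s1 where "s1 = ((fst s')(vRr := r), snd s')"
    have t1: "tree_rep c s1" using r rep_upd by (simp add: I_def s1_def)
    then have W1: "fst s1 vW = w" by (simp add: tree_rep_def nenv_def)
    \<comment> \<open>Progress within a round, in lexicographic order of the pairs: unless a vertex
      has been added, no pair scanned so far leaves the visited set.\<close>
    define same where "same i j s2 \<longleftrightarrow> tree_rep c s2 \<and> (fst s1 vTs < fst s2 vTs \<or> Vis s2 = Vis s1 \<and> fst s2 vTs = fst s1 vTs
      \<and> (\<forall>x\<in>Vis s1. \<forall>y<w. x < i \<or> x = i \<and> y < j \<longrightarrow> c x y \<noteq> 0 \<longrightarrow> y \<in> Vis s1))" for i j and s2 :: st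
    have "same (fst s1 vW) 0 (sem (For vI1 vW (For vI2 vW VISIT)) s1)"
    proof (rule sem_For_inv[where I = "\<lambda>i. same i 0"])
      show "same 0 0 s1" using t1 by (simp add: same_def)
    next
      fix i s2 assume i: "i < fst s1 vW" "same i 0 s2"
      define s3 where "s3 = ((fst s2)(vI1 := i), snd s2)"
      have t3: "same i 0 s3" using i(2) rep_upd by (simp add: same_def s3_def Vis_def)
      then have W3: "fst s3 vW = w" by (simp add: same_def tree_rep_def nenv_def)
      have "same i (fst s3 vW) (sem (For vI2 vW VISIT) s3)"
      proof (rule sem_For_inv[where I = "same i"])
        show "same i 0 s3" by (rule t3)
      next
        fix j s4 assume j: "j < fst s3 vW" "same i j s4" "\<And>y. y \<noteq> vI2 \<Longrightarrow> y \<notin> mv VISIT \<Longrightarrow> fst s4 y = fst s3 y"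
        let ?s = "((fst s4)(vI2 := j), snd s4)"
        have t: "tree_rep c ?s" using j(2) rep_upd by (simp add: same_def)
        have i1: "fst ?s vI1 = i" using j(3) by (simp add: s3_def)
        have "i < w" "j < w" using i(1) j(1) W1 W3 by auto
        note v = sem_VISIT[OF t i1 _ this]
        have 1: "tree_rep c (sem VISIT ?s)" by (rule v(1)) simp
        have 2: "fst ?s vTs < fst (sem VISIT ?s) vTs \<or>
            sem VISIT ?s = ?s \<and> (i \<in> Vis ?s \<longrightarrow> c i j \<noteq> 0 \<longrightarrow> j \<in> Vis ?s)"
          unfolding Vis_def by (rule v(2)) simp
        have V: "Vis ?s = Vis s4" "fst ?s vTs = fst s4 vTs" by (simp_all add: Vis_def)
        define u where "u = sem VISIT ?s"
        have u: "tree_rep c u" "fst s4 vTs < fst u vTs \<or> Vis u = Vis s4 \<and> fst u vTs = fst s4 vTs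
            \<and> (i \<in> Vis s4 \<longrightarrow> c i j \<noteq> 0 \<longrightarrow> j \<in> Vis s4)"
          using 1 2 V unfolding u_def by metis+
        show "same i (Suc j) (sem VISIT ?s)"
          unfolding same_def u_def[symmetric]
        proof (intro conjI u(1))
          from j(2) consider "fst s1 vTs < fst s4 vTs" | "Vis s4 = Vis s1" "fst s4 vTs = fst s1 vTs"
            "\<forall>x\<in>Vis s1. \<forall>y<w. x < i \<or> x = i \<and> y < j \<longrightarrow> c x y \<noteq> 0 \<longrightarrow> y \<in> Vis s1"
            unfolding same_def by blast
          then show "fst s1 vTs < fst u vTs \<or> Vis u = Vis s1 \<and> fst u vTs = fst s1 vTs
            \<and> (\<forall>x\<in>Vis s1. \<forall>y<w. x < i \<or> x = i \<and> y < Suc j \<longrightarrow> c x y \<noteq> 0 \<longrightarrow> y \<in> Vis s1)"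
          proof cases
            case 1
            moreover have "fst s4 vTs \<le> fst u vTs" by (rule disjE[OF u(2)]) linarith+
            ultimately show ?thesis by (intro disjI1) linarith
          next
            case old: 2
            from u(2) show ?thesis
            proof
              assume "fst s4 vTs < fst u vTs"
              then show ?thesis using old(2) by (intro disjI1) simp
            next
              assume new: "Vis u = Vis s4 \<and> fst u vTs = fst s4 vTs \<and> (i \<in> Vis s4 \<longrightarrow> c i j \<noteq> 0 \<longrightarrow> j \<in> Vis s4)"
              have "y \<in> Vis s1" if xy: "x \<in> Vis s1" "y < w" "x < i \<or> x = i \<and> y < Suc j" "c x y \<noteq> 0" for x y
              proof (cases "x = i \<and> y = j")
                case True
                then show ?thesis using new old(1) xy(1,4) by metis
              next
                case False
                then have "x < i \<or> x = i \<and> y < j" using xy(3) by linarith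
                then show ?thesis using old(3) xy by blast
              qed
              then show ?thesis using new old(1,2) by (intro disjI2) simp
            qed
          qed
        qed
      qed
      then show "same (Suc i) 0 (sem (For vI2 vW VISIT) ((fst s2)(vI1 := i), snd s2))"
        unfolding s3_def[symmetric] W3 same_def by (auto simp: less_Suc_eq)
    qed
    then have fin: "same w 0 (sem (For vI1 vW (For vI2 vW VISIT)) s1)" using W1 by simp
    define s5 where "s5 = sem (For vI1 vW (For vI2 vW VISIT)) s1"
    have t5: "tree_rep c s5" using fin by (simp add: same_def s5_def)
    have V1: "Vis s1 = Vis s'" "fst s1 vTs = fst s' vTs" by (simp_all add: Vis_def s1_def)
    have "r < fst s5 vTs - 1 \<or> closed_set w c (Vis s5)"
    proof (cases "fst s1 vTs < fst s5 vTs")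
      case True
      from r have "r < fst s' vTs \<or> closed_set w c (Vis s')" by (simp add: I_def)
      then show ?thesis
      proof
        assume "closed_set w c (Vis s')"
        moreover have "src \<in> Vis s'" using r src by (simp add: I_def tree_rep_def search_tree_def Vis_def aset_def)
        ultimately have "Vis s5 \<subseteq> Vis s'" using t5 unfolding tree_rep_def search_tree_def Vis_def by blast
        then have "card (Vis s5) \<le> card (Vis s')" by (intro card_mono) (simp_all add: Vis_def)
        then show ?thesis using True TV[OF t5] TV[OF t1] V1 by simp
      qed (use True V1 in \<open>intro disjI1, linarith\<close>)
    next
      case False
      then have "Vis s5 = Vis s1 \<and> (\<forall>x\<in>Vis s1. \<forall>y<w. x < w \<longrightarrow> c x y \<noteq> 0 \<longrightarrow> y \<in> Vis s1)"
        using fin unfolding same_def s5_def by auto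
      then show ?thesis by (auto simp: closed_set_def Vis_def aset_def)
    qed
    then have "Suc r < fst s5 vTs \<or> closed_set w c (Vis s5)" by auto
    then show "I (Suc r) (sem (For vI1 vW (For vI2 vW VISIT)) ((fst s')(vRr := r), snd s'))"
      unfolding I_def s1_def[symmetric] s5_def[symmetric] using t5 by blast
  qed
  moreover have "sem REACH s = sem (For vRr vW (For vI1 vW (For vI2 vW VISIT))) s0" by (simp add: REACH_def s0_def)
  ultimately have I: "I w (sem REACH s)" using W by simp
  then show t: "tree_rep c (sem REACH s)" by (simp add: I_def)
  have "card (Vis (sem REACH s)) \<le> card {..<w}" unfolding Vis_def by (intro card_mono) (auto simp: aset_def)
  then show "closed_set w c (aset w (snd (sem REACH s) aVis))"
    using I TV[OF t] by (simp add: I_def Vis_def)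
qed

text \<open>Walking back from \<open>snk\<close>, each reversal changes a cut by the difference of
  the membership indicators of its two ends. The sum telescopes to minus one for every cut that
  separates \<open>src\<close> from \<open>snk\<close>.\<close>

lemma sem_AUG:
  assumes "tree_rep c s" "snd s aVis snk \<noteq> 0" "Z \<subseteq> {..<w}" "src \<in> Z" "snk \<notin> Z"
  shows "Suc (cut w (capf (sem AUG s)) Z) = cut w c Z"
proof -
  define f where "f = snd s aVis"
  define g where "g = snd s aPar"
  define T where "T = fst s vTs"
  have tr: "f src = 1" "T = card (aset w f)" "\<And>y. y < w \<Longrightarrow> f y \<le> T"
    "\<And>y. y < w \<Longrightarrow> y \<noteq> src \<Longrightarrow> f y \<noteq> 0 \<Longrightarrow> g y < w \<and> f (g y) \<noteq> 0 \<and> f (g y) < f y \<and> c (g y) y \<noteq> 0"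
    and cs: "\<And>x y. x < w \<Longrightarrow> y < w \<Longrightarrow> capf s x y = c x y" and ne: "nenv s"
    using assms(1) unfolding tree_rep_def search_tree_def f_def g_def T_def by blast+
  have "card (aset w f) \<le> card {..<w}" by (intro card_mono) (auto simp: aset_def)
  then have Tw: "T \<le> w" using tr(2) by simp
  define s0 where "s0 = ((fst s)(vCur := snk), snd s)"
  \<comment> \<open>Visiting times strictly decrease along the walk. So the arcs still ahead keep
    their capacities, and \<open>w\<close> steps are enough to reach \<open>src\<close>, where
    further steps are idle.\<close>
  define I where "I i s' \<longleftrightarrow> (let cur = fst s' vCur in cur < w \<and> f cur \<noteq> 0 \<and> (cur = src \<or> f cur + i \<le> w)
    \<and> (\<forall>x<w. \<forall>y<w. f x < f y \<longrightarrow> f y \<le> f cur \<longrightarrow> capf s' x y = c x y)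
    \<and> cut w (capf s') Z + of_bool (cur \<in> Z) = cut w c Z)" for i and s' :: st
  have W: "fst s0 vW = w" using ne by (simp add: nenv_def s0_def)
  have "I (fst s0 vW) (sem (For vRr vW BACK) s0)"
  proof (rule sem_For_inv)
    have "cut w (capf s0) Z = cut w c Z"
      by (rule cut_cong[OF _ assms(3)]) (use cs in \<open>simp add: s0_def capf_def\<close>)
    moreover have "f snk + 0 \<le> w" using tr(3)[OF snk] Tw by simp
    ultimately show "I 0 s0" using assms(2,5) snk cs by (simp add: I_def s0_def f_def capf_def)
  next
    fix i s' assume i: "I i s'" "\<And>y. y \<noteq> vRr \<Longrightarrow> y \<notin> mv BACK \<Longrightarrow> fst s' y = fst s0 y"
      "\<And>a. a \<notin> ma BACK \<Longrightarrow> snd s' a = snd s0 a"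
    define cur where "cur = fst s' vCur"
    have c: "cur < w" "f cur \<noteq> 0" "cur = src \<or> f cur + i \<le> w"
      "\<And>x y. x < w \<Longrightarrow> y < w \<Longrightarrow> f x < f y \<Longrightarrow> f y \<le> f cur \<Longrightarrow> capf s' x y = c x y"
      "cut w (capf s') Z + of_bool (cur \<in> Z) = cut w c Z"
      using i(1) unfolding I_def Let_def cur_def by blast+
    have v: "fst s' vSrc = src" "fst s' vW = w" using i(2) ne by (simp_all add: s0_def nenv_def)
    have g': "snd s' aPar = g" using i(3) by (simp add: s0_def g_def)
    let ?s = "((fst s')(vRr := i), snd s')"
    show "I (Suc i) (sem BACK ?s)"
    proof (cases "cur = src")
      case True
      then have "sem BACK ?s = ?s" using v by (simp add: BACK_def cur_def)
      then show ?thesis using True c by (simp add: I_def Let_def cur_def capf_def)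
    next
      case False
      define pr where "pr = g cur"
      have pr: "pr < w" "f pr \<noteq> 0" "f pr < f cur" "c pr cur \<noteq> 0" using tr(4)[OF c(1) False c(2)] by (auto simp: pr_def)
      then have pc: "pr \<noteq> cur" by auto
      have cap: "capf s' pr cur = c pr cur" by (rule c(4)) (use pr c in auto)
      let ?s1 = "sem BACK ?s"
      have s1: "fst ?s1 vCur = pr" "\<And>x y. x < w \<Longrightarrow> y < w \<Longrightarrow> capf ?s1 x y =
          (if (x, y) = (pr, cur) then capf s' x y - 1 else if (x, y) = (cur, pr) then capf s' x y + 1 else capf s' x y)"
        using False v g' pc pr(1) c(1)
        by (auto simp: BACK_def cur_def[symmetric] pr_def[symmetric] cell_def capf_def cell_eq_iff)
      have "cut w (capf ?s1) Z + of_bool (pr \<in> Z \<and> cur \<notin> Z) = cut w (capf s') Z + of_bool (cur \<in> Z \<and> pr \<notin> Z)"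
        by (rule cut_reverse[OF pr(1) c(1) pc _ assms(3) s1(2)]) (use cap pr in auto)
      then have "cut w (capf ?s1) Z + of_bool (pr \<in> Z) = cut w c Z"
        using c(5) by (cases "pr \<in> Z"; cases "cur \<in> Z") simp_all
      moreover have "capf ?s1 x y = c x y" if "x < w" "y < w" "f x < f y" "f y \<le> f pr" for x y
      proof -
        have "(x, y) \<noteq> (pr, cur)" "(x, y) \<noteq> (cur, pr)" using that pr(3) by auto
        then have "capf ?s1 x y = capf s' x y" unfolding s1(2)[OF that(1,2)] by (simp only: if_False)
        also have "\<dots> = c x y" by (rule c(4)[OF that(1-3)]) (use that(4) pr(3) in simp)
        finally show ?thesis .
      qed
      moreover have "pr = src \<or> f pr + Suc i \<le> w" using c(3) False pr(3) by auto
      ultimately show ?thesis using pr by (simp add: I_def Let_def s1(1))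
    qed
  qed
  then have I: "I w (sem AUG s)" using W ne by (simp add: AUG_def s0_def nenv_def)
  then have "fst (sem AUG s) vCur = src" by (auto simp: I_def Let_def)
  then show ?thesis using I assms(4) by (simp add: I_def Let_def)
qed

definition valid_cut :: "nat set \<Rightarrow> bool" where
  "valid_cut Z \<longleftrightarrow> Z \<subseteq> {..<w} \<and> src \<in> Z \<and> snk \<notin> Z"

text \<open>Each augmentation lowers all valid cuts by the same amount, so their comparison can be
  made in the residual network. There the visited set has cut value 0 and is contained in every
  valid cut of value 0.\<close>

theorem sem_MINCUT:
  assumes "nenv s" "valid_cut Z0" "cut w (capf s) Z0 \<le> fst s vBl"
  defines "V \<equiv> aset w (snd (sem MINCUT s) aVis)"
  shows "valid_cut V" "\<And>Z. valid_cut Z \<Longrightarrow> cut w (capf s) V \<le> cut w (capf s) Z"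
    "\<And>Z. valid_cut Z \<Longrightarrow> cut w (capf s) Z = cut w (capf s) V \<Longrightarrow> V \<subseteq> Z"
proof -
  let ?c = "capf s"
  let ?P = "Sq REACH (Cond (Arr aVis (Var vSnk)) AUG Nop)"
  have reach: "search_tree (capf s') (snd (sem REACH s') aVis) (snd (sem REACH s') aPar) (fst (sem REACH s') vTs)"
    "closed_set w (capf s') (aset w (snd (sem REACH s') aVis))" if "nenv s'" for s'
    using sem_REACH[OF that, of "capf s'"] by (auto simp: tree_rep_def)
  have low: "aset w (snd (sem REACH s') aVis) \<subseteq> Z" if "nenv s'" "valid_cut Z" "cut w (capf s') Z = 0" for s' Z
    using reach(1)[OF that(1)] that(2,3) cut_eq_0_iff[of Z w "capf s'"] unfolding search_tree_def valid_cut_def by auto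
  have vs: "valid_cut (aset w (snd (sem REACH s') aVis))" if "nenv s'" "snd (sem REACH s') aVis snk = 0" for s'
    using reach(1)[OF that(1)] that(2) src unfolding search_tree_def valid_cut_def by (auto simp: aset_def)
  define I where "I i s' \<longleftrightarrow> (\<exists>f. (\<forall>Z. valid_cut Z \<longrightarrow> cut w (capf s') Z + f = cut w ?c Z)
    \<and> (f = i \<or> (\<exists>Z. valid_cut Z \<and> cut w (capf s') Z = 0)))" for i and s' :: st
  define s1 where "s1 = sem (For vAug vBl ?P) s"
  have "I (fst s vBl) s1" unfolding s1_def
  proof (rule sem_For_inv)
    show "I 0 s" unfolding I_def by (intro exI[of _ 0]) simp
  next
    fix i s' assume i: "I i s'" "\<And>y. y \<noteq> vAug \<Longrightarrow> y \<notin> mv ?P \<Longrightarrow> fst s' y = fst s y"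
    let ?s = "((fst s')(vAug := i), snd s')"
    have ne: "nenv ?s" using assms(1) i(2) by (simp add: nenv_def)
    have cap: "capf ?s = capf s'" "capf (sem REACH ?s) = capf s'" by (simp_all add: capf_def fun_eq_iff)
    have snk': "fst (sem REACH ?s) vSnk = snk" using ne by (simp add: nenv_def)
    from i(1) obtain f where f: "\<And>Z. valid_cut Z \<Longrightarrow> cut w (capf s') Z + f = cut w ?c Z"
      "f = i \<or> (\<exists>Z. valid_cut Z \<and> cut w (capf s') Z = 0)" unfolding I_def by blast
    show "I (Suc i) (sem ?P ?s)"
    proof (cases "snd (sem REACH ?s) aVis snk = 0")
      case True
      then have "sem ?P ?s = sem REACH ?s" using snk' by simp
      moreover have "valid_cut (aset w (snd (sem REACH ?s) aVis))" by (rule vs[OF ne True])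
      moreover from this have "cut w (capf s') (aset w (snd (sem REACH ?s) aVis)) = 0"
        using reach(2)[OF ne] cut_eq_0_iff unfolding cap valid_cut_def by blast
      ultimately show ?thesis unfolding I_def using f(1) cap by (intro exI[of _ f]) auto
    next
      case False
      have "f = i"
      proof (rule ccontr)
        assume "f \<noteq> i"
        then obtain Z where Z: "valid_cut Z" "cut w (capf ?s) Z = 0" using f(2) cap by auto
        have "snk \<in> Z" using low[OF ne Z] False snk by (auto simp: aset_def)
        then show False using Z(1) by (simp add: valid_cut_def)
      qed
      moreover have "sem ?P ?s = sem AUG (sem REACH ?s)" using False snk' by simp
      moreover have "Suc (cut w (capf (sem AUG (sem REACH ?s))) Z) = cut w (capf s') Z" if "valid_cut Z" for Z
        using sem_AUG[OF sem_REACH(1)[OF ne, of "capf s'"] False, of Z] that unfolding valid_cut_def cap by auto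
      ultimately show ?thesis unfolding I_def using f(1) by (intro exI[of _ "Suc i"]) fastforce
    qed
  qed
  then obtain f where f: "\<And>Z. valid_cut Z \<Longrightarrow> cut w (capf s1) Z + f = cut w ?c Z"
    "f = fst s vBl \<or> (\<exists>Z. valid_cut Z \<and> cut w (capf s1) Z = 0)" unfolding I_def by blast
  have ne1: "nenv s1" using assms(1) by (simp add: s1_def nenv_def)
  \<comment> \<open>If every iteration augmented, \<open>Z0\<close> has lost \<open>vBl\<close>,
    which is at least its value, and is down to 0.\<close>
  have "\<exists>Z. valid_cut Z \<and> cut w (capf s1) Z = 0" using f(2) f(1)[OF assms(2)] assms(2,3) by auto
  then obtain Z1 where Z1: "valid_cut Z1" "cut w (capf s1) Z1 = 0" by blast
  have V: "V = aset w (snd (sem REACH s1) aVis)" by (simp add: V_def MINCUT_def s1_def)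
  have "snd (sem REACH s1) aVis snk = 0"
  proof (rule ccontr)
    assume "snd (sem REACH s1) aVis snk \<noteq> 0"
    then show False using low[OF ne1 Z1] Z1(1) snk by (auto simp: valid_cut_def aset_def)
  qed
  then show vV: "valid_cut V" unfolding V by (rule vs[OF ne1])
  then have "cut w (capf s1) V = 0"
    using reach(2)[OF ne1] cut_eq_0_iff[of V w "capf s1"] unfolding V valid_cut_def by blast
  then have Vf: "cut w ?c V = f" using f(1)[OF vV] by simp
  show "cut w ?c V \<le> cut w ?c Z" if "valid_cut Z" for Z using f(1)[OF that] Vf by simp
  show "V \<subseteq> Z" if "valid_cut Z" "cut w ?c Z = cut w ?c V" for Z
    unfolding V by (rule low[OF ne1 that(1)]) (use f(1)[OF that(1)] Vf that(2) in simp)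
qed

end


section \<open>Networks whose cuts measure the cost of a vertex set\<close>

subsection \<open>Minimum cost supersets as minimum cuts\<close>

definition Lt :: "ex \<Rightarrow> ex \<Rightarrow> ex" where "Lt e f = Not (Le f e)"

lemma tt_Lt [simp]: "tt (Lt e f) s \<longleftrightarrow> ev e s < ev f s"
  by (auto simp: Lt_def)

text \<open>\<open>b + 1\<close> serves as infinite capacity, since only cuts of value at most
  \<open>b\<close> are of interest.\<close>

abbreviation (input) InfCap :: ex where "InfCap \<equiv> Plus (Var vb) (Num 1)"
abbreviation (input) NodeOf :: ex where "NodeOf \<equiv> Minus (Var vI1) (Var vN)"

text \<open>
  Vertex \<open>v\<close> is represented by the nodes \<open>v\<close> and \<open>n + v\<close>. In a cut, node \<open>v\<close> on the source side
  means that \<open>v\<close> belongs to the set, and node \<open>n + v\<close> that its in-neighbours are required to.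
\<close>

definition CAPACITY :: stm where
  "CAPACITY = Sq (Asg vCv (Num 0))
    (Cond (Eq (Var vI1) (Var vSrc)) (Cond (Lt (Var vI2) (Var vN)) (Cond (Arr aInq (Var vI2)) (Asg vCv InfCap) Nop) Nop)
    (Cond (Lt (Var vI1) (Var vN))
      (Cond (Eq (Var vI2) (Plus (Var vN) (Var vI1)))
        (Cond (Le (Arr aDg (Var vI1)) (Var vk)) (Asg vCv (Num 1)) Nop)
        (Cond (And (Eq (Var vI2) (Var vSnk)) (Eq (Arr aSt (Var vI1)) (Num 1))) (Asg vCv InfCap) Nop))
    (Cond (Lt (Var vI1) (Var vSrc))
      (Cond (Lt (Arr aDg NodeOf) (Var vk))
        (Cond (Eq (Var vI2) (Var vSnk)) (Asg vCv InfCap) Nop)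
        (Cond (Eq (Arr aDg NodeOf) (Var vk))
          (Cond (Lt (Var vI2) (Var vN)) (Cond (Adj (Var vI2) NodeOf) (Asg vCv InfCap) Nop) Nop) Nop)) Nop)))"

definition BUILD :: stm where
  "BUILD = For vI1 vW (For vI2 vW (Sq CAPACITY (Wr aCap (cell vI1 vI2) (Var vCv))))"

text \<open>The value \<open>vN\<close> means that no vertex was found; otherwise the scan keeps the
  last candidate.\<close>

definition FIND :: stm where
  "FIND = Sq (Asg vFu (Var vN)) (For vV vN
     (Cond (And (Arr aVis (Var vV)) (And (Not (Arr aSt (Var vV))) (Lt (Var vk) (Arr aDg (Var vV))))) (Asg vFu (Var vV)) Nop))"

text \<open>In \<open>aSt\<close>, 0 stands for undecided, 1 for excluded and 2 for resolved.
  \<open>aInq\<close>, filled by the exploration, goes on to hold the known members.\<close>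

definition QUERY :: stm where
  "QUERY = Cond (Lt (Var vFu) (Var vN)) (Sq POP (Cond (Var vBit)
     (Sq (Wr aSt (Var vFu) (Num 2)) (Sq (Wr aInq (Var vFu) (Num 1)) (For vR vN
       (Cond (Adj (Var vR) (Var vFu)) (Sq POP (Cond (Var vBit) (Wr aInq (Var vR) (Num 1)) Nop)) Nop))))
     (Wr aSt (Var vFu) (Num 1)))) Nop"

definition ROUND :: stm where
  "ROUND = Sq (Sq BUILD MINCUT) (Sq FIND QUERY)"

definition DEFICIT :: stm where
  "DEFICIT = For vV vN (Sq (Wr aA (Var vV) (Num 0)) (Cond (Arr aVis (Var vV))
     (Sq (DEG aVis vV) (Cond (Le (Var vk) (Var vC)) Nop (Wr aA (Var vV) (Num 1)))) Nop))"

definition LARGE1 :: stm where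
  "LARGE1 = Sq (Asg vX (Var vG)) (Sq EXPL (Sq (CLEAR aSt) (Sq (For vRd vN ROUND)
     (Sq (Sq BUILD MINCUT) (Sq DEFICIT VER)))))"

definition LARGE :: stm where
  "LARGE = For vS vN (For vG vNN LARGE1)"

lemma mv_large [simp]:
  "mv CAPACITY = {vCv}" "mv BUILD = {vI1, vI2, vCv}" "mv FIND = {vFu, vV}"
  "mv QUERY = {vHalf, vZ, vX, vBit, vR}"
  "mv ROUND = {vI1, vI2, vCv, vV, vTs, vRr, vCur, vPr, vAug, vFu, vHalf, vZ, vX, vBit, vR}"
  "mv DEFICIT = {vV, vC, vU}"
  by (simp_all add: CAPACITY_def BUILD_def FIND_def QUERY_def ROUND_def DEFICIT_def, auto)

lemma ma_large [simp]:
  "ma CAPACITY = {}" "ma BUILD = {aCap}" "ma FIND = {}" "ma QUERY = {aSt, aInq}"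
  "ma ROUND = {aCap, aVis, aPar, aSt, aInq}" "ma DEFICIT = {aA}"
  by (simp_all add: CAPACITY_def BUILD_def FIND_def QUERY_def ROUND_def DEFICIT_def, auto)

context core_instance
begin

definition capacity :: "nat set \<Rightarrow> nat set \<Rightarrow> nat \<Rightarrow> nat \<Rightarrow> nat" where
  "capacity K F x y =
    (if x = 2 * n then if y < n then if y \<in> K then b + 1 else 0 else 0
     else if x < n then
       if y = n + x then if all_in x \<le> k then 1 else 0
       else if y = 2 * n + 1 \<and> x \<in> F then b + 1 else 0
     else if x < 2 * n then
       if all_in (x - n) < k then if y = 2 * n + 1 then b + 1 else 0
       else if all_in (x - n) = k then if y < n then if E y (x - n) then b + 1 else 0 else 0 else 0
     else 0)"

abbreviation "cutn \<equiv> cut (2 * n + 2)"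

sublocale net: network "2 * n + 2" "2 * n" "2 * n + 1"
  by unfold_locales auto

text \<open>The following copies keep the simplifier from rewriting the parameters of the network.\<close>

definition ncut :: "nat set \<Rightarrow> bool" where "ncut = net.valid_cut"
definition nnenv :: "st \<Rightarrow> bool" where "nnenv = net.nenv"
definition ncap :: "st \<Rightarrow> nat \<Rightarrow> nat \<Rightarrow> nat" where "ncap = net.capf"

lemma ncut_iff: "ncut Z \<longleftrightarrow> Z \<subseteq> {..<2 * n + 2} \<and> 2 * n \<in> Z \<and> 2 * n + 1 \<notin> Z"
  by (simp only: ncut_def net.valid_cut_def)

lemma nnenv_iff: "nnenv s \<longleftrightarrow> fst s vW = 2 * n + 2 \<and> fst s vSrc = 2 * n \<and> fst s vSnk = 2 * n + 1"
  by (simp only: nnenv_def net.nenv_def)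

lemma ncap_eq: "ncap s x y = snd s aCap (x * (2 * n + 2) + y)"
  by (simp only: ncap_def net.capf_def)

lemmas sem_ncut = net.sem_MINCUT[folded ncut_def nnenv_def ncap_def]

text \<open>The cheapest cut that represents \<open>H\<close>: the node \<open>n + v\<close> joins
  the source side exactly when this cuts no infinite arc, so the unit arc into it is cut only for
  the vertices counted by \<open>cost\<close>.\<close>

definition side :: "nat set \<Rightarrow> nat set" where
  "side H = insert (2 * n) (H \<union> {n + v |v. v \<in> H \<and> all_in v \<le> k \<and> k \<le> indeg H v})"

lemma full_indeg:
  assumes "H \<subseteq> {..<n}" "all_in v \<le> indeg H v" "E u v"
  shows "u \<in> H"
proof -
  have "{u \<in> H. E u v} = {u \<in> {..<n}. E u v}"
    by (rule card_subset_eq) (use assms card_mono[of "{u \<in> {..<n}. E u v}" "{u \<in> H. E u v}"] in \<open>auto simp: indeg_def\<close>)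
  then show ?thesis using assms(3) E_less(1) by blast
qed

lemma valid_side: "H \<subseteq> {..<n} \<Longrightarrow> ncut (side H)"
  by (auto simp: ncut_iff side_def)

text \<open>Infinite arcs do not leave \<open>side H\<close>: if \<open>n + v\<close> belongs to it,
  then \<open>all_in v = k\<close> and all in-neighbours of \<open>v\<close> are in
  \<open>H\<close>. What remains is the unit arc of each vertex counted by
  \<open>cost\<close>.\<close>

lemma cut_side_le:
  assumes "feas K F H"
  shows "cutn (capacity K F) (side H) \<le> cost H"
proof -
  have H: "K \<subseteq> H" "H \<subseteq> {..<n}" "H \<inter> F = {}" using assms by (auto simp: feas_def)
  have fin: "finite (side H)" using valid_side[OF H(2)] finite_subset by (auto simp: ncut_iff)
  let ?P = "\<lambda>x. x \<in> H \<and> all_in x \<le> k \<and> indeg H x < k"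
  have "(\<Sum>y\<in>{..<2 * n + 2} - side H. capacity K F x y) \<le> of_bool (?P x)" if x: "x \<in> side H" for x
  proof -
    have le: "capacity K F x y \<le> (if y = n + x then of_bool (?P x) else 0)" if y: "y \<notin> side H" for y
    proof -
      from x consider "x = 2 * n" | "x \<in> H" "x < n" | v where "x = n + v" "v \<in> H" "v < n" "all_in v \<le> k" "k \<le> indeg H v"
        using H(2) by (auto simp: side_def)
      then show ?thesis
      proof cases
        case 1
        then show ?thesis using y H(1) by (auto simp: capacity_def side_def)
      next
        case 2
        then show ?thesis using y H(3) by (auto simp: capacity_def side_def)
      next
        case 3
        have "indeg H v \<le> all_in v" by (rule indeg_mono[OF H(2)])
        then have "all_in v = k" using 3 by simp
        moreover have "u \<in> H" if "E u v" for u using full_indeg[OF H(2) _ that] 3 by simp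
        ultimately show ?thesis using 3 y by (auto simp: capacity_def side_def)
      qed
    qed
    have "(\<Sum>y\<in>{..<2 * n + 2} - side H. capacity K F x y)
        \<le> (\<Sum>y\<in>{..<2 * n + 2} - side H. if y = n + x then of_bool (?P x) else 0)"
      by (rule sum_mono) (use le in auto)
    also have "\<dots> \<le> of_bool (?P x)" by simp
    finally show ?thesis .
  qed
  then have "cutn (capacity K F) (side H) \<le> (\<Sum>x\<in>side H. of_bool (?P x))" unfolding cut_def by (rule sum_mono)
  also have "\<dots> = card {x \<in> side H. ?P x}" using fin by (simp add: of_bool_def sum.If_cases Int_def)
  also have "{x \<in> side H. ?P x} = {x \<in> H. all_in x \<le> k \<and> indeg H x < k}" by (auto simp: side_def)
  finally show ?thesis by (simp add: cost_def)
qed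

text \<open>A cut of value at most \<open>b\<close> cuts no arc of capacity \<open>b + 1\<close>, so
  these arcs act as implications. If \<open>n + v\<close> lies in \<open>Z\<close>, they give
  \<open>v\<close> all of its exactly \<open>k\<close> in-neighbours; hence each vertex counted by
  \<open>cost\<close> has its unit arc cut.\<close>

lemma cost_le_cut:
  assumes "ncut Z" "cutn (capacity K F) Z \<le> b" "K \<subseteq> {..<n}" "F \<subseteq> {..<n}"
  shows "feas K F (Z \<inter> {..<n})" "cost (Z \<inter> {..<n}) \<le> cutn (capacity K F) Z"
proof -
  have Z: "Z \<subseteq> {..<2 * n + 2}" "2 * n \<in> Z" "2 * n + 1 \<notin> Z" using assms(1) by (auto simp: ncut_iff)
  have fin: "finite Z" using Z(1) finite_subset by blast
  let ?X = "Z \<inter> {..<n}"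
  have inf: "y \<in> Z" if "x \<in> Z" "y < 2 * n + 2" "capacity K F x y = b + 1" for x y
    using cut_ge_arc[OF Z(1), of x y "capacity K F"] that assms(2) by fastforce
  have "K \<subseteq> Z" using inf[OF Z(2)] assms(3) by (auto simp: capacity_def subset_iff)
  moreover have "x \<notin> F" if "x \<in> Z" "x < n" for x
    using inf[OF that(1), of "2 * n + 1"] that(2) Z(3) by (auto simp: capacity_def)
  ultimately show "feas K F ?X" using assms(3) by (auto simp: feas_def)
  let ?S = "{x \<in> ?X. all_in x \<le> k \<and> indeg ?X x < k}"
  have out: "n + v \<notin> Z" if v: "v \<in> ?S" for v
  proof
    assume nv: "n + v \<in> Z"
    have "all_in v = k"
      using inf[OF nv, of "2 * n + 1"] v Z(3) by (cases "all_in v < k") (auto simp: capacity_def)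
    moreover have "u \<in> Z" if "E u v" for u
      using inf[OF nv, of u] v E_less(1)[OF that] that \<open>all_in v = k\<close> by (auto simp: capacity_def)
    then have "{u \<in> ?X. E u v} = {u \<in> {..<n}. E u v}" by auto
    then have "indeg ?X v = all_in v" by (simp add: indeg_def)
    ultimately show False using v by simp
  qed
  have "cost ?X = (\<Sum>x\<in>?S. 1)" by (simp add: cost_def)
  also have "\<dots> \<le> (\<Sum>x\<in>?S. \<Sum>y\<in>{..<2 * n + 2} - Z. capacity K F x y)"
  proof (rule sum_mono)
    fix x assume x: "x \<in> ?S"
    have "capacity K F x (n + x) = 1" using x by (auto simp: capacity_def)
    moreover have "capacity K F x (n + x) \<le> (\<Sum>y\<in>{..<2 * n + 2} - Z. capacity K F x y)"
      by (rule member_le_sum) (use x out in auto)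
    ultimately show "1 \<le> (\<Sum>y\<in>{..<2 * n + 2} - Z. capacity K F x y)" by simp
  qed
  also have "\<dots> \<le> cutn (capacity K F) Z" unfolding cut_def by (rule sum_mono2[OF fin]) auto
  finally show "cost ?X \<le> cutn (capacity K F) Z" .
qed

definition wenv :: "nat \<Rightarrow> st \<Rightarrow> bool" where
  "wenv NN s \<longleftrightarrow> env s \<and> nnenv s \<and> fst s vPl = p \<and> fst s vBl = b \<and> fst s vNN = NN
     \<and> (\<forall>v<n. snd s aDg v = all_in v)"

text \<open>The numbers are those of \<open>vb\<close>, \<open>vk\<close>, \<open>vp\<close>,
  \<open>vBl\<close>, \<open>vPl\<close>, \<open>vNN\<close>, \<open>vW\<close>, \<open>vN\<close>,
  \<open>vSrc\<close> and \<open>vSnk\<close>.\<close>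

lemma wenv_cong:
  "\<lbrakk>\<And>y. y \<in> {2, 3, 4, 5, 6, 9, 10, 35, 38, 39} \<Longrightarrow> fst s' y = fst s y; snd s' 0 = snd s 0; snd s' aDg = snd s aDg\<rbrakk>
   \<Longrightarrow> wenv NN s' = wenv NN s"
  by (simp add: wenv_def env_def nnenv_iff)

definition srep :: "nat \<Rightarrow> nat set \<times> nat set \<times> nat set \<Rightarrow> nat \<Rightarrow> st \<Rightarrow> bool" where
  "srep NN = (\<lambda>(K, F, R) X s. wenv NN s \<and> fst s vX = X \<and> aset n (snd s aInq) = K
     \<and> {v. v < n \<and> snd s aSt v = 1} = F \<and> {v. v < n \<and> snd s aSt v = 2} = R \<and> (\<forall>v<n. snd s aSt v \<le> 2))"

lemma sem_CAPACITY:
  assumes "srep NN (K, F, R) X s" "fst s vI1 = x" "fst s vI2 = y"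
  shows "fst (sem CAPACITY s) vCv = capacity K F x y"
proof -
  have e: "fst s vN = n" "fst s vb = b" "fst s vk = k" "fst s vSrc = 2 * n" "fst s vSnk = 2 * n + 1"
    "\<And>v. v < n \<Longrightarrow> snd s aDg v = all_in v" "\<And>v. v < n \<Longrightarrow> v \<in> F \<longleftrightarrow> snd s aSt v = 1"
    "\<And>v. v < n \<Longrightarrow> v \<in> K \<longleftrightarrow> snd s aInq v \<noteq> 0" and env: "env s"
    using assms(1) by (auto simp: srep_def wenv_def env_def nnenv_iff aset_def)
  let ?s = "((fst s)(vCv := 0), snd s)"
  have a: "y < n \<Longrightarrow> x - n < n \<Longrightarrow> tt (Adj (Var vI2) NodeOf) ?s \<longleftrightarrow> E y (x - n)"
    using tt_Adj[of ?s "Var vI2" NodeOf] env assms(2,3) e(1) by simp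
  consider "x = 2 * n" | "x < n" | "n \<le> x" "x < 2 * n" | "2 * n < x" by linarith
  then show ?thesis
  proof cases
    case 1
    then show ?thesis using e assms(2,3) by (auto simp: CAPACITY_def capacity_def)
  next
    case 2
    then show ?thesis using e assms(2,3) by (auto simp: CAPACITY_def capacity_def)
  next
    case 3
    then have "x - n < n" "x \<noteq> 2 * n" "\<not> x < n" by auto
    then show ?thesis using 3 e assms(2,3) a by (simp add: CAPACITY_def capacity_def)
  next
    case 4
    then show ?thesis using e assms(2,3) by (auto simp: CAPACITY_def capacity_def)
  qed
qed

lemma sem_BUILD:
  assumes "srep NN (K, F, R) X s" "x < 2 * n + 2" "y < 2 * n + 2"
  shows "ncap (sem BUILD s) x y = capacity K F x y"
proof -
  let ?w = "2 * n + 2"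
  let ?P = "Sq CAPACITY (Wr aCap (cell vI1 vI2) (Var vCv))"
  have W: "fst s vW = ?w" using assms(1) by (simp add: srep_def wenv_def nnenv_iff)
  define J where "J i j s' \<longleftrightarrow> (\<forall>x<?w. \<forall>y<?w. x < i \<or> x = i \<and> y < j \<longrightarrow> ncap s' x y = capacity K F x y)" for i j and s' :: st
  have "J (fst s vW) 0 (sem BUILD s)" unfolding BUILD_def
  proof (rule sem_For_inv[where I = "\<lambda>i. J i 0"])
    show "J 0 0 s" by (simp add: J_def)
  next
    fix i s' assume i: "i < fst s vW" "J i 0 s'" "\<And>y. y \<noteq> vI1 \<Longrightarrow> y \<notin> mv (For vI2 vW ?P) \<Longrightarrow> fst s' y = fst s y"
      "\<And>a. a \<notin> ma (For vI2 vW ?P) \<Longrightarrow> snd s' a = snd s a"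
    define s1 where "s1 = ((fst s')(vI1 := i), snd s')"
    have W1: "fst s1 vW = ?w" using i(3) W by (simp add: s1_def)
    have "J i (fst s1 vW) (sem (For vI2 vW ?P) s1)"
    proof (rule sem_For_inv[where I = "J i"])
      show "J i 0 s1" using i(2) by (simp add: J_def s1_def ncap_eq)
    next
      fix j s2 assume j: "j < fst s1 vW" "J i j s2" "\<And>y. y \<noteq> vI2 \<Longrightarrow> y \<notin> mv ?P \<Longrightarrow> fst s2 y = fst s1 y"
        "\<And>a. a \<notin> ma ?P \<Longrightarrow> snd s2 a = snd s1 a"
      let ?s = "((fst s2)(vI2 := j), snd s2)"
      have "wenv NN ?s = wenv NN s"
        by (rule wenv_cong) (use i(3,4) j(3,4) in \<open>auto simp: s1_def\<close>)
      then have rep: "srep NN (K, F, R) X ?s"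
        using assms(1) i(3,4) j(3,4) by (simp add: srep_def s1_def)
      have "fst ?s vI1 = i" using j(3) by (simp add: s1_def)
      then have cv: "fst (sem CAPACITY ?s) vCv = capacity K F i j" using sem_CAPACITY[OF rep] by simp
      have ij: "i < ?w" "j < ?w" using i(1) j(1) W W1 by auto
      have "ncap (sem ?P ?s) x y = (if x = i \<and> y = j then capacity K F i j else ncap s2 x y)"
        if "x < ?w" "y < ?w" for x y
        using cv \<open>fst ?s vI1 = i\<close> rep that ij cell_eq_iff[OF that(2) ij(2), of x i]
        by (simp add: ncap_eq cell_def srep_def wenv_def nnenv_iff)
      then show "J i (Suc j) (sem ?P ?s)" using j(2) by (auto simp: J_def less_Suc_eq)
    qed
    then show "J (Suc i) 0 (sem (For vI2 vW ?P) ((fst s')(vI1 := i), snd s'))"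
      unfolding s1_def[symmetric] W1 J_def by (auto simp: less_Suc_eq)
  qed
  then show ?thesis using assms(2,3) W by (simp add: J_def)
qed

text \<open>Passing from sets to cuts and back never increases the value, so optimality transfers.
  If \<open>H'\<close> is optimal, then \<open>side H'\<close> is a minimum cut and contains the
  least one.\<close>

lemma sem_opt:
  assumes "srep NN (K, F, R) X s" "feas K F H" "cost H \<le> b"
  shows "least_opt K F (aset n (snd (sem (Sq BUILD MINCUT) s) aVis))"
proof -
  define s1 where "s1 = sem BUILD s"
  define V where "V = aset (2 * n + 2) (snd (sem MINCUT s1) aVis)"
  have eq: "aset n (snd (sem (Sq BUILD MINCUT) s) aVis) = V \<inter> {..<n}"
    by (auto simp: V_def s1_def aset_def)
  have KF: "K \<subseteq> {..<n}" "F \<subseteq> {..<n}" using assms(1) by (auto simp: srep_def aset_def)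
  have cut: "cutn (ncap s1) Z = cutn (capacity K F) Z" if "ncut Z" for Z
    by (rule cut_cong) (use sem_BUILD[OF assms(1)] that in \<open>auto simp: s1_def ncut_iff\<close>)
  have ne: "nnenv s1" "fst s1 vBl = b" using assms(1) by (simp_all add: s1_def srep_def wenv_def nnenv_iff)
  have H: "H \<subseteq> {..<n}" using assms(2) by (simp add: feas_def)
  have vH: "ncut (side H)" by (rule valid_side[OF H])
  have "cutn (ncap s1) (side H) \<le> fst s1 vBl"
    using cut_side_le[OF assms(2)] assms(3) ne(2) cut[OF vH] by simp
  note mc = sem_ncut[OF ne(1) vH this, folded V_def]
  have Vb: "cutn (capacity K F) V \<le> b"
    using mc(2)[OF vH] cut[OF vH] cut[OF mc(1)] cut_side_le[OF assms(2)] assms(3) by simp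
  note cV = cost_le_cut[OF mc(1) Vb KF]
  have le: "cutn (capacity K F) V \<le> cutn (capacity K F) (side H')" "cutn (capacity K F) (side H') \<le> cost H'"
    if "feas K F H'" for H'
  proof -
    have "ncut (side H')" using that valid_side by (simp add: feas_def)
    then show "cutn (capacity K F) V \<le> cutn (capacity K F) (side H')" using mc(2) cut mc(1) by simp
    show "cutn (capacity K F) (side H') \<le> cost H'" by (rule cut_side_le[OF that])
  qed
  have "cost (V \<inter> {..<n}) \<le> cost H'" if "feas K F H'" for H' using cV(2) le[OF that] by linarith
  moreover have "V \<inter> {..<n} \<subseteq> H'" if f: "feas K F H'" and c: "cost H' = cost (V \<inter> {..<n})" for H'
  proof -
    have H': "H' \<subseteq> {..<n}" using f by (simp add: feas_def)
    have "cutn (capacity K F) (side H') = cutn (capacity K F) V" using cV(2) le[OF f] c by linarith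
    then have "V \<subseteq> side H'" using mc(3) valid_side[OF H'] cut mc(1) by simp
    then show ?thesis by (auto simp: side_def)
  qed
  ultimately show ?thesis using cV(1) unfolding eq least_opt_def by blast
qed


section \<open>Codes for the adaptive queries and the number of bits they take\<close>

subsection \<open>The search for large components\<close>

lemma srep_cong:
  assumes "srep NN \<sigma> X s" "fst s' vX = X'"
    "\<And>y. y \<in> {2, 3, 4, 5, 6, 9, 10, 35, 38, 39} \<Longrightarrow> fst s' y = fst s y"
    "\<And>a. a \<in> {0, aDg, aInq, aSt} \<Longrightarrow> snd s' a = snd s a"
  shows "srep NN \<sigma> X' s'"
proof -
  have "wenv NN s' = wenv NN s" by (rule wenv_cong) (use assms(3,4) in auto)
  moreover have "snd s' aInq = snd s aInq" "snd s' aSt = snd s aSt" using assms(4) by auto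
  ultimately show ?thesis using assms(1,2) by (cases \<sigma>) (simp add: srep_def)
qed

lemma srepD:
  assumes "srep NN \<sigma> X s"
  shows "env s" "fst s vX = X" "fst s vNN = NN" "fst s vN = n"
  using assms by (cases \<sigma>, auto simp: srep_def wenv_def env_def)+

lemma srep_unresolved:
  assumes "srep NN \<sigma> X s" "v < n"
  shows "unresolved \<sigma> v \<longleftrightarrow> snd s aSt v = 0 \<and> k < snd s aDg v"
proof -
  obtain K F R where \<sigma>: "\<sigma> = (K, F, R)" by (cases \<sigma>)
  have "snd s aSt v \<le> 2" "v \<in> F \<longleftrightarrow> snd s aSt v = 1" "v \<in> R \<longleftrightarrow> snd s aSt v = 2" "snd s aDg v = all_in v"
    using assms by (auto simp: srep_def wenv_def \<sigma>)
  then show ?thesis by (auto simp: unresolved_def \<sigma>)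
qed

lemma least_opt_unique: "least_opt K F X \<Longrightarrow> least_opt K F Y \<Longrightarrow> X = Y"
  unfolding least_opt_def by (metis le_antisym subset_antisym)

text \<open>With the empty set as default, a nonempty \<open>opt\<close> certifies that a least
  optimum exists.\<close>

definition opt :: "nat set \<times> nat set \<times> nat set \<Rightarrow> nat set" where
  "opt = (\<lambda>(K, F, R). if \<exists>X. least_opt K F X then THE X. least_opt K F X else {})"

lemma opt_eq:
  assumes "least_opt K F X"
  shows "opt (K, F, R) = X"
proof -
  have "(THE X. least_opt K F X) = X"
    by (rule the_equality[where P = "least_opt K F", OF assms]) (rule least_opt_unique[OF _ assms])
  then show ?thesis using assms by (auto simp: opt_def)
qed

definition cand :: "nat set \<times> nat set \<times> nat set \<Rightarrow> nat set" where
  "cand \<sigma> = {u \<in> opt \<sigma>. unresolved \<sigma> u}"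

text \<open>\<open>Max\<close> agrees with \<open>FIND\<close>, which returns the last candidate of
  its scan.\<close>

definition nxt :: "nat set \<Rightarrow> nat set \<times> nat set \<times> nat set \<Rightarrow> nat set \<times> nat set \<times> nat set" where
  "nxt H \<sigma> = (if cand \<sigma> = {} then \<sigma> else advance H (Max (cand \<sigma>)) \<sigma>)"

lemma opt_subset: "opt \<sigma> \<subseteq> {..<n}"
proof -
  obtain K F R where \<sigma>: "\<sigma> = (K, F, R)" by (cases \<sigma>)
  show ?thesis
  proof (cases "\<exists>X. least_opt K F X")
    case True
    then obtain X where X: "least_opt K F X" by blast
    show ?thesis using X unfolding \<sigma> opt_eq[OF X] by (simp add: least_opt_def feas_def)
  next
    case False
    then have "opt \<sigma> = {}" unfolding opt_def \<sigma> prod.case by (rule if_not_P)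
    then show ?thesis by simp
  qed
qed

lemma cand_subset: "cand \<sigma> \<subseteq> {v. v < n \<and> unresolved \<sigma> v}"
  using opt_subset[of \<sigma>] by (auto simp: cand_def)

lemma finite_cand: "finite (cand \<sigma>)"
  by (rule finite_subset[OF cand_subset]) simp

lemma sem_FIND:
  assumes "srep NN \<sigma> X s" "aset n (snd s aVis) = opt \<sigma>"
  shows "fst (sem FIND s) vFu = (if cand \<sigma> = {} then n else Max (cand \<sigma>))"
proof -
  let ?P = "Cond (And (Arr aVis (Var vV)) (And (Not (Arr aSt (Var vV))) (Lt (Var vk) (Arr aDg (Var vV))))) (Asg vFu (Var vV)) Nop"
  define s0 where "s0 = ((fst s)(vFu := fst s vN), snd s)"
  define S where "S i = {u \<in> cand \<sigma>. u < i}" for i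
  define I where "I i s' \<longleftrightarrow> fst s' vFu = (if S i = {} then n else Max (S i))" for i and s' :: st
  have N: "fst s0 vN = n" using srepD(4)[OF assms(1)] by (simp add: s0_def)
  have "I (fst s0 vN) (sem (For vV vN ?P) s0)"
  proof (rule sem_For_inv)
    show "I 0 s0" using srepD(4)[OF assms(1)] by (simp add: I_def S_def s0_def)
  next
    fix i s' assume i: "i < fst s0 vN" "I i s'" "\<And>y. y \<noteq> vV \<Longrightarrow> y \<notin> mv ?P \<Longrightarrow> fst s' y = fst s0 y"
      "\<And>a. a \<notin> ma ?P \<Longrightarrow> snd s' a = snd s0 a"
    have iN: "i < n" using i(1) N by simp
    have k: "fst s' vk = k" using i(3) assms(1) envD(3)[OF srepD(1)[OF assms(1)]] by (simp add: s0_def)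
    have arr: "snd s' a = snd s a" for a using i(4) by (simp add: s0_def)
    have c: "i \<in> cand \<sigma> \<longleftrightarrow> snd s aVis i \<noteq> 0 \<and> snd s aSt i = 0 \<and> k < snd s aDg i"
      using srep_unresolved[OF assms(1) iN] assms(2) iN by (auto simp: cand_def aset_def)
    have S: "S (Suc i) = (if i \<in> cand \<sigma> then insert i (S i) else S i)" by (auto simp: S_def less_Suc_eq)
    have "Max (insert i (S i)) = i"
      by (rule Max_eqI) (use finite_cand in \<open>auto simp: S_def\<close>)
    then show "I (Suc i) (sem ?P ((fst s')(vV := i), snd s'))"
      using i(2) k arr c S by (auto simp: I_def)
  qed
  moreover have "S n = cand \<sigma>" using cand_subset[of \<sigma>] by (auto simp: S_def)
  ultimately show ?thesis by (simp add: FIND_def s0_def[symmetric] N I_def)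
qed

text \<open>The number whose lowest digits answer the questions about the in-neighbours of
  \<open>u\<close>, and from which \<open>X'\<close> remains afterwards.\<close>

definition qcode :: "nat set \<Rightarrow> nat \<Rightarrow> nat \<Rightarrow> nat list \<Rightarrow> nat" where
  "qcode H u X' rs = foldr (\<lambda>r Y. if E r u then 2 * Y + of_bool (r \<in> H) else Y) rs X'"

lemma qcode_le: "Suc (qcode H u X' rs) \<le> Suc X' * 2 ^ length (filter (\<lambda>r. E r u) rs)"
proof (induction rs)
  case (Cons r rs)
  have "Suc (qcode H u X' (r # rs)) \<le> 2 * Suc (qcode H u X' rs)" if "E r u" using that by (simp add: qcode_def of_bool_def)
  then show ?case using Cons by (cases "E r u") (auto simp: qcode_def intro: order_trans)
qed (simp add: qcode_def)

lemma sem_query_loop: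
  assumes "srep NN (K, F, R) (qcode H u X' [0..<n]) s" "fst s vFu = u" "u < n" "qcode H u X' [0..<n] < NN"
  shows "srep NN (K \<union> {r \<in> H. E r u}, F, R) X' (sem (For vR vN
       (Cond (Adj (Var vR) (Var vFu)) (Sq POP (Cond (Var vBit) (Wr aInq (Var vR) (Num 1)) Nop)) Nop)) s)"
proof -
  let ?P = "Cond (Adj (Var vR) (Var vFu)) (Sq POP (Cond (Var vBit) (Wr aInq (Var vR) (Num 1)) Nop)) Nop"
  define I where "I i s' \<longleftrightarrow> srep NN (K \<union> {r \<in> H. E r u \<and> r < i}, F, R) (qcode H u X' [i..<n]) s' \<and> qcode H u X' [i..<n] < NN"
    for i and s' :: st
  have N: "fst s vN = n" using srepD(4)[OF assms(1)] .
  have "I (fst s vN) (sem (For vR vN ?P) s)"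
  proof (rule sem_For_inv)
    show "I 0 s" using assms(1,4) by (simp add: I_def)
  next
    fix i s' assume i: "i < fst s vN" "I i s'" "\<And>y. y \<noteq> vR \<Longrightarrow> y \<notin> mv ?P \<Longrightarrow> fst s' y = fst s y"
    have iN: "i < n" using i(1) N by simp
    then have up: "[i..<n] = i # [Suc i..<n]" by (simp add: upt_conv_Cons)
    define Y where "Y = qcode H u X' [Suc i..<n]"
    have code: "qcode H u X' [i..<n] = (if E i u then 2 * Y + of_bool (i \<in> H) else Y)" by (simp add: up qcode_def Y_def)
    let ?s = "((fst s')(vR := i), snd s')" and ?K = "K \<union> {r \<in> H. E r u \<and> r < i}"
    have rep: "srep NN (?K, F, R) (qcode H u X' [i..<n]) ?s"
      by (rule srep_cong[of NN _ "qcode H u X' [i..<n]" s']) (use i(2) srepD(2)[of NN _ _ s'] in \<open>auto simp: I_def\<close>)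
    have fu: "fst ?s vFu = u" using i(3) assms(2) by simp
    have adj: "tt (Adj (Var vR) (Var vFu)) ?s \<longleftrightarrow> E i u"
      using tt_Adj[OF srepD(1)[OF rep], of "Var vR" "Var vFu"] iN fu assms(3) by simp
    show "I (Suc i) (sem ?P ?s)"
    proof (cases "E i u")
      case False
      then have "{r \<in> H. E r u \<and> r < Suc i} = {r \<in> H. E r u \<and> r < i}" by (auto simp: less_Suc_eq)
      moreover have "sem ?P ?s = ?s" using adj False by simp
      ultimately show ?thesis using rep i(2) False code by (simp add: I_def Y_def)
    next
      case True
      have lt: "fst ?s vX < fst ?s vNN" using srepD(2,3)[OF rep] i(2) by (simp add: I_def)
      have pop: "fst (sem POP ?s) vBit = of_bool (i \<in> H)" "fst (sem POP ?s) vX = Y"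
        using sem_POP[OF lt] srepD(2)[OF rep] code True by auto
      have rep1: "srep NN (?K, F, R) Y (sem POP ?s)"
        by (rule srep_cong[OF rep pop(2)]) auto
      have S: "{r \<in> H. E r u \<and> r < Suc i} = (if i \<in> H then insert i {r \<in> H. E r u \<and> r < i} else {r \<in> H. E r u \<and> r < i})"
        using True by (auto simp: less_Suc_eq)
      have sem: "sem ?P ?s = (if i \<in> H then (fst (sem POP ?s), (snd (sem POP ?s))(aInq := (snd (sem POP ?s) aInq)(i := 1)))
          else sem POP ?s)" using adj True pop(1) by simp
      have "wenv NN (fst (sem POP ?s), (snd (sem POP ?s))(aInq := (snd (sem POP ?s) aInq)(i := 1))) = wenv NN (sem POP ?s)"
        by (rule wenv_cong) auto
      then have "srep NN (K \<union> {r \<in> H. E r u \<and> r < Suc i}, F, R) Y (sem ?P ?s)"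
        unfolding sem S using rep1 iN by (auto simp: srep_def aset_upd)
      moreover have "Y < NN" using i(2) code True by (simp add: I_def)
      ultimately show ?thesis by (simp add: I_def Y_def)
    qed
  qed
  moreover have "{r \<in> H. E r u \<and> r < n} = {r \<in> H. E r u}" using E_less(1) by auto
  ultimately show ?thesis by (simp add: I_def N qcode_def)
qed

lemma sem_QUERY_yes:
  assumes "srep NN (K, F, R) (2 * qcode H u X' [0..<n] + 1) s" "fst s vFu = u" "u < n" "u \<in> H"
    "u \<notin> F" "2 * qcode H u X' [0..<n] + 1 < NN"
  shows "srep NN (advance H u (K, F, R)) X' (sem QUERY s)"
proof -
  let ?q = "qcode H u X' [0..<n]"
  let ?L = "For vR vN (Cond (Adj (Var vR) (Var vFu)) (Sq POP (Cond (Var vBit) (Wr aInq (Var vR) (Num 1)) Nop)) Nop)"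
  have lt: "fst s vX < fst s vNN" using srepD(2,3)[OF assms(1)] assms(6) by simp
  have pop: "fst (sem POP s) vBit = 1" "fst (sem POP s) vX = ?q" using sem_POP[OF lt] srepD(2)[OF assms(1)] by auto
  have rep: "srep NN (K, F, R) ?q (sem POP s)" by (rule srep_cong[OF assms(1) pop(2)]) auto
  define s2 where "s2 = sem (Sq (Wr aSt (Var vFu) (Num 2)) (Wr aInq (Var vFu) (Num 1))) (sem POP s)"
  have fu: "fst (sem POP s) vFu = u" using assms(2) by simp
  have "wenv NN s2 = wenv NN (sem POP s)" unfolding s2_def by (rule wenv_cong) auto
  moreover have "snd (sem POP s) aSt u \<noteq> 1" using rep assms(3,5) by (auto simp: srep_def)
  ultimately have "srep NN (insert u K, F, insert u R) ?q s2"
    using rep assms(3,5) fu by (auto simp: srep_def s2_def aset_upd)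
  then have "srep NN (insert u K \<union> {r \<in> H. E r u}, F, insert u R) X' (sem ?L s2)"
    by (rule sem_query_loop) (use assms fu in \<open>auto simp: s2_def\<close>)
  moreover have "sem QUERY s = sem ?L s2"
    using assms(2,3) srepD(4)[OF assms(1)] pop(1) by (simp add: QUERY_def s2_def)
  ultimately show ?thesis using assms(4) by (simp add: advance_def)
qed

lemma sem_QUERY_no:
  assumes "srep NN (K, F, R) (2 * X') s" "fst s vFu = u" "u < n" "u \<notin> H" "u \<notin> R" "2 * X' < NN"
  shows "srep NN (advance H u (K, F, R)) X' (sem QUERY s)"
proof -
  have lt: "fst s vX < fst s vNN" using srepD(2,3)[OF assms(1)] assms(6) by simp
  have pop: "fst (sem POP s) vBit = 0" "fst (sem POP s) vX = X'" using sem_POP[OF lt] srepD(2)[OF assms(1)] by auto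
  have rep: "srep NN (K, F, R) X' (sem POP s)" by (rule srep_cong[OF assms(1) pop(2)]) auto
  define s2 where "s2 = sem (Wr aSt (Var vFu) (Num 1)) (sem POP s)"
  have fu: "fst (sem POP s) vFu = u" using assms(2) by simp
  have "wenv NN s2 = wenv NN (sem POP s)" unfolding s2_def by (rule wenv_cong) auto
  moreover have "snd (sem POP s) aSt u \<noteq> 2" using rep assms(3,5) by (auto simp: srep_def)
  ultimately have "srep NN (K, insert u F, R) X' s2"
    using rep assms(3,5) fu by (auto simp: srep_def s2_def)
  moreover have "sem QUERY s = s2"
    using assms(2,3) srepD(4)[OF assms(1)] pop(1) by (simp add: QUERY_def s2_def)
  ultimately show ?thesis using assms(4) by (simp add: advance_def)
qed

text \<open>The bits of a round are charged to the drop of \<open>pot\<close>, so that over all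
  rounds they telescope. As in the exploration, the code is obtained from the number
  \<open>X'\<close> to be left over.\<close>

lemma sem_ROUND:
  assumes "sol A H" "card A \<le> b" "good H \<sigma>"
  shows "\<exists>X. Suc X \<le> Suc X' * 2 ^ (pot b H \<sigma> - pot b H (nxt H \<sigma>))
    \<and> (\<forall>s. srep NN \<sigma> X s \<longrightarrow> X < NN \<longrightarrow> srep NN (nxt H \<sigma>) X' (sem ROUND s))"
proof -
  obtain K F R where \<sigma>: "\<sigma> = (K, F, R)" by (cases \<sigma>)
  have feas: "feas K F H" using good_feas[OF assms(1)] assms(3) by (simp add: \<sigma>)
  have "finite A" using assms(1) finite_subset_V[of H] finite_subset[of A H] by (auto simp: sol_def)
  then have cost: "cost H \<le> b"
    using cost_le_anchors[OF assms(1)] card_mono[of A "{w \<in> A. all_in w \<le> k}"] assms(2) by auto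
  have vis: "least_opt K F (aset n (snd (sem (Sq BUILD MINCUT) s) aVis))" if "srep NN \<sigma> X s" for X s
    using sem_opt[OF that[unfolded \<sigma>] feas cost] .
  have find: "fst (sem FIND (sem (Sq BUILD MINCUT) s)) vFu = (if cand \<sigma> = {} then n else Max (cand \<sigma>))"
    "srep NN \<sigma> X (sem FIND (sem (Sq BUILD MINCUT) s))" if s: "srep NN \<sigma> X s" for X s
  proof -
    have rep: "srep NN \<sigma> X (sem (Sq BUILD MINCUT) s)"
      by (rule srep_cong[OF s]) (use srepD(2)[OF s] in auto)
    show "fst (sem FIND (sem (Sq BUILD MINCUT) s)) vFu = (if cand \<sigma> = {} then n else Max (cand \<sigma>))"
      by (rule sem_FIND[OF rep]) (use opt_eq[OF vis[OF s]] in \<open>simp add: \<sigma>\<close>)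
    show "srep NN \<sigma> X (sem FIND (sem (Sq BUILD MINCUT) s))"
      by (rule srep_cong[OF rep]) (use srepD(2)[OF rep] in auto)
  qed
  have round: "sem ROUND s = sem QUERY (sem FIND (sem (Sq BUILD MINCUT) s))" for s by (simp add: ROUND_def)
  show ?thesis
  proof (cases "cand \<sigma> = {}")
    case True
    have "srep NN \<sigma> X' (sem ROUND s)" if s: "srep NN \<sigma> X' s" for s
    proof -
      have "sem ROUND s = sem FIND (sem (Sq BUILD MINCUT) s)"
        unfolding round using find(1)[OF s] srepD(4)[OF find(2)[OF s]] True by (simp add: QUERY_def)
      then show ?thesis using find(2)[OF s] by simp
    qed
    then show ?thesis using True by (intro exI[of _ X']) (simp add: nxt_def)
  next
    case False
    define u where "u = Max (cand \<sigma>)"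
    have u: "u \<in> cand \<sigma>" unfolding u_def by (rule Max_in[OF finite_cand False])
    then have u': "u \<in> opt \<sigma>" "unresolved \<sigma> u" "u < n" using cand_subset[of \<sigma>] by (auto simp: cand_def)
    then have "opt \<sigma> \<noteq> {}" by auto
    then obtain L where L: "least_opt K F L" by (auto simp: opt_def \<sigma> split: if_splits)
    have nx: "nxt H \<sigma> = advance H u \<sigma>" using False by (simp add: nxt_def u_def)
    have pot: "pot b H (nxt H \<sigma>) + (if u \<in> H then D else 1) \<le> pot b H \<sigma>"
      unfolding nx unfolding \<sigma>
      by (rule pot_advance[OF assms(1,2) assms(3)[unfolded \<sigma>] L]) (use u' opt_eq[OF L, of R] in \<open>simp_all add: \<sigma>\<close>)
    have FR: "u \<notin> F" "u \<notin> R" using u'(2) by (auto simp: \<sigma> unresolved_def)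
    define X where "X = (if u \<in> H then 2 * qcode H u X' [0..<n] + 1 else 2 * X')"
    have "Suc X \<le> Suc X' * 2 ^ (if u \<in> H then D else 1)"
    proof (cases "u \<in> H")
      case True
      let ?l = "length (filter (\<lambda>r. E r u) [0..<n])"
      have "?l = card (set (filter (\<lambda>r. E r u) [0..<n]))" by (rule distinct_card[symmetric]) simp
      also have "\<dots> \<le> card {r. E r u}" by (rule card_mono) auto
      \<comment> \<open>One bit for \<open>u\<close> and one for each in-neighbour: in-degree plus
        out-degree is less than \<open>D\<close>.\<close>
      finally have l: "Suc ?l \<le> D" using degree_less[OF u'(3)] by simp
      have "Suc X \<le> 2 * Suc (qcode H u X' [0..<n])" using True by (simp add: X_def)
      also have "\<dots> \<le> 2 * (Suc X' * 2 ^ ?l)" by (rule mult_le_mono2[OF qcode_le])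
      also have "\<dots> = Suc X' * 2 ^ Suc ?l" by (simp only: power_Suc ac_simps)
      also have "\<dots> \<le> Suc X' * 2 ^ D" by (intro mult_le_mono2 power_increasing l) simp
      finally show ?thesis using True by simp
    qed (simp add: X_def)
    also have "\<dots> \<le> Suc X' * 2 ^ (pot b H \<sigma> - pot b H (nxt H \<sigma>))"
      by (intro mult_le_mono2 power_increasing) (use pot in auto)
    finally have bnd: "Suc X \<le> Suc X' * 2 ^ (pot b H \<sigma> - pot b H (nxt H \<sigma>))" .
    have "srep NN (nxt H \<sigma>) X' (sem ROUND s)" if s: "srep NN \<sigma> X s" "X < NN" for s
    proof -
      note f = find[OF s(1)]
      have fu: "fst (sem FIND (sem (Sq BUILD MINCUT) s)) vFu = u" using f(1) False by (simp add: u_def)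
      show ?thesis
      proof (cases "u \<in> H")
        case True
        then show ?thesis unfolding round nx using f(2) s(2) FR fu u'(3) unfolding \<sigma>
          by (intro sem_QUERY_yes) (simp_all add: X_def)
      next
        case False
        then show ?thesis unfolding round nx using f(2) s(2) FR fu u'(3) unfolding \<sigma>
          by (intro sem_QUERY_no) (simp_all add: X_def)
      qed
    qed
    with bnd show ?thesis by blast
  qed
qed

text \<open>The value after the last round is prescribed, and earlier ones are chosen from later
  ones.\<close>

lemma backward_choice:
  fixes m :: nat
  assumes "\<And>i y. i < m \<Longrightarrow> \<exists>x. P i x y"
  shows "\<exists>f. f m = y \<and> (\<forall>i<m. P i (f i) (f (Suc i)))"
  using assms
proof (induction m arbitrary: y)
  case (Suc m)
  obtain x where x: "P m x y" using Suc.prems by blast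
  obtain f where f: "f m = x" "\<forall>i<m. P i (f i) (f (Suc i))" using Suc.IH[of x] Suc.prems by auto
  show ?case by (rule exI[of _ "f(Suc m := y)"]) (use f x in \<open>auto simp: less_Suc_eq\<close>)
qed auto

lemma good_nxt: "good H \<sigma> \<Longrightarrow> good H (nxt H \<sigma>)"
  by (simp add: nxt_def good_advance)

lemma pot_nxt_le:
  assumes "sol A H" "card A \<le> b" "good H \<sigma>"
  shows "pot b H (nxt H \<sigma>) \<le> pot b H \<sigma>"
proof (cases "cand \<sigma> = {}")
  case False
  obtain K F R where \<sigma>: "\<sigma> = (K, F, R)" by (cases \<sigma>)
  have u: "Max (cand \<sigma>) \<in> opt \<sigma>" "unresolved \<sigma> (Max (cand \<sigma>))" using Max_in[OF finite_cand False] by (auto simp: cand_def)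
  then have "opt \<sigma> \<noteq> {}" by auto
  then obtain L where L: "least_opt K F L" by (auto simp: opt_def \<sigma> split: if_splits)
  show ?thesis
    using pot_advance[OF assms(1,2) assms(3)[unfolded \<sigma>] L, of "Max (cand \<sigma>)"] u opt_eq[OF L, of R] False
    by (simp add: \<sigma> nxt_def)
qed (simp add: nxt_def)

text \<open>Every round with a candidate resolves or excludes one vertex for good, so after
  \<open>n\<close> rounds none is left.\<close>

lemma cand_exhausted: "cand ((nxt H ^^ n) \<sigma>) = {}"
proof -
  let ?U = "\<lambda>\<sigma>. {v. v < n \<and> unresolved \<sigma> v}"
  have "cand ((nxt H ^^ i) \<sigma>) = {} \<or> card (?U ((nxt H ^^ i) \<sigma>)) \<le> n - i" for i
  proof (induction i)
    case 0
    show ?case using card_mono[of "{..<n}" "?U \<sigma>"] by auto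
  next
    case (Suc i)
    define \<tau> where "\<tau> = (nxt H ^^ i) \<sigma>"
    have S: "(nxt H ^^ Suc i) \<sigma> = nxt H \<tau>" by (simp add: \<tau>_def)
    show ?case
    proof (cases "cand \<tau> = {}")
      case True
      then show ?thesis unfolding S by (simp add: nxt_def)
    next
      case False
      then have u: "Max (cand \<tau>) \<in> ?U \<tau>" using Max_in[OF finite_cand False] cand_subset by blast
      have "?U (nxt H \<tau>) \<subseteq> ?U \<tau> - {Max (cand \<tau>)}"
        using False by (cases \<tau>) (auto simp: nxt_def advance_def unresolved_def split: if_splits)
      then have "card (?U (nxt H \<tau>)) \<le> card (?U \<tau> - {Max (cand \<tau>)})" by (intro card_mono) auto
      also have "\<dots> < card (?U \<tau>)" using u by (intro psubset_card_mono) auto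
      finally show ?thesis using Suc False unfolding S by (auto simp: \<tau>_def)
    qed
  qed
  from this[of n] show ?thesis
  proof
    assume "card (?U ((nxt H ^^ n) \<sigma>)) \<le> n - n"
    then show ?thesis using cand_subset[of "(nxt H ^^ n) \<sigma>"] by auto
  qed
qed

lemma sem_DEFICIT:
  assumes "env s"
  defines "V \<equiv> aset n (snd s aVis)"
  shows "aset n (snd (sem DEFICIT s) aA) = {v \<in> V. indeg V v < k}"
proof -
  let ?P = "Sq (Wr aA (Var vV) (Num 0)) (Cond (Arr aVis (Var vV))
     (Sq (DEG aVis vV) (Cond (Le (Var vk) (Var vC)) Nop (Wr aA (Var vV) (Num 1)))) Nop)"
  define I where "I i s' \<longleftrightarrow> (\<forall>v<i. snd s' aA v \<noteq> 0 \<longleftrightarrow> v \<in> V \<and> indeg V v < k)" for i and s' :: st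
  have N: "fst s vN = n" using envD(1)[OF assms(1)] .
  have "I (fst s vN) (sem (For vV vN ?P) s)"
  proof (rule sem_For_inv)
    show "I 0 s" by (simp add: I_def)
  next
    fix i s' assume i: "i < fst s vN" "I i s'" "\<And>y. y \<noteq> vV \<Longrightarrow> y \<notin> mv ?P \<Longrightarrow> fst s' y = fst s y"
      "\<And>a. a \<notin> ma ?P \<Longrightarrow> snd s' a = snd s a"
    have iN: "i < n" using i(1) N by simp
    define s1 where "s1 = sem (Wr aA (Var vV) (Num 0)) ((fst s')(vV := i), snd s')"
    have e: "env s1" by (subst env_cong[of s1 s]) (use i(3,4) assms(1) in \<open>auto simp: s1_def\<close>)
    have vis: "snd s1 aVis = snd s aVis" "fst s1 vV = i" "fst s1 vk = k"
      using i(3,4) envD(3)[OF assms(1)] by (auto simp: s1_def)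
    have deg: "fst (sem (DEG aVis vV) s1) vC = indeg V i"
      using sem_DEG[OF e, of vV aVis] iN vis by (simp add: V_def)
    have iV: "i \<in> V \<longleftrightarrow> snd s aVis i \<noteq> 0" using iN by (simp add: V_def aset_def)
    have "sem ?P ((fst s')(vV := i), snd s') = sem (Cond (Arr aVis (Var vV))
     (Sq (DEG aVis vV) (Cond (Le (Var vk) (Var vC)) Nop (Wr aA (Var vV) (Num 1)))) Nop) s1" by (simp add: s1_def)
    moreover have "snd s1 aA = (snd s' aA)(i := 0)" by (simp add: s1_def)
    ultimately show "I (Suc i) (sem ?P ((fst s')(vV := i), snd s'))"
      using i(2) deg vis iV by (simp add: I_def All_less_Suc snd_sem_eq)
  qed
  then show ?thesis using N by (auto simp: DEFICIT_def I_def aset_def V_def)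
qed

lemma sem_LARGE1:
  assumes "sol A H" "card A \<le> b" "expl p v N = (Q, X0)" "set Q \<subseteq> H" "card (set Q) = p" "v < n"
    "N < NN" "2 ^ (b * (D + 1) * D + b) \<le> NN"
  defines "\<sigma> \<equiv> \<lambda>i. (nxt H ^^ i) (set Q, {}, {})"
  assumes Xs: "Xs 0 = X0" "\<And>i. i < n \<Longrightarrow> Suc (Xs i) \<le> 2 ^ pot b H (\<sigma> i)"
    "\<And>i s. i < n \<Longrightarrow> srep NN (\<sigma> i) (Xs i) s \<Longrightarrow> Xs i < NN \<Longrightarrow> srep NN (\<sigma> (Suc i)) (Xs (Suc i)) (sem ROUND s)"
    and s: "wenv NN s" "fst s vS = v" "fst s vG = N"
  shows "fst (sem LARGE1 s) vAns = 1"
proof -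
  have w: "env s" "fst s vPl = p" "fst s vNN = NN" "fst s vN = n" using s(1) by (auto simp: wenv_def env_def)
  define s1 where "s1 = sem EXPL ((fst s)(vX := fst s vG), snd s)"
  have q1: "qrep Q X0 s1"
    using sem_EXPL[of "((fst s)(vX := fst s vG), snd s)" v N] w s assms(3,6,7) by (simp add: s1_def)
  have f1: "fst s1 y = fst s y" if "y \<notin> {vHalf, vZ, vX, vBit, vLen, vV, vT, vY}" for y using that by (simp add: s1_def)
  define s2 where "s2 = sem (CLEAR aSt) s1"
  have st: "aset n (snd s2 aSt) = {}" unfolding s2_def by (rule aset_CLEAR) (use f1 w in simp)
  have "wenv NN s2 = wenv NN s" by (rule wenv_cong) (auto simp: s2_def s1_def)
  then have r2: "srep NN (\<sigma> 0) (Xs 0) s2"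
    using s(1) q1 st by (auto simp: srep_def \<sigma>_def Xs(1) qrep_def s2_def aset_def)
  have bnd: "Xs i < NN" if "i < n" for i
  proof -
    have "Suc (Xs i) \<le> 2 ^ pot b H (\<sigma> i)" by (rule Xs(2)[OF that])
    also have "\<dots> \<le> 2 ^ (b * (D + 1) * D + b)" by (intro power_increasing pot_le[OF assms(1,2)]) simp
    finally show ?thesis using assms(8) by simp
  qed
  define s3 where "s3 = sem (For vRd vN ROUND) s2"
  have "srep NN (\<sigma> (fst s2 vN)) (Xs (fst s2 vN)) s3"
    unfolding s3_def
  proof (rule sem_For_inv[where I = "\<lambda>i. srep NN (\<sigma> i) (Xs i)"])
    show "srep NN (\<sigma> 0) (Xs 0) s2" by (rule r2)
  next
    fix i s' assume i: "i < fst s2 vN" "srep NN (\<sigma> i) (Xs i) s'"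
    have "i < n" using i(1) srepD(4)[OF r2] by simp
    moreover have "srep NN (\<sigma> i) (Xs i) ((fst s')(vRd := i), snd s')"
      by (rule srep_cong[OF i(2)]) (use srepD(2)[OF i(2)] in auto)
    ultimately show "srep NN (\<sigma> (Suc i)) (Xs (Suc i)) (sem ROUND ((fst s')(vRd := i), snd s'))"
      using Xs(3) bnd by blast
  qed
  then have r3: "srep NN (\<sigma> n) (Xs n) s3" using srepD(4)[OF r2] by simp
  have H: "H \<subseteq> {..<n}" "finite A" using assms(1) finite_subset_V[of H] finite_subset[of A H] by (auto simp: sol_def)
  have good: "good H (\<sigma> i) \<and> set Q \<subseteq> fst (\<sigma> i)" for i
  proof (induction i)
    case 0
    then show ?case using assms(4) by (simp add: \<sigma>_def good_def)
  next
    case (Suc i)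
    have "fst (\<sigma> i) \<subseteq> fst (nxt H (\<sigma> i))" by (cases "\<sigma> i") (auto simp: nxt_def advance_def)
    then show ?case using Suc good_nxt[of H "\<sigma> i"] by (auto simp: \<sigma>_def)
  qed
  obtain K F R where \<sigma>n: "\<sigma> n = (K, F, R)" by (cases "\<sigma> n")
  have cost: "cost H \<le> b"
    using cost_le_anchors[OF assms(1)] card_mono[OF H(2), of "{w \<in> A. all_in w \<le> k}"] assms(2) by auto
  define s4 where "s4 = sem (Sq BUILD MINCUT) s3"
  define V where "V = aset n (snd s4 aVis)"
  have opt: "least_opt K F V" unfolding V_def s4_def
    by (rule sem_opt[OF r3[unfolded \<sigma>n] good_feas[OF assms(1), of K F R] cost]) (use good[of n] \<sigma>n in simp)
  have "cand (K, F, R) = {}" unfolding \<sigma>n[symmetric] \<sigma>_def by (rule cand_exhausted)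
  then have res: "\<not> unresolved (K, F, R) u" if "u \<in> V" for u
    using that opt_eq[OF opt, of R] by (auto simp: cand_def)
  have g: "good H (K, F, R)" "set Q \<subseteq> K" using good[of n] \<sigma>n by auto
  note R = resolved_opt_sol[OF assms(1) g(1) opt res]
  have env4: "env s4" using srepD(1)[OF r3] unfolding s4_def by (subst env_sem) auto
  have "finite V" by (simp add: V_def)
  then have "p \<le> card V" using card_mono[of V "set Q"] R(3) g(2) assms(5) by auto
  then have "accepts b p {v \<in> V. indeg V v < k}" using R assms(2) by (auto simp: accepts_def)
  then have "accepts b p (aset n (snd (sem DEFICIT s4) aA))" using sem_DEFICIT[OF env4] by (simp add: V_def)
  moreover have "env (sem DEFICIT s4)" using env4 by (subst env_sem) auto
  moreover have "sem LARGE1 s = sem VER (sem DEFICIT s4)" by (simp add: LARGE1_def s4_def s3_def s2_def s1_def)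
  ultimately show ?thesis by (simp add: sem_VER)
qed

lemma sound_LARGE1: "sound LARGE1"
  unfolding LARGE1_def by (intro sound_Sq sound_VER sound_For sound_frame) auto

lemma sound_LARGE: "sound LARGE"
  unfolding LARGE_def by (intro sound_For sound_LARGE1) auto

lemma sem_LARGE:
  assumes "wenv NN s" "0 < p" "sol A H" "card A \<le> b" "v \<in> H" "p \<le> card (component H v)"
    "2 ^ (b * (D + 1) * D + b + p * (D - 1)) \<le> NN"
  shows "fst (sem LARGE s) vAns = 1"
proof -
  have H: "H \<subseteq> {..<n}" using assms(3) by (simp add: sol_def)
  have vn: "v < n" using assms(5) H by auto
  have s: "env s" "fst s vN = n" "fst s vNN = NN" using assms(1) by (auto simp: wenv_def env_def)
  have mvL: "mv LARGE1 = {vX, vV, vT, vHalf, vZ, vBit, vLen, vY, vI1, vI2, vCv, vTs, vRr, vCur, vPr, vAug, vFu, vR, vRd, vC, vU, vSz, vAsz, vAns}"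
    by (simp add: LARGE1_def) auto
  have maL: "ma LARGE1 = {aQ, aInq, aSt, aCap, aVis, aPar, aA, aH}" by (simp add: LARGE1_def) auto
  let ?E = "b * (D + 1) * D + b"
  have pow: "2 ^ ?E \<le> NN" using assms(7) by (rule order_trans[rotated]) (intro power_increasing; simp)
  obtain Q where Q: "\<And>X'. \<exists>X. expl p v X = (Q, X') \<and> X < Suc X' * 2 ^ (p * (D - 1))"
    "set Q \<subseteq> component H v" "length Q \<le> p" "card (set Q) = p \<or> set Q = component H v"
    using expl_component[OF assms(5) H assms(2)] by metis
  have QH: "set Q \<subseteq> H" using Q(2) component_subset[OF assms(5)] by simp
  have cQ: "card (set Q) = p" using Q(3,4) assms(6) card_length[of Q] by auto
  define \<sigma> where "\<sigma> i = (nxt H ^^ i) (set Q, {}, {})" for i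
  have good: "good H (\<sigma> i)" for i
  proof (induction i)
    case 0
    then show ?case using QH by (simp add: \<sigma>_def good_def)
  qed (simp add: \<sigma>_def good_nxt)
  define P where "P i X X' \<longleftrightarrow> Suc X \<le> Suc X' * 2 ^ (pot b H (\<sigma> i) - pot b H (\<sigma> (Suc i)))
    \<and> (\<forall>s. srep NN (\<sigma> i) X s \<longrightarrow> X < NN \<longrightarrow> srep NN (\<sigma> (Suc i)) X' (sem ROUND s))" for i X X'
  have "\<exists>X. P i X X'" for i X'
    using sem_ROUND[OF assms(3,4) good[of i], of X' NN] by (simp add: P_def \<sigma>_def)
  then obtain Xs where Xs: "Xs n = 0" "\<And>i. i < n \<Longrightarrow> P i (Xs i) (Xs (Suc i))"
    using backward_choice[of n P 0] by blast
  have bnd: "Suc (Xs i) \<le> 2 ^ pot b H (\<sigma> i)" if "i \<le> n" for i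
    using that
  proof (induction "n - i" arbitrary: i)
    case 0
    then show ?case using Xs(1) by simp
  next
    case (Suc m)
    then have i: "i < n" "m = n - Suc i" by auto
    have le: "pot b H (\<sigma> (Suc i)) \<le> pot b H (\<sigma> i)"
      using pot_nxt_le[OF assms(3,4) good[of i]] by (simp add: \<sigma>_def)
    have "Suc (Xs i) \<le> Suc (Xs (Suc i)) * 2 ^ (pot b H (\<sigma> i) - pot b H (\<sigma> (Suc i)))"
      using Xs(2)[OF i(1)] by (simp add: P_def)
    also have "\<dots> \<le> 2 ^ pot b H (\<sigma> (Suc i)) * 2 ^ (pot b H (\<sigma> i) - pot b H (\<sigma> (Suc i)))"
      using Suc.hyps(1)[OF i(2)] i(1) by (intro mult_le_mono1) simp
    also have "\<dots> = 2 ^ pot b H (\<sigma> i)" using le by (simp add: power_add[symmetric])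
    finally show ?case .
  qed
  obtain N where N: "expl p v N = (Q, Xs 0)" "N < Suc (Xs 0) * 2 ^ (p * (D - 1))" using Q(1) by blast
  have "Suc (Xs 0) \<le> 2 ^ pot b H (\<sigma> 0)" by (rule bnd) simp
  also have "\<dots> \<le> 2 ^ ?E" by (intro power_increasing pot_le[OF assms(3,4)]) simp
  \<comment> \<open>The search starts with \<open>Xs 0\<close>, the number that remains after the
    digits for \<open>Q\<close>; the two bit counts add up.\<close>
  finally have "N < 2 ^ ?E * 2 ^ (p * (D - 1))" using N(2) by (meson less_le_trans mult_le_mono1)
  then have NN: "N < NN" using assms(7) by (simp add: power_add)
  show ?thesis unfolding LARGE_def
  proof (rule sem_For_hit[OF _ _ s(1), where j = v])
    show "sound (For vG vNN LARGE1)" by (intro sound_For sound_LARGE1) auto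
    show "v < fst s vN" using vn s(2) by simp
    fix s1 assume s1: "env s1" "\<And>y. y \<noteq> vS \<Longrightarrow> y \<notin> mv (For vG vNN LARGE1) \<Longrightarrow> fst s1 y = fst s y"
      "\<And>a. a \<notin> ma (For vG vNN LARGE1) \<Longrightarrow> snd s1 a = snd s a" "fst s1 vS = v"
    show "fst (sem (For vG vNN LARGE1) s1) vAns = 1"
    proof (rule sem_For_hit[OF sound_LARGE1 _ s1(1), where j = N])
      show "N < fst s1 vNN" using s1(2) NN s(3) by (simp add: mvL)
      fix s2 assume s2: "env s2" "\<And>y. y \<noteq> vG \<Longrightarrow> y \<notin> mv LARGE1 \<Longrightarrow> fst s2 y = fst s1 y"
        "\<And>a. a \<notin> ma LARGE1 \<Longrightarrow> snd s2 a = snd s1 a" "fst s2 vG = N"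
      have "wenv NN s2 = wenv NN s"
        by (rule wenv_cong) (use s1(2,3) s2(2,3) in \<open>auto simp: mvL maL\<close>)
      then have w: "wenv NN s2" using assms(1) by simp
      have "fst s2 vS = v" using s2(2)[of vS] s1(4) by (simp add: mvL)
      then show "fst (sem LARGE1 s2) vAns = 1"
        using Xs(2) bnd unfolding P_def \<sigma>_def
        by (intro sem_LARGE1[OF assms(3,4) N(1) QH cQ vn NN pow _ _ _ w _ s2(4), of Xs]) (auto simp: less_imp_le)
    qed auto
  qed auto
qed

end


section \<open>Input layout, size of the guess space and assembly of the algorithm\<close>

section \<open>The complete machine program\<close>

subsection \<open>Copying the input into the array area\<close>

text \<open>The array area begins right behind the input, in memory that is still zero. Its start
  \<open>n * n + 4\<close> is found by repeated addition, and the input is copied there with stride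
  16 as array 0.\<close>

definition INIT :: ram where
  "INIT = Seq (Const 1 0) (Seq (Load 3 1) (Seq (Copy 5 3) (Seq (Const 7 1)
     (Seq (WhileNZ 5 (Seq (Add 0 0 3) (Sub 5 5 7)))
     (Seq (Const 5 4) (Seq (Add 0 0 5) (Seq (Copy 5 0) (Seq (Const 9 0) (Seq (Copy 11 0) (Seq (Const 13 16)
     (WhileNZ 5 (Seq (Load 15 9) (Seq (Store 11 15) (Seq (Add 9 9 7) (Seq (Add 11 11 13) (Sub 5 5 7))))))))))))))))"

definition start :: "nat list \<Rightarrow> st" where
  "start xs = ((\<lambda>_. 0), (\<lambda>a i. if a = 0 \<and> i < length xs then xs ! i else 0))"

lemma exec_INIT:
  assumes "length xs = n * n + 4" "xs ! 0 = n"
  shows "\<exists>t \<sigma>. exec INIT (init_state xs) t \<sigma> \<and> rep (start xs) (n * n + 4) \<sigma> \<and> t \<le> 6 * (n * n + 4) + 3 * n + 12"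
proof -
  define L where "L = n * n + 4"
  define M where "M = snd (init_state xs)"
  have M: "M a = (if a < L then xs ! a else 0)" for a using assms(1) by (simp add: M_def init_state_def L_def)
  define R1 where "R1 = (\<lambda>_ :: nat. 0 :: nat)(1 := 0, 3 := n, 5 := n, 7 := 1)"
  define I where "I i \<sigma> \<longleftrightarrow> snd \<sigma> = M \<and> fst \<sigma> 0 = i * n \<and> fst \<sigma> 3 = n \<and> fst \<sigma> 5 = n - i \<and> fst \<sigma> 7 = 1
    \<and> (\<forall>x. fst \<sigma> (2 * x + 2) = 0)" for i and \<sigma> :: ram_state
  have "\<exists>t \<sigma>. exec (WhileNZ 5 (Seq (Add 0 0 3) (Sub 5 5 7))) (R1, M) t \<sigma> \<and> I n \<sigma> \<and> t \<le> n * (2 + 1) + 1"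
  proof (rule exec_while_count)
    have odd: "2 * x + 2 \<noteq> (2 * y + 1 :: nat)" for x y by presburger
    show "I 0 (R1, M)" using odd[of _ 0] odd[of _ 1] odd[of _ 2] odd[of _ 3] by (simp add: I_def R1_def)
  next
    fix i and \<sigma> :: ram_state assume i: "i < n" "I i \<sigma>"
    obtain Ra Ma where \<sigma>: "\<sigma> = (Ra, Ma)" by (cases \<sigma>)
    have E: "exec (Seq (Add 0 0 3) (Sub 5 5 7)) \<sigma> (1 + 1) ((Ra(0 := Ra 0 + Ra 3))(5 := (Ra(0 := Ra 0 + Ra 3)) 5 - (Ra(0 := Ra 0 + Ra 3)) 7), Ma)"
      unfolding \<sigma> by (rule exec.Seq[OF exec.Add exec.Sub])
    have odd: "2 * x + 2 \<noteq> (5 :: nat)" for x by presburger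
    have "I (Suc i) ((Ra(0 := Ra 0 + Ra 3))(5 := (Ra(0 := Ra 0 + Ra 3)) 5 - (Ra(0 := Ra 0 + Ra 3)) 7), Ma)"
      using i odd by (simp add: I_def \<sigma>)
    moreover have "fst \<sigma> 5 \<noteq> 0" using i by (simp add: I_def)
    ultimately show "fst \<sigma> 5 \<noteq> 0 \<and> (\<exists>t \<sigma>'. exec (Seq (Add 0 0 3) (Sub 5 5 7)) \<sigma> t \<sigma>' \<and> I (Suc i) \<sigma>' \<and> t \<le> 2)"
      using E by (metis one_add_one order_refl)
  qed (simp add: I_def)
  then obtain t1 R2 where 1: "exec (WhileNZ 5 (Seq (Add 0 0 3) (Sub 5 5 7))) (R1, M) t1 (R2, M)" "I n (R2, M)" "t1 \<le> 3 * n + 1"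
    by (auto simp: I_def)
  define R3 where "R3 = R2(5 := L, 0 := L, 9 := 0, 11 := L, 13 := 16)"
  let ?B = "Seq (Load 15 9) (Seq (Store 11 15) (Seq (Add 9 9 7) (Seq (Add 11 11 13) (Sub 5 5 7))))"
  define J where "J i \<sigma> \<longleftrightarrow> fst \<sigma> 0 = L \<and> fst \<sigma> 5 = L - i \<and> fst \<sigma> 7 = 1 \<and> fst \<sigma> 9 = i \<and> fst \<sigma> 11 = L + 16 * i
    \<and> fst \<sigma> 13 = 16 \<and> (\<forall>x. fst \<sigma> (2 * x + 2) = 0)
    \<and> (\<forall>a<L. snd \<sigma> a = xs ! a) \<and> (\<forall>j a. a < 16 \<longrightarrow> snd \<sigma> (L + 16 * j + a) = (if a = 0 \<and> j < i then xs ! j else 0))"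
    for i and \<sigma> :: ram_state
  have odd: "2 * x + 2 \<noteq> (2 * y + 1 :: nat)" for x y by presburger
  note odds = odd[of _ 2, simplified] odd[of _ 4, simplified] odd[of _ 5, simplified] odd[of _ 6, simplified] odd[of _ 7, simplified]
  have "\<exists>t \<sigma>. exec (WhileNZ 5 ?B) (R3, M) t \<sigma> \<and> J L \<sigma> \<and> t \<le> L * (5 + 1) + 1"
  proof (rule exec_while_count)
    show "J 0 (R3, M)" using 1(2) odds by (simp add: J_def R3_def I_def M)
  next
    fix i and \<sigma> :: ram_state assume i: "i < L" "J i \<sigma>"
    obtain Ra Ma where \<sigma>: "\<sigma> = (Ra, Ma)" by (cases \<sigma>)
    let ?R1 = "Ra(15 := Ma (Ra 9))"
    let ?R2 = "?R1(9 := ?R1 9 + ?R1 7)"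
    let ?R3 = "?R2(11 := ?R2 11 + ?R2 13)"
    let ?R4 = "?R3(5 := ?R3 5 - ?R3 7)"
    let ?M = "Ma(?R1 11 := ?R1 15)"
    have E: "exec ?B \<sigma> (1 + (1 + (1 + (1 + 1)))) (?R4, ?M)"
      unfolding \<sigma> by (rule exec.Seq[OF exec.Load exec.Seq[OF exec.Store exec.Seq[OF exec.Add exec.Seq[OF exec.Add exec.Sub]]]])
    have inj: "L + 16 * j + a = L + 16 * i \<longleftrightarrow> j = i \<and> a = 0" if "a < 16" for j a
    proof -
      have "a = 0" if "16 * j + a = 16 * i"
      proof -
        have "a = (16 * j + a) mod 16" using \<open>a < 16\<close> by simp
        then show ?thesis using that by simp
      qed
      then show ?thesis by auto
    qed
    have j: "Ra 0 = L" "Ra 5 = L - i" "Ra 7 = 1" "Ra 9 = i" "Ra 11 = L + 16 * i" "Ra 13 = 16"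
      "\<And>x. Ra (2 * x + 2) = 0" "\<And>a. a < L \<Longrightarrow> Ma a = xs ! a"
      "\<And>j a. a < 16 \<Longrightarrow> Ma (L + 16 * j + a) = (if a = 0 \<and> j < i then xs ! j else 0)"
      using i(2) unfolding J_def \<sigma> fst_conv snd_conv by blast+
    have m: "?M = Ma(L + 16 * i := xs ! i)" using j i(1) by simp
    have "?M (L + 16 * j' + a) = (if a = 0 \<and> j' < Suc i then xs ! j' else 0)" if "a < 16" for j' a
      using j(9)[OF that, of j'] inj[OF that, of j'] unfolding m by (auto simp: less_Suc_eq)
    moreover have "?M a = xs ! a" if "a < L" for a using j(8)[OF that] that unfolding m by simp
    moreover have "?R4 (2 * x + 2) = 0" for x using j(7)[of x] odds[of x] by simp
    moreover have "?R4 0 = L" "?R4 5 = L - Suc i" "?R4 7 = 1" "?R4 9 = Suc i" "?R4 11 = L + 16 * Suc i" "?R4 13 = 16"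
      using j i(1) by simp_all
    ultimately have "J (Suc i) (?R4, ?M)" unfolding J_def fst_conv snd_conv by blast
    moreover have "fst \<sigma> 5 \<noteq> 0" using i by (simp add: J_def)
    moreover have "1 + (1 + (1 + (1 + 1))) \<le> (5 :: nat)" by simp
    ultimately show "fst \<sigma> 5 \<noteq> 0 \<and> (\<exists>t \<sigma>'. exec ?B \<sigma> t \<sigma>' \<and> J (Suc i) \<sigma>' \<and> t \<le> 5)"
      using E by blast
  qed (simp add: J_def)
  then obtain t2 \<sigma> where 2: "exec (WhileNZ 5 ?B) (R3, M) t2 \<sigma>" "J L \<sigma>" "t2 \<le> 6 * L + 1" by auto
  have R2: "R2 0 = n * n" using 1(2) by (simp add: I_def)
  have "exec INIT (init_state xs) (1 + (1 + (1 + (1 + (t1 + (1 + (1 + (1 + (1 + (1 + (1 + t2))))))))))) \<sigma>"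
    unfolding INIT_def init_state_def
    apply (rule exec.Seq, rule exec.Const, rule exec.Seq, rule exec.Load, rule exec.Seq, rule exec.Copy,
        rule exec.Seq, rule exec.Const, rule exec.Seq)
     apply (rule back_subst[of "\<lambda>z. exec _ z _ _", OF 1(1)])
    subgoal using assms M[of 0] by (auto simp: R1_def M_def init_state_def fun_eq_iff L_def)
    apply (rule exec.Seq, rule exec.Const, rule exec.Seq, rule exec.Add, rule exec.Seq, rule exec.Copy,
        rule exec.Seq, rule exec.Const, rule exec.Seq, rule exec.Copy, rule exec.Seq, rule exec.Const)
    apply (rule back_subst[of "\<lambda>z. exec _ z _ _", OF 2(1)])
    using R2 by (auto simp: R3_def fun_eq_iff L_def)
  moreover have "rep (start xs) L \<sigma>"
    using 2(2) assms(1) by (auto simp: rep_def J_def start_def L_def)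
  ultimately show ?thesis using 1(3) 2(3) unfolding L_def
    by (intro exI[of _ "1 + (1 + (1 + (1 + (t1 + (1 + (1 + (1 + (1 + (1 + (1 + t2))))))))))"] exI[of _ \<sigma>]) auto
qed


subsection \<open>Preprocessing\<close>

definition PRE1 :: stm where
  "PRE1 = Sq (Asg vN (Arr 0 (Num 0))) (Sq (Asg vb (Arr 0 (Num 1))) (Sq (Asg vk (Arr 0 (Num 2))) (Asg vp (Arr 0 (Num 3)))))"

definition OUTDEG :: stm where
  "OUTDEG = For vU vN (Cond (Adj (Var vV) (Var vU)) (inc vC) Nop)"

definition DEGREES :: stm where
  "DEGREES = Sq (For vV vN (Wr aH (Var vV) (Num 1))) (Sq (Asg vD (Num 1)) (For vV vN
     (Sq (DEG aH vV) (Sq (Wr aDg (Var vV) (Var vC)) (Sq OUTDEG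
       (Cond (Le (Var vD) (Var vC)) (Asg vD (Plus (Var vC) (Num 1))) Nop))))))"

text \<open>Unless \<open>0 < b < p\<close>, the bounds \<open>vBl\<close> and \<open>vPl\<close>
  become 0 and only one guess remains. For \<open>b = 0\<close> the claimed time is polynomial
  however large \<open>p\<close> is, so \<open>p\<close> must not control a loop then.\<close>

definition PRE2 :: stm where
  "PRE2 = Sq DEGREES (Sq (Asg vSrc (Plus (Var vN) (Var vN))) (Sq (Asg vSnk (Plus (Var vSrc) (Num 1)))
     (Sq (Asg vW (Plus (Var vSrc) (Num 2))) (Sq (Asg vBl (Num 0)) (Sq (Asg vPl (Num 0))
     (Cond (And (Var vb) (Lt (Var vb) (Var vp))) (Sq (Asg vBl (Var vb)) (Asg vPl (Var vp))) Nop))))))"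

definition DBL :: "nat \<Rightarrow> stm" where
  "DBL x = Sq (Asg x (Plus (Var x) (Var x))) (Asg x (Plus (Var x) (Var x)))"

text \<open>Two \<open>DBL\<close> multiply by \<open>2 ^ 4\<close> and eight by
  \<open>2 ^ 16\<close>, so \<open>vNN\<close> becomes \<open>vB ^ (4 * b)\<close> if
  \<open>0 < b < p\<close>: four digits in base \<open>vB\<close> for each of \<open>b\<close>
  components.\<close>

definition PRE3 :: stm where
  "PRE3 = Sq (Asg vB (Num 1)) (Sq (For vI1 vD (For vI2 vD (For vRr vPl (Sq (DBL vB) (DBL vB)))))
     (Sq (Asg vNN (Num 1)) (For vAug vBl (For vI1 vD (For vI2 vD (For vRr vPl
       (Sq (Sq (Sq (DBL vNN) (DBL vNN)) (Sq (DBL vNN) (DBL vNN))) (Sq (Sq (DBL vNN) (DBL vNN)) (Sq (DBL vNN) (DBL vNN))))))))))"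

definition POST :: stm where
  "POST = Cond (Le (Var vp) (Var vb)) (Cond (Le (Var vp) (Var vN)) (Asg vAns (Num 1)) (Asg vAns (Num 0))) Nop"

lemma mv_pre [simp]:
  "mv OUTDEG = {vU, vC}" "mv DEGREES = {vV, vD, vU, vC}" "mv PRE2 = {vV, vD, vU, vC, vSrc, vSnk, vW, vBl, vPl}"
  "mv (DBL x) = {x}" "mv PRE3 = {vB, vNN, vI1, vI2, vRr, vAug}"
  by (simp_all add: OUTDEG_def DEGREES_def PRE2_def DBL_def PRE3_def, auto)

lemma ma_pre [simp]:
  "ma PRE1 = {}" "ma OUTDEG = {}" "ma DEGREES = {aH, aDg}" "ma PRE2 = {aH, aDg}" "ma (DBL x) = {}" "ma PRE3 = {}"
  by (simp_all add: PRE1_def OUTDEG_def DEGREES_def PRE2_def DBL_def PRE3_def insert_commute)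

lemma sem_For_scale:
  assumes "\<And>s. (\<And>y. y \<in> C \<Longrightarrow> fst s y = c y) \<Longrightarrow> fst (sem P s) x = fst s x * m" "y \<noteq> x" "l \<in> C" "mv P \<inter> C = {}" "y \<notin> C"
    "\<And>z. z \<in> C \<Longrightarrow> fst s z = c z"
  shows "fst (sem (For y l P) s) x = fst s x * m ^ c l"
proof -
  define I where "I i s' \<longleftrightarrow> fst s' x = fst s x * m ^ i" for i and s' :: st
  have "I (fst s l) (sem (For y l P) s)"
  proof (rule sem_For_inv)
    show "I 0 s" by (simp add: I_def)
  next
    fix i s' assume i: "I i s'" "\<And>z. z \<noteq> y \<Longrightarrow> z \<notin> mv P \<Longrightarrow> fst s' z = fst s z"
    have "fst (sem P ((fst s')(y := i), snd s')) x = fst ((fst s')(y := i), snd s') x * m"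
    proof (rule assms(1))
      fix z assume "z \<in> C"
      moreover from this have "z \<notin> mv P" "z \<noteq> y" using assms(4,5) by auto
      ultimately show "fst ((fst s')(y := i), snd s') z = c z" using i(2) assms(6) by simp
    qed
    then show "I (Suc i) (sem P ((fst s')(y := i), snd s'))" using i(1) assms(2) by (simp add: I_def)
  qed
  then show ?thesis using assms(3,6) by (simp add: I_def)
qed

lemma sem_DBL: "fst (sem (DBL x) s) x = 4 * fst s x"
  by (simp add: DBL_def)

lemma sem_PRE3:
  "fst (sem PRE3 s) vB = 2 ^ (4 * (fst s vD * fst s vD * fst s vPl))"
  "fst (sem PRE3 s) vNN = 2 ^ (16 * (fst s vBl * (fst s vD * fst s vD * fst s vPl)))"
proof -
  let ?C = "{vD, vPl, vBl}"
  let ?P1 = "Sq (DBL vB) (DBL vB)"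
  let ?P2 = "Sq (Sq (Sq (DBL vNN) (DBL vNN)) (Sq (DBL vNN) (DBL vNN))) (Sq (Sq (DBL vNN) (DBL vNN)) (Sq (DBL vNN) (DBL vNN)))"
  have a: "fst (sem (For vRr vPl ?P1) s) vB = fst s vB * 16 ^ c vPl" if "\<And>z. z \<in> ?C \<Longrightarrow> fst s z = c z" for s c
    by (rule sem_For_scale[where C = ?C]) (use that in \<open>auto simp: sem_DBL\<close>)
  have b: "fst (sem (For vI2 vD (For vRr vPl ?P1)) s) vB = fst s vB * (16 ^ c vPl) ^ c vD" if "\<And>z. z \<in> ?C \<Longrightarrow> fst s z = c z" for s c
    by (rule sem_For_scale[where C = ?C, OF a]) (use that in auto)
  have d: "fst (sem (For vI1 vD (For vI2 vD (For vRr vPl ?P1))) s) vB = fst s vB * ((16 ^ c vPl) ^ c vD) ^ c vD"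
    if "\<And>z. z \<in> ?C \<Longrightarrow> fst s z = c z" for s c
    by (rule sem_For_scale[where C = ?C, OF b]) (use that in auto)
  have a2: "fst (sem (For vRr vPl ?P2) s) vNN = fst s vNN * 65536 ^ c vPl" if "\<And>z. z \<in> ?C \<Longrightarrow> fst s z = c z" for s c
    by (rule sem_For_scale[where C = ?C]) (use that in \<open>auto simp: sem_DBL\<close>)
  have b2: "fst (sem (For vI2 vD (For vRr vPl ?P2)) s) vNN = fst s vNN * (65536 ^ c vPl) ^ c vD" if "\<And>z. z \<in> ?C \<Longrightarrow> fst s z = c z" for s c
    by (rule sem_For_scale[where C = ?C, OF a2]) (use that in auto)
  have d2: "fst (sem (For vI1 vD (For vI2 vD (For vRr vPl ?P2))) s) vNN = fst s vNN * ((65536 ^ c vPl) ^ c vD) ^ c vD"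
    if "\<And>z. z \<in> ?C \<Longrightarrow> fst s z = c z" for s c
    by (rule sem_For_scale[where C = ?C, OF b2]) (use that in auto)
  have e2: "fst (sem (For vAug vBl (For vI1 vD (For vI2 vD (For vRr vPl ?P2)))) s) vNN = fst s vNN * (((65536 ^ c vPl) ^ c vD) ^ c vD) ^ c vBl"
    if "\<And>z. z \<in> ?C \<Longrightarrow> fst s z = c z" for s c
    by (rule sem_For_scale[where C = ?C, OF d2]) (use that in auto)
  have p: "(16 :: nat) = 2 ^ 4" "(65536 :: nat) = 2 ^ 16" by simp_all
  define s1 where "s1 = ((fst s)(vB := 1), snd s)"
  define s2 where "s2 = sem (For vI1 vD (For vI2 vD (For vRr vPl ?P1))) s1"
  define s3 where "s3 = ((fst s2)(vNN := 1), snd s2)"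
  have c1: "fst s1 z = fst s z" "fst s3 z = fst s z" if "z \<in> ?C" for z
    using that by (auto simp: s1_def s2_def s3_def)
  have sem: "sem PRE3 s = sem (For vAug vBl (For vI1 vD (For vI2 vD (For vRr vPl ?P2)))) s3"
    by (simp add: PRE3_def s1_def s2_def s3_def)
  have "fst (sem PRE3 s) vB = fst s2 vB" unfolding sem by (simp add: s3_def)
  also have "\<dots> = fst s1 vB * ((16 ^ fst s vPl) ^ fst s vD) ^ fst s vD"
    unfolding s2_def by (rule d) (rule c1(1))
  also have "fst s1 vB = 1" by (simp add: s1_def)
  also have "1 * (((16 :: nat) ^ fst s vPl) ^ fst s vD) ^ fst s vD = ((16 ^ fst s vPl) ^ fst s vD) ^ fst s vD" by simp
  also have "\<dots> = 2 ^ (4 * (fst s vD * fst s vD * fst s vPl))"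
    unfolding p(1) power_mult[symmetric] by (simp add: ac_simps)
  finally show "fst (sem PRE3 s) vB = 2 ^ (4 * (fst s vD * fst s vD * fst s vPl))" .
  have "fst (sem PRE3 s) vNN = fst s3 vNN * (((65536 ^ fst s vPl) ^ fst s vD) ^ fst s vD) ^ fst s vBl"
    unfolding sem by (rule e2) (rule c1(2))
  also have "fst s3 vNN = 1" by (simp add: s3_def)
  also have "1 * ((((65536 :: nat) ^ fst s vPl) ^ fst s vD) ^ fst s vD) ^ fst s vBl = (((65536 ^ fst s vPl) ^ fst s vD) ^ fst s vD) ^ fst s vBl"
    by simp
  also have "\<dots> = 2 ^ (16 * (fst s vBl * (fst s vD * fst s vD * fst s vPl)))"
    unfolding p(2) power_mult[symmetric] by (simp add: ac_simps)
  finally show "fst (sem PRE3 s) vNN = 2 ^ (16 * (fst s vBl * (fst s vD * fst s vD * fst s vPl)))" .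
qed

context core_instance
begin

lemma sem_DEGREES:
  assumes "env s"
  shows "fst (sem DEGREES s) vD = Suc (Max (insert 0 ((\<lambda>v. card {u. E u v} + card {u. E v u}) ` {..<n})))"
    "\<And>v. v < n \<Longrightarrow> snd (sem DEGREES s) aDg v = all_in v"
proof -
  let ?d = "\<lambda>v. card {u. E u v} + card {u. E v u}"
  let ?P = "Sq (DEG aH vV) (Sq (Wr aDg (Var vV) (Var vC)) (Sq OUTDEG
       (Cond (Le (Var vD) (Var vC)) (Asg vD (Plus (Var vC) (Num 1))) Nop)))"
  define s1 where "s1 = sem (For vV vN (Wr aH (Var vV) (Num 1))) s"
  define I0 where "I0 i s' \<longleftrightarrow> (\<forall>v<i. snd s' aH v \<noteq> 0)" for i and s' :: st
  have "I0 (fst s vN) s1" unfolding s1_def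
    by (rule sem_For_inv) (auto simp: I0_def less_Suc_eq)
  then have H1: "aset n (snd s1 aH) = {..<n}" using envD(1)[OF assms] by (auto simp: I0_def aset_def)
  define s2 where "s2 = ((fst s1)(vD := 1), snd s1)"
  have env2: "env s2" using assms by (subst env_cong[of s2 s]) (auto simp: s2_def s1_def)
  define I where "I i s' \<longleftrightarrow> fst s' vD = Suc (Max (insert 0 (?d ` {..<i}))) \<and> (\<forall>v<i. snd s' aDg v = all_in v)" for i and s' :: st
  have N: "fst s2 vN = n" by (rule envD(1)[OF env2])
  have "I (fst s2 vN) (sem (For vV vN ?P) s2)"
  proof (rule sem_For_inv)
    show "I 0 s2" by (simp add: I_def s2_def)
  next
    fix i s' assume i: "i < fst s2 vN" "I i s'" "\<And>y. y \<noteq> vV \<Longrightarrow> y \<notin> mv ?P \<Longrightarrow> fst s' y = fst s2 y"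
      "\<And>a. a \<notin> ma ?P \<Longrightarrow> snd s' a = snd s2 a"
    have iN: "i < n" using i(1) N by simp
    define s3 where "s3 = sem (DEG aH vV) ((fst s')(vV := i), snd s')"
    have e': "env ((fst s')(vV := i), snd s')" by (subst env_cong[of _ s2]) (use i(3,4) env2 in auto)
    have C3: "fst s3 vC = all_in i" unfolding s3_def
      using sem_DEG[OF e', of vV aH] iN i(4) H1 by (simp add: s2_def)
    define s4 where "s4 = sem (Wr aDg (Var vV) (Var vC)) s3"
    have v4: "fst s4 vV = i" "fst s4 vC = all_in i" "fst s4 vD = fst s' vD" using C3 by (simp_all add: s4_def s3_def)
    have e4: "env s4" unfolding s4_def s3_def using e' by (subst env_cong) auto
    have a4: "snd s4 aDg = (snd s' aDg)(i := all_in i)" using C3 by (simp add: s4_def s3_def)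
    define s5 where "s5 = sem OUTDEG s4"
    define J where "J j s' \<longleftrightarrow> fst s' vC = all_in i + card {u. u < j \<and> E i u}" for j and s' :: st
    have "J (fst s4 vN) s5" unfolding s5_def OUTDEG_def
    proof (rule sem_For_inv)
      show "J 0 s4" using v4 by (simp add: J_def)
    next
      fix j s' assume j: "j < fst s4 vN" "J j s'"
        "\<And>y. y \<noteq> vU \<Longrightarrow> y \<notin> mv (Cond (Adj (Var vV) (Var vU)) (inc vC) Nop) \<Longrightarrow> fst s' y = fst s4 y"
        "\<And>a. a \<notin> ma (Cond (Adj (Var vV) (Var vU)) (inc vC) Nop) \<Longrightarrow> snd s' a = snd s4 a"
      have "env ((fst s')(vU := j), snd s')" by (subst env_cong[of _ s4]) (use j(3,4) e4 in auto)
      then have "tt (Adj (Var vV) (Var vU)) ((fst s')(vU := j), snd s') \<longleftrightarrow> E i j"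
        using tt_Adj[of "((fst s')(vU := j), snd s')" "Var vV" "Var vU"] j(1,3) v4 iN envD(1)[OF e4] by simp
      then show "J (Suc j) (sem (Cond (Adj (Var vV) (Var vU)) (inc vC) Nop) ((fst s')(vU := j), snd s'))"
        using j(2) by (simp add: J_def card_less_Suc_Collect)
    qed
    moreover have "{u. u < n \<and> E i u} = {u. E i u}" using E_less by auto
    ultimately have C5: "fst s5 vC = ?d i" using envD(1)[OF e4] by (simp add: J_def all_in_eq)
    have v5: "fst s5 vD = fst s' vD" "snd s5 aDg = (snd s' aDg)(i := all_in i)" using v4 a4 by (simp_all add: s5_def)
    have "Max (insert 0 (?d ` {..<Suc i})) = max (?d i) (Max (insert 0 (?d ` {..<i})))"
      by (subst lessThan_Suc, subst image_insert, subst insert_commute, rule Max_insert) auto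
    moreover have "sem ?P ((fst s')(vV := i), snd s') = sem (Cond (Le (Var vD) (Var vC)) (Asg vD (Plus (Var vC) (Num 1))) Nop) s5"
      by (simp add: s5_def s4_def s3_def)
    ultimately show "I (Suc i) (sem ?P ((fst s')(vV := i), snd s'))"
      using i(2) C5 v5 by (auto simp: I_def less_Suc_eq max_def)
  qed
  moreover have "sem DEGREES s = sem (For vV vN ?P) s2" by (simp add: DEGREES_def s2_def s1_def)
  ultimately show "fst (sem DEGREES s) vD = Suc (Max (insert 0 (?d ` {..<n})))"
    "\<And>v. v < n \<Longrightarrow> snd (sem DEGREES s) aDg v = all_in v" by (simp_all add: I_def N)
qed


lemma sem_PRE2:
  assumes "env s" "D = Suc (Max (insert 0 ((\<lambda>v. card {u. E u v} + card {u. E v u}) ` {..<n})))"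
  shows "env (sem PRE2 s)" "nnenv (sem PRE2 s)" "fst (sem PRE2 s) vD = D"
    "\<And>v. v < n \<Longrightarrow> snd (sem PRE2 s) aDg v = all_in v"
    "fst (sem PRE2 s) vBl = (if 0 < b \<and> b < p then b else 0)" "fst (sem PRE2 s) vPl = (if 0 < b \<and> b < p then p else 0)"
proof -
  define s1 where "s1 = sem DEGREES s"
  have v: "fst s1 vN = n" "fst s1 vb = b" "fst s1 vp = p" using envD[OF assms(1)] by (simp_all add: s1_def)
  show "env (sem PRE2 s)" using assms(1) by (subst env_sem) auto
  show "nnenv (sem PRE2 s)" using v by (simp add: PRE2_def nnenv_iff s1_def[symmetric])
  show "fst (sem PRE2 s) vD = D"
    using sem_DEGREES(1)[OF assms(1)] assms(2) by (simp add: PRE2_def)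
  show "snd (sem PRE2 s) aDg v = all_in v" if "v < n" for v
    using sem_DEGREES(2)[OF assms(1) that] by (simp add: PRE2_def)
  show "fst (sem PRE2 s) vBl = (if 0 < b \<and> b < p then b else 0)" "fst (sem PRE2 s) vPl = (if 0 < b \<and> b < p then p else 0)"
    using v by (simp_all add: PRE2_def s1_def[symmetric])
qed

text \<open>\<open>B\<close> exceeds the number of starting vertices within distance
  \<open>p\<close> of a solution with at most \<open>(b + 1) * p\<close> vertices, and bounds piece
  sizes and codes. The last bound makes room for the codes of large components.\<close>

lemma small_bounds:
  assumes "0 < b" "b < p" "0 < D"
  defines "B \<equiv> 2 ^ (4 * (D * D * p)) :: nat"
  shows "(b + 1) * p * D ^ p < B" "p \<le> B" "2 ^ (p * D) \<le> B"
    "2 ^ (b * (D + 1) * D + b + p * (D - 1)) \<le> (2 :: nat) ^ (16 * (b * (D * D * p)))"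
proof -
  have DD: "D \<le> D * D" "1 \<le> D * D" using assms(3) by (simp_all add: Suc_le_eq)
  have e: "p + p + D * p \<le> 4 * (D * D * p)"
  proof -
    have "p \<le> D * D * p" "D * p \<le> D * D * p" using DD mult_le_mono1[of _ _ p] by fastforce+
    then show ?thesis by linarith
  qed
  have "(b + 1) * p * D ^ p \<le> p * p * D ^ p" using assms(2) by (intro mult_le_mono1) simp
  also have "\<dots> < 2 ^ p * 2 ^ p * 2 ^ (D * p)"
  proof -
    have "p * p < 2 ^ p * (2 :: nat) ^ p" using less_exp[of p] by (intro mult_strict_mono) auto
    moreover have "D ^ p \<le> (2 ^ D) ^ p" by (intro power_mono) (simp_all add: less_imp_le)
    ultimately show ?thesis using assms(1-3) unfolding power_mult
      by (intro mult_less_le_imp_less) auto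
  qed
  also have "\<dots> = 2 ^ (p + p + D * p)" by (simp add: power_add)
  also have "\<dots> \<le> B" unfolding B_def by (intro power_increasing e) simp
  finally show "(b + 1) * p * D ^ p < B" .
  have "p \<le> 2 ^ p" by (simp add: less_imp_le)
  also have "(2 :: nat) ^ p \<le> B" unfolding B_def by (intro power_increasing) (use e assms(3) in auto)
  finally show "p \<le> B" .
  show "2 ^ (p * D) \<le> B" unfolding B_def by (intro power_increasing) (use e in \<open>auto simp: mult.commute\<close>)
  have "b * (D + 1) * D + b + p * (D - 1) \<le> 16 * (b * (D * D * p))"
  proof -
    have p: "1 \<le> p" using assms by simp
    have "b * (D * D) \<le> b * (D * D * p)" using p by simp
    moreover have "b * D \<le> b * (D * D)" "b \<le> b * (D * D)" using DD by (metis mult_le_mono2 mult_1_right)+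
    moreover have "p * (D - 1) \<le> p * (D * D)" using DD(1) by (intro mult_le_mono2) linarith
    moreover have "p * (D * D) \<le> b * (D * D * p)" using assms(1) by (simp add: mult.commute)
    moreover have "b * (D + 1) * D = b * (D * D) + b * D" by (simp add: algebra_simps)
    ultimately show ?thesis by linarith
  qed
  then show "2 ^ (b * (D + 1) * D + b + p * (D - 1)) \<le> (2 :: nat) ^ (16 * (b * (D * D * p)))"
    by (intro power_increasing) auto
qed

text \<open>For \<open>b = 0\<close> the empty set is the only candidate, and with no tuples to read
  any guess leaves \<open>aA\<close> empty.\<close>

lemma sem_SMALL_zero:
  assumes "env s" "fst s vBl = 0" "0 < fst s vNN" "accepts b p {}"
  shows "fst (sem SMALL s) vAns = 1"
  unfolding SMALL_def
proof (rule sem_For_hit[OF _ _ assms(1,3)])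
  let ?P = "Sq (DIGIT vI) (Sq (DIGIT vSi) (Sq (DIGIT vJ) (Sq (DIGIT vM) PICK)))"
  let ?Q = "Sq (CLEAR aA) (Sq (Asg vG1 (Var vG)) (Sq (For vIt vBl ?P) VER))"
  show "sound ?Q" by (intro sound_Sq sound_For sound_VER sound_frame) auto
  fix s' assume s': "env s'" "\<And>y. y \<noteq> vG \<Longrightarrow> y \<notin> mv ?Q \<Longrightarrow> fst s' y = fst s y"
  define s1 where "s1 = sem (Asg vG1 (Var vG)) (sem (CLEAR aA) s')"
  have env1: "env s1" using s'(1) unfolding s1_def by (subst env_sem; simp)+
  have A1: "aset n (snd s1 aA) = {}" using aset_CLEAR[OF envD(1)[OF s'(1)], of aA] by (simp add: s1_def)
  have "fst s1 vBl = 0" using s'(2)[of vBl] assms(2) by (simp add: s1_def)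
  then have "sem ?Q s' = sem VER s1" by (simp add: s1_def sem.simps(6))
  then show "fst (sem ?Q s') vAns = 1" using sem_VER[OF env1] A1 assms(4) by simp
qed auto

lemma sem_search:
  assumes "wenv NN s \<or> env s \<and> b = 0 \<and> fst s vBl = 0" "fst s vNN = NN" "fst s vB = B" "b < p" "fst s vAns = 0" "0 < D"
    "B = 2 ^ (4 * (D * D * p)) \<or> b = 0" "NN = 2 ^ (16 * (b * (D * D * p)))"
  shows "fst (sem (Sq SMALL LARGE) s) vAns = (if \<exists>A. accepts b p A then 1 else 0)"
proof -
  have env: "env s" using assms(1) by (auto simp: wenv_def)
  have snd': "sound (Sq SMALL LARGE)" by (intro sound_Sq sound_SMALL sound_LARGE)
  have small: "fst (sem (Sq SMALL LARGE) s) vAns = 1" if "fst (sem SMALL s) vAns = 1"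
  proof -
    have "env (sem SMALL s)" using sound_SMALL env unfolding sound_def by blast
    then have "fst (sem LARGE (sem SMALL s)) vAns = fst (sem SMALL s) vAns \<or> fst (sem LARGE (sem SMALL s)) vAns = 1"
      using sound_LARGE unfolding sound_def by blast
    with that show ?thesis by auto
  qed
  show ?thesis
  proof (cases "\<exists>A. accepts b p A")
    case False
    then show ?thesis using snd' env assms(5) unfolding sound_def by metis
  next
    case True
    then obtain A H where A: "card A \<le> b" "sol A H" "p \<le> card H" by (auto simp: accepts_def)
    have fin: "finite A" using A(2) finite_subset_V[of H] finite_subset[of A H] by (auto simp: sol_def)
    have "fst (sem (Sq SMALL LARGE) s) vAns = 1"
    proof (cases "b = 0")
      case b0: True
      then have "A = {}" using A(1) fin by simp
      then have acc: "accepts b p {}" using A by (auto simp: accepts_def)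
      have "fst s vBl = 0" using assms(1) b0 unfolding wenv_def by auto
      moreover have "0 < fst s vNN" using assms(2,8) by simp
      ultimately show ?thesis by (intro small sem_SMALL_zero env acc)
    next
      case False
      then have w: "wenv NN s" using assms(1) by simp
      have b: "0 < b" "0 < p" "fst s vPl = p" "fst s vBl = b" using False assms(4) w by (auto simp: wenv_def)
      have Beq: "B = 2 ^ (4 * (D * D * p))" using assms(7) False by simp
      note bnd = small_bounds[OF b(1) assms(4,6), folded Beq]
      have NB: "NN = B ^ (4 * b)" unfolding Beq assms(8) power_mult[symmetric] by (simp add: ac_simps)
      show ?thesis
      proof (cases "\<exists>v\<in>H. p \<le> card (component H v)")
        case True
        then obtain v where v: "v \<in> H" "p \<le> card (component H v)" by blast
        have "mv SMALL \<inter> {2, 3, 4, 5, 6, 9, 10, 35, 38, 39} = {}" "ma SMALL = {aA, aQ, aInq, aM, aH}"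
          by (simp_all add: SMALL_def insert_commute)
        then have "wenv NN (sem SMALL s) = wenv NN s" by (intro wenv_cong sem_frame_var sem_frame_arr) auto
        then have "fst (sem LARGE (sem SMALL s)) vAns = 1"
          using sem_LARGE[OF _ b(2) A(2,1) v] w bnd(4) assms(8) by auto
        then show ?thesis by simp
      next
        case cs: False
        have "\<exists>N < NN. accepts b p (\<Union>i<b. pick p (digs B (N div B ^ (4 * i))))"
        proof (cases "\<exists>Z. sol {} Z \<and> p \<le> card Z")
          case True
          then have "accepts b p {}" by (auto simp: accepts_def)
          \<comment> \<open>The guess 0 decodes to padding only and thereby tests the empty set of
            anchors.\<close>
          moreover have "(\<Union>i<b. pick p (digs B (0 div B ^ (4 * i)))) = {}" using pick_zero[OF b(2)] by (simp add: digs_def)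
          ultimately show ?thesis using assms(8) by (intro exI[of _ 0]) simp
        next
          case False
          obtain ds where ds: "length ds = b" "\<And>i s j M. (i, s, j, M) \<in> set ds \<Longrightarrow> i < B \<and> s < B \<and> j < B \<and> M < B"
            "accepts b p (\<Union>(pick p ` set ds))"
            by (rule small_components_picks[OF b(2) bnd(1-3) A(2,1,3)]) (use cs False in \<open>auto simp: not_le\<close>)
          have "0 < B" using bnd(1) by simp
          have "\<exists>N < B ^ (4 * length ds). \<forall>i < length ds. digs B (N div B ^ (4 * i)) = ds ! i"
            by (rule digs_exist[OF _ \<open>0 < B\<close>]) (rule ds(2))
          then obtain N where N: "N < B ^ (4 * b)" "\<And>i. i < b \<Longrightarrow> digs B (N div B ^ (4 * i)) = ds ! i"
            by (auto simp: ds(1))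
          have "(\<Union>i<b. pick p (digs B (N div B ^ (4 * i)))) = (\<Union>i<b. pick p (ds ! i))" using N(2) by simp
          also have "\<dots> = \<Union>(pick p ` set ds)" using ds(1) by (force simp: set_conv_nth)
          finally show ?thesis using N(1) ds(3) NB by (intro exI[of _ N]) simp
        qed
        then obtain N where N: "N < NN" "accepts b p (\<Union>i<b. pick p (digs B (N div B ^ (4 * i))))" by blast
        have "0 < B" using bnd(1) by simp
        show ?thesis
          by (rule small, rule sem_SMALL[OF env b(3,2,4) assms(3) \<open>0 < B\<close> _ N(2)]) (use N(1) assms(2) in simp)
      qed
    qed
    then show ?thesis using True by simp
  qed
qed

definition MAIN :: stm where
  "MAIN = Sq PRE2 (Sq PRE3 (Sq (Sq SMALL LARGE) POST))"

lemma accepts_trivial: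
  assumes "p \<le> b"
  shows "(\<exists>A. accepts b p A) \<longleftrightarrow> p \<le> n"
proof
  assume "\<exists>A. accepts b p A"
  then obtain A H where H: "sol A H" "p \<le> card H" by (auto simp: accepts_def)
  have "card H \<le> card {..<n}" using H(1) by (intro card_mono) (auto simp: sol_def)
  then show "p \<le> n" using H(2) by simp
next
  assume "p \<le> n"
  then have "sol {..<p} {..<p}" by (auto simp: sol_def)
  then show "\<exists>A. accepts b p A" using assms by (intro exI[of _ "{..<p}"]) (auto simp: accepts_def)
qed

lemma sem_MAIN:
  assumes "env s" "fst s vAns = 0"
    "D = Suc (Max (insert 0 ((\<lambda>v. card {u. E u v} + card {u. E v u}) ` {..<n})))"
  shows "fst (sem MAIN s) vAns = (if \<exists>A. accepts b p A then 1 else 0)"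
proof -
  define s2 where "s2 = sem PRE2 s"
  define s3 where "s3 = sem PRE3 s2"
  define s4 where "s4 = sem (Sq SMALL LARGE) s3"
  note P2 = sem_PRE2[OF assms(1,3), folded s2_def]
  note P3 = sem_PRE3[of s2, folded s3_def, unfolded P2(3,5,6)]
  have D: "0 < D" using assms(3) by simp
  have env3: "env s3" using P2(1) unfolding s3_def by (subst env_sem) auto
  have a0: "fst s3 vAns = 0" using assms(2) by (simp add: s3_def s2_def)
  have env4: "env s4"
    using env3 sound_Sq[OF sound_SMALL sound_LARGE] unfolding s4_def sound_def by blast
  have M: "sem MAIN s = sem POST s4" by (simp add: MAIN_def s4_def s3_def s2_def)
  show ?thesis
  proof (cases "p \<le> b")
    case True
    then show ?thesis using envD[OF env4] accepts_trivial unfolding M by (auto simp: POST_def)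
  next
    case False
    have "wenv (fst s3 vNN) s3 \<or> env s3 \<and> b = 0 \<and> fst s3 vBl = 0"
    proof (cases "b = 0")
      case True
      then show ?thesis using env3 P2(5) by (simp add: s3_def)
    next
      case b: False
      have "nnenv s3" using P2(2) by (simp add: nnenv_iff s3_def)
      moreover have "fst s3 vPl = p" "fst s3 vBl = b" using P2(5,6) b False by (simp_all add: s3_def)
      moreover have "snd s3 aDg = snd s2 aDg" by (simp add: s3_def)
      ultimately show ?thesis using env3 P2(4) by (simp add: wenv_def)
    qed
    then have "fst s4 vAns = (if \<exists>A. accepts b p A then 1 else 0)"
      unfolding s4_def
      by (rule sem_search[OF _ refl refl _ a0 D]) (use P3 False in auto)
    moreover have "sem POST s4 = s4" using False envD[OF env4] by (simp add: POST_def)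
    ultimately show ?thesis using M by simp
  qed
qed

end


section \<open>Time bounds for the staged machine program\<close>

subsection \<open>Running time\<close>

text \<open>Compiled in stages, because a stage must not assign the variables that control its own
  time, yet each stage computes those of the next. Register 2 holds \<open>vAns\<close>.\<close>

definition PROG :: ram where
  "PROG = Seq INIT (Seq (cst PRE1 0) (Seq (cst PRE2 0) (Seq (cst PRE3 0) (Seq (cst (Sq SMALL LARGE) 0)
     (Seq (cst POST 0) (Copy 0 2))))))"

lemmas routine_defs = DEG_def DEL_def COUNT_def VER_def POP_def DIGIT_def CLEAR_def ESTEP_def EXPL_def MARK_def
  VALID_def PICK_def SMALL_def VISIT_def REACH_def BACK_def AUG_def MINCUT_def CAPACITY_def BUILD_def FIND_def
  QUERY_def ROUND_def DEFICIT_def LARGE1_def LARGE_def OUTDEG_def DEGREES_def DBL_def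
  And_def Not_def Le_def Eq_def Lt_def Adj_def cell_def

lemma wfs_stages:
  "wfs {} PRE1" "wfs {vN} PRE2" "wfs {vBl, vPl, vD} PRE3" "wfs {vN, vBl, vPl, vNN, vW} (Sq SMALL LARGE)" "wfs {} POST"
  by (simp_all add: PRE1_def PRE2_def PRE3_def POST_def routine_defs)

definition WORK :: nat where
  "WORK = 40 + ws PRE1 + ws PRE2 + ws PRE3 + ws (Sq SMALL LARGE) + ws POST"

definition DEPTH :: nat where
  "DEPTH = 2 + dp PRE1 + dp PRE2 + dp PRE3 + dp (Sq SMALL LARGE) + dp POST"

context core_instance
begin

definition NN0 :: nat where
  "NN0 = (if 0 < b \<and> b < p then 2 ^ (16 * (b * (D * D * p))) else 1)"

lemma exec_PROG:
  assumes "length xs = n * n + 4" "xs ! 0 = n" "xs ! 1 = b" "xs ! 2 = k" "xs ! 3 = p"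
    "\<And>i j. i < n \<Longrightarrow> j < n \<Longrightarrow> xs ! (4 + (i * n + j)) \<noteq> 0 \<longleftrightarrow> E i j"
    "D = Suc (Max (insert 0 ((\<lambda>v. card {u. E u v} + card {u. E v u}) ` {..<n})))"
    "D \<le> 2 * n + 1"
  shows "\<exists>t \<sigma>. exec PROG (init_state xs) t \<sigma> \<and> fst \<sigma> 0 = (if \<exists>A. accepts b p A then 1 else 0)
     \<and> t \<le> WORK * (2 * n + 3 + NN0) ^ DEPTH"
proof -
  \<comment> \<open>One bound for the controlling variables of all stages; \<open>NN0\<close> is the
    final value of \<open>vNN\<close>.\<close>
  define Z where "Z = 2 * n + 2 + NN0"
  let ?L = "n * n + 4"
  define s0 where "s0 = start xs"
  define s1 where "s1 = sem PRE1 s0"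
  define s2 where "s2 = sem PRE2 s1"
  define s3 where "s3 = sem PRE3 s2"
  define s4 where "s4 = sem (Sq SMALL LARGE) s3"
  define s5 where "s5 = sem POST s4"
  have env1: "env s1"
  proof -
    have "4 + (i * n + j) < n * n + 4" if "i < n" "j < n" for i j
    proof -
      have "i * n + j < Suc i * n" using that by simp
      also have "\<dots> \<le> n * n" using that by (intro mult_le_mono1) simp
      finally show ?thesis by simp
    qed
    then show ?thesis using assms(1-6) by (auto simp: env_def s1_def s0_def PRE1_def start_def)
  qed
  have a1: "fst s1 vAns = 0" by (simp add: s1_def s0_def PRE1_def start_def)
  note P2 = sem_PRE2[OF env1 assms(7), folded s2_def]
  have D: "0 < D" using assms(7) by simp
  have N2: "fst s2 vN = n" by (rule envD(1)[OF P2(1)])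
  have "b * p \<le> NN0" if "0 < b" "b < p"
  proof -
    have "1 \<le> D * D" using D by (simp add: Suc_le_eq)
    then have "b * p \<le> 16 * (b * (D * D * p))" using mult_le_mono2[of 1 "D * D" "b * p"] by (simp add: ac_simps)
    also have "\<dots> < 2 ^ (16 * (b * (D * D * p)))" by (rule less_exp)
    finally show ?thesis using that by (simp add: NN0_def)
  qed
  then have bp: "fst s2 vBl \<le> NN0" "fst s2 vPl \<le> NN0"
    unfolding P2(5,6) by (auto intro: order_trans[rotated])
  have NN: "fst s3 vNN = NN0" unfolding s3_def sem_PRE3(2) P2(3,5,6) by (auto simp: NN0_def)
  have s3: "fst s3 vN = n" "fst s3 vBl = fst s2 vBl" "fst s3 vPl = fst s2 vPl" "fst s3 vW = 2 * n + 2"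
    using N2 P2(2) by (simp_all add: s3_def nnenv_iff)
  obtain t0 \<sigma>0 where 0: "exec INIT (init_state xs) t0 \<sigma>0" "rep s0 ?L \<sigma>0" "t0 \<le> 6 * (n * n + 4) + 3 * n + 12"
    using exec_INIT[OF assms(1,2)] unfolding s0_def by blast
  obtain t1 \<sigma>1 where 1: "exec (cst PRE1 0) \<sigma>0 t1 \<sigma>1" "rep s1 ?L \<sigma>1" "t1 \<le> ws PRE1 * (Z + 1) ^ dp PRE1"
    using exec_cst[OF 0(2) wfs_stages(1), of Z 0] unfolding s1_def by auto
  have "\<forall>x\<in>{vN}. fst s1 x \<le> Z" using envD(1)[OF env1] by (simp add: Z_def)
  from exec_cst[OF 1(2) wfs_stages(2) this, of 0]
  obtain t2 \<sigma>2 where 2: "exec (cst PRE2 0) \<sigma>1 t2 \<sigma>2" "rep s2 ?L \<sigma>2" "t2 \<le> ws PRE2 * (Z + 1) ^ dp PRE2"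
    unfolding s2_def by auto
  have "\<forall>x\<in>{vBl, vPl, vD}. fst s2 x \<le> Z" using bp P2(3) assms(8) by (simp add: Z_def)
  from exec_cst[OF 2(2) wfs_stages(3) this, of 0]
  obtain t3 \<sigma>3 where 3: "exec (cst PRE3 0) \<sigma>2 t3 \<sigma>3" "rep s3 ?L \<sigma>3" "t3 \<le> ws PRE3 * (Z + 1) ^ dp PRE3"
    unfolding s3_def by auto
  have "\<forall>x\<in>{vN, vBl, vPl, vNN, vW}. fst s3 x \<le> Z" using s3 bp NN by (simp add: Z_def)
  from exec_cst[OF 3(2) wfs_stages(4) this, of 0]
  obtain t4 \<sigma>4 where 4: "exec (cst (Sq SMALL LARGE) 0) \<sigma>3 t4 \<sigma>4" "rep s4 ?L \<sigma>4"
    "t4 \<le> ws (Sq SMALL LARGE) * (Z + 1) ^ dp (Sq SMALL LARGE)"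
    unfolding s4_def by blast
  obtain t5 \<sigma>5 where 5: "exec (cst POST 0) \<sigma>4 t5 \<sigma>5" "rep s5 ?L \<sigma>5" "t5 \<le> ws POST * (Z + 1) ^ dp POST"
    using exec_cst[OF 4(2) wfs_stages(5), of Z 0] unfolding s5_def by auto
  obtain R M where \<sigma>5: "\<sigma>5 = (R, M)" by (cases \<sigma>5)
  have "R 2 = fst s5 0" using 5(2) unfolding rep_def \<sigma>5 by (metis add_0 fst_conv mult_0_right)
  moreover have "s5 = sem MAIN s1" by (simp add: MAIN_def s5_def s4_def s3_def s2_def)
  ultimately have out: "R 2 = (if \<exists>A. accepts b p A then 1 else 0)" using sem_MAIN[OF env1 a1 assms(7)] by simp
  have "exec PROG (init_state xs) (t0 + (t1 + (t2 + (t3 + (t4 + (t5 + 1)))))) (R(0 := R 2), M)"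
    unfolding PROG_def
    by (rule exec.Seq[OF 0(1) exec.Seq[OF 1(1) exec.Seq[OF 2(1) exec.Seq[OF 3(1) exec.Seq[OF 4(1) exec.Seq[OF 5(1)[unfolded \<sigma>5] exec.Copy]]]]]])
  moreover have "t0 + (t1 + (t2 + (t3 + (t4 + (t5 + 1))))) \<le> WORK * (Z + 1) ^ DEPTH"
  proof -
    have up: "c * (Z + 1) ^ d \<le> c * (Z + 1) ^ DEPTH" if "d \<le> DEPTH" for c d
      by (intro mult_le_mono2 power_increasing that) simp
    have "t0 + 1 \<le> 40 * (Z + 1) ^ 2"
    proof -
      have "t0 + 1 \<le> 6 * (n * n) + 3 * n + 37" using 0(3) by simp
      also have "\<dots> \<le> 40 * (n + 1) ^ 2" by (simp add: power2_eq_square)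
      also have "\<dots> \<le> 40 * (Z + 1) ^ 2" by (intro mult_le_mono2 power_mono) (simp_all add: Z_def)
      finally show ?thesis .
    qed
    also have "\<dots> \<le> 40 * (Z + 1) ^ DEPTH" by (rule up) (simp add: DEPTH_def del: dp.simps)
    finally have "t0 + 1 \<le> 40 * (Z + 1) ^ DEPTH" .
    moreover have "t1 \<le> ws PRE1 * (Z + 1) ^ DEPTH" by (rule order_trans[OF 1(3) up]) (simp add: DEPTH_def del: dp.simps)
    moreover have "t2 \<le> ws PRE2 * (Z + 1) ^ DEPTH" by (rule order_trans[OF 2(3) up]) (simp add: DEPTH_def del: dp.simps)
    moreover have "t3 \<le> ws PRE3 * (Z + 1) ^ DEPTH" by (rule order_trans[OF 3(3) up]) (simp add: DEPTH_def del: dp.simps)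
    moreover have "t4 \<le> ws (Sq SMALL LARGE) * (Z + 1) ^ DEPTH" by (rule order_trans[OF 4(3) up]) (simp add: DEPTH_def del: dp.simps)
    moreover have "t5 \<le> ws POST * (Z + 1) ^ DEPTH" by (rule order_trans[OF 5(3) up]) (simp add: DEPTH_def del: dp.simps)
    ultimately show ?thesis unfolding WORK_def add_mult_distrib by linarith
  qed
  moreover have "Z + 1 = 2 * n + 3 + NN0" by (simp add: Z_def)
  moreover have "fst (R(0 := R 2), M) 0 = (if \<exists>A. accepts b p A then 1 else 0)" using out by simp
  ultimately show ?thesis by metis
qed

lemma time_bound:
  assumes "D \<le> 2 * \<Delta>"
  shows "WORK * (2 * n + 3 + NN0) ^ DEPTH
    \<le> WORK * 4 ^ DEPTH * 2 ^ (64 * DEPTH * (\<Delta>\<^sup>2 * (if 0 < b \<and> b < p then b * p else 0))) * (n + 1) ^ DEPTH"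
proof -
  let ?q = "if 0 < b \<and> b < p then b * p else 0"
  \<comment> \<open>The factor 64 is 16 times the 4 from
    \<open>D * D \<le> 4 * \<Delta> * \<Delta>\<close>.\<close>
  have "16 * (b * (D * D * p)) \<le> 64 * (\<Delta>\<^sup>2 * (b * p))"
  proof -
    have "D * D \<le> (2 * \<Delta>) * (2 * \<Delta>)" using assms by (intro mult_le_mono)
    then have "D * D * (b * p) \<le> 4 * \<Delta>\<^sup>2 * (b * p)" by (intro mult_le_mono1) (simp add: power2_eq_square)
    then show ?thesis by (simp add: ac_simps)
  qed
  then have NN: "NN0 \<le> 2 ^ (64 * (\<Delta>\<^sup>2 * ?q))" by (auto simp: NN0_def intro!: power_increasing)
  have "1 \<le> NN0" by (simp add: NN0_def)
  then have "2 * n + 3 + NN0 \<le> (2 * n + 3) * NN0 + NN0" by simp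
  also have "\<dots> \<le> 4 * (n + 1) * NN0" by (simp add: add_mult_distrib)
  also have "\<dots> \<le> 4 * (n + 1) * 2 ^ (64 * (\<Delta>\<^sup>2 * ?q))" using NN by (rule mult_le_mono2)
  finally have "(2 * n + 3 + NN0) ^ DEPTH \<le> (4 * (n + 1) * 2 ^ (64 * (\<Delta>\<^sup>2 * ?q))) ^ DEPTH" by (rule power_mono) simp
  also have "\<dots> = 4 ^ DEPTH * (n + 1) ^ DEPTH * 2 ^ (64 * DEPTH * (\<Delta>\<^sup>2 * ?q))"
    by (simp only: power_mult_distrib power_mult[symmetric] ac_simps)
  finally have "WORK * (2 * n + 3 + NN0) ^ DEPTH \<le> WORK * (4 ^ DEPTH * (n + 1) ^ DEPTH * 2 ^ (64 * DEPTH * (\<Delta>\<^sup>2 * ?q)))"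
    by (rule mult_le_mono2)
  then show ?thesis by (simp only: ac_simps)
qed

end


section \<open>Transfer to encoded digraphs and fixed-parameter tractability\<close>

section \<open>Correctness for encoded digraphs\<close>

lemma nth_concat_rows:
  assumes "i < m" "j < n"
  shows "concat (map (\<lambda>i. map (f i) [0..<n]) [0..<m]) ! (i * n + j) = f i j"
  using assms(1)
proof (induction m)
  case (Suc m)
  have len: "length (concat (map (\<lambda>i. map (f i) [0..<n]) [0..<m])) = m * n"
    by (induction m) simp_all
  show ?case
  proof (cases "i = m")
    case True
    then show ?thesis using assms(2) len by (simp add: nth_append)
  next
    case False
    then have "i < m" using Suc.prems by simp
    have "i * n + j < Suc i * n" using assms(2) by simp
    also have "\<dots> \<le> m * n" using \<open>i < m\<close> by (intro mult_le_mono1) simp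
    finally show ?thesis using Suc.IH[OF \<open>i < m\<close>] len by (simp add: nth_append)
  qed
qed simp

lemma length_core_input: "length (core_input G b k p) = card (pverts G) * card (pverts G) + 4"
proof -
  have "length (concat (map (\<lambda>i. map (f i) [0..<n]) [0..<m])) = m * n" for f :: "nat \<Rightarrow> nat \<Rightarrow> nat" and m n
    by (induction m) simp_all
  then show ?thesis by (simp add: core_input_def Let_def)
qed

lemma nth_core_input:
  fixes G :: "nat pair_pre_digraph"
  defines "n \<equiv> card (pverts G)"
  shows "core_input G b k p ! 0 = n" "core_input G b k p ! 1 = b" "core_input G b k p ! 2 = k" "core_input G b k p ! 3 = p"
    "i < n \<Longrightarrow> j < n \<Longrightarrow> core_input G b k p ! (4 + (i * n + j)) = (if (i, j) \<in> parcs G then 1 else 0)"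
proof -
  show "core_input G b k p ! 0 = n" "core_input G b k p ! 1 = b" "core_input G b k p ! 2 = k" "core_input G b k p ! 3 = p"
    by (simp_all add: core_input_def Let_def n_def numeral_eq_Suc)
  assume "i < n" "j < n"
  have "core_input G b k p = [n, b, k, p] @ concat (map (\<lambda>i. map (\<lambda>j. if (i, j) \<in> parcs G then 1 else 0) [0..<n]) [0..<n])"
    by (simp add: core_input_def Let_def n_def)
  then have "core_input G b k p ! (4 + (i * n + j)) =
      concat (map (\<lambda>i. map (\<lambda>j. if (i, j) \<in> parcs G then 1 else 0) [0..<n]) [0..<n]) ! (i * n + j)"
    by (simp add: nth_append)
  also have "\<dots> = (if (i, j) \<in> parcs G then 1 else 0)" by (rule nth_concat_rows) fact+
  finally show "core_input G b k p ! (4 + (i * n + j)) = (if (i, j) \<in> parcs G then 1 else 0)" .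
qed

lemma degrees_with_proj:
  "in_degree (with_proj G) v = card {u. (u, v) \<in> parcs G}"
  "out_degree (with_proj G) v = card {u. (v, u) \<in> parcs G}"
  "v \<in> H \<Longrightarrow> in_degree (with_proj G \<restriction> H) v = card {u \<in> H. (u, v) \<in> parcs G}"
proof -
  have "in_arcs (with_proj G) v = (\<lambda>u. (u, v)) ` {u. (u, v) \<in> parcs G}" by (auto simp: in_arcs_def)
  then show "in_degree (with_proj G) v = card {u. (u, v) \<in> parcs G}"
    by (simp add: in_degree_def card_image inj_on_def)
  have "out_arcs (with_proj G) v = (\<lambda>u. (v, u)) ` {u. (v, u) \<in> parcs G}" by (auto simp: out_arcs_def)
  then show "out_degree (with_proj G) v = card {u. (v, u) \<in> parcs G}"
    by (simp add: out_degree_def card_image inj_on_def)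
  assume "v \<in> H"
  then have "in_arcs (with_proj G \<restriction> H) v = (\<lambda>u. (u, v)) ` {u \<in> H. (u, v) \<in> parcs G}"
    by (auto simp: in_arcs_def induce_subgraph_def)
  then show "in_degree (with_proj G \<restriction> H) v = card {u \<in> H. (u, v) \<in> parcs G}"
    by (simp add: in_degree_def card_image inj_on_def)
qed

lemma core_instance_of_digraph:
  fixes G :: "nat pair_pre_digraph"
  assumes "input_digraph G" "max_degree (with_proj G) \<le> \<Delta>" "real \<Delta> / 2 \<le> real k"
  defines "n \<equiv> card (pverts G)" and "E \<equiv> \<lambda>u v. (u, v) \<in> parcs G"
  defines "D \<equiv> Suc (max_degree (with_proj G))"
  shows "core_instance n E k D"
    "D = Suc (Max (insert 0 ((\<lambda>v. card {u. E u v} + card {u. E v u}) ` {..<n})))" "D \<le> 2 * n + 1"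
    "has_anchored_core (with_proj G) b k p \<longleftrightarrow> (\<exists>A. loopfree_graph.accepts n E k b p A)"
proof -
  have G: "digraph (with_proj G)" "pverts G = {..<n}" using assms(1) by (simp_all add: input_digraph_def n_def)
  interpret digraph "with_proj G" by (rule G(1))
  have E_less: "u < n" "v < n" if "E u v" for u v
    using wellformed[of "(u, v)"] that G(2) by (auto simp: E_def)
  show D_eq: "D = Suc (Max (insert 0 ((\<lambda>v. card {u. E u v} + card {u. E v u}) ` {..<n})))"
    by (simp add: D_def max_degree_def degrees_with_proj E_def G(2))
  have deg: "card {u. E u v} + card {u. E v u} < D" if "v < n" for v
    unfolding D_eq less_Suc_eq_le by (rule Max_ge) (use that in auto)
  have "\<Delta> \<le> 2 * k" using assms(3) by linarith
  then have D_le: "D \<le> 2 * k + 1" using assms(2) by (simp add: D_def)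
  show inst: "core_instance n E k D"
    by unfold_locales (use E_less deg D_le in auto)
  interpret core_instance n E k D b p by (rule inst)
  have "card {u. E u v} + card {u. E v u} \<le> 2 * n" for v
  proof -
    have "{u. E u v} \<subseteq> {..<n}" "{u. E v u} \<subseteq> {..<n}" using E_less by auto
    then have "card {u. E u v} \<le> card {..<n}" "card {u. E v u} \<le> card {..<n}" by (intro card_mono; simp)+
    then show ?thesis by simp
  qed
  then show "D \<le> 2 * n + 1" unfolding D_eq by auto
  have "has_anchored_core (with_proj G) b k p \<longleftrightarrow> (\<exists>A H. sol A H \<and> card A \<le> b \<and> p \<le> card H)"
    unfolding has_anchored_core_def sol_def indeg_def
    by (auto simp: degrees_with_proj(3) G(2) E_def subset_iff)
  then show "has_anchored_core (with_proj G) b k p \<longleftrightarrow> (\<exists>A. accepts b p A)" by (auto simp: accepts_def)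
qed

lemma PROG_decides:
  assumes "0 < \<Delta>" "input_digraph G" "max_degree (with_proj G) \<le> \<Delta>" "real \<Delta> / 2 \<le> real k"
  shows "ram_decides_within PROG (core_input G b k p)
    (WORK * 4 ^ DEPTH * 2 ^ (64 * DEPTH * (\<Delta>\<^sup>2 * (if 0 < b \<and> b < p then b * p else 0))) * (card (pverts G) + 1) ^ DEPTH)
    (has_anchored_core (with_proj G) b k p)"
proof -
  define n where "n = card (pverts G)"
  define E where "E = (\<lambda>u v. (u, v) \<in> parcs G)"
  define D where "D = Suc (max_degree (with_proj G))"
  have inst: "core_instance n E k D"
    "D = Suc (Max (insert 0 ((\<lambda>v. card {u. E u v} + card {u. E v u}) ` {..<n})))" "D \<le> 2 * n + 1"
    "has_anchored_core (with_proj G) b k p \<longleftrightarrow> (\<exists>A. loopfree_graph.accepts n E k b p A)"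
    unfolding n_def E_def D_def by (rule core_instance_of_digraph[OF assms(2-4)])+
  interpret core_instance n E k D b p by (rule inst(1))
  have "D \<le> 2 * \<Delta>" using assms(1,3) by (simp add: D_def)
  note tb = time_bound[OF this]
  note nth = nth_core_input[where G = G and b = b and k = k and p = p, folded n_def]
  have "\<exists>t \<sigma>. exec PROG (init_state (core_input G b k p)) t \<sigma> \<and> fst \<sigma> 0 = (if \<exists>A. accepts b p A then 1 else 0)
     \<and> t \<le> WORK * (2 * n + 3 + NN0) ^ DEPTH"
    by (rule exec_PROG[OF _ nth(1-4) _ inst(2,3)]) (simp_all add: length_core_input nth(5) n_def[symmetric] E_def)
  then show ?thesis
    unfolding ram_decides_within_def ram_outputs_within_def inst(4) n_def[symmetric]
    using order_trans[OF _ tb] by blast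
qed

lemma ram_outputs_within_mono: "ram_outputs_within P xs T y \<Longrightarrow> T \<le> T' \<Longrightarrow> ram_outputs_within P xs T' y"
  unfolding ram_outputs_within_def by (blast intro: order_trans)

lemma exec_doubling:
  assumes "R 7 = 1" "i \<noteq> c" "i \<noteq> 7" "c \<noteq> 7"
  shows "\<exists>t R'. exec (WhileNZ c (Seq (Add i i i) (Sub c c 7))) (R, M) t (R', M)
    \<and> R' i = R i * 2 ^ R c \<and> R' 7 = 1 \<and> (\<forall>r. r \<noteq> i \<longrightarrow> r \<noteq> c \<longrightarrow> R' r = R r)"
proof -
  define m where "m = R c"
  define I where "I j \<sigma> \<longleftrightarrow> snd \<sigma> = M \<and> fst \<sigma> i = R i * 2 ^ j \<and> fst \<sigma> c = m - j \<and> (\<forall>r. r \<noteq> i \<longrightarrow> r \<noteq> c \<longrightarrow> fst \<sigma> r = R r)"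
    for j and \<sigma> :: ram_state
  have "\<exists>t \<sigma>. exec (WhileNZ c (Seq (Add i i i) (Sub c c 7))) (R, M) t \<sigma> \<and> I m \<sigma> \<and> t \<le> m * (2 + 1) + 1"
  proof (rule exec_while_count)
    show "I 0 (R, M)" by (simp add: I_def m_def)
  next
    fix j and \<sigma> :: ram_state assume j: "j < m" "I j \<sigma>"
    obtain Ra Ma where \<sigma>: "\<sigma> = (Ra, Ma)" by (cases \<sigma>)
    let ?R1 = "Ra(i := Ra i + Ra i)"
    let ?R2 = "?R1(c := ?R1 c - ?R1 7)"
    have E: "exec (Seq (Add i i i) (Sub c c 7)) \<sigma> (1 + 1) (?R2, Ma)"
      unfolding \<sigma> by (rule exec.Seq[OF exec.Add exec.Sub])
    have "Ra 7 = 1" using j(2) assms by (simp add: I_def \<sigma>)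
    then have "I (Suc j) (?R2, Ma)" using j assms by (simp add: I_def \<sigma>)
    moreover have "fst \<sigma> c \<noteq> 0" using j by (simp add: I_def)
    ultimately show "fst \<sigma> c \<noteq> 0 \<and> (\<exists>t \<sigma>'. exec (Seq (Add i i i) (Sub c c 7)) \<sigma> t \<sigma>' \<and> I (Suc j) \<sigma>' \<and> t \<le> 2)"
      using E by (metis one_add_one order_refl)
  qed (simp add: I_def)
  then obtain t \<sigma> where 1: "exec (WhileNZ c (Seq (Add i i i) (Sub c c 7))) (R, M) t \<sigma>" "I m \<sigma>" by blast
  obtain R' M' where "\<sigma> = (R', M')" by (cases \<sigma>)
  with 1 show ?thesis using assms by (intro exI[of _ t] exI[of _ R']) (simp add: I_def m_def)
qed

text \<open>A double exponential takes just two doubling loops on a machine without multiplication,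
  and it dominates the bound \<open>c * 2 ^ (c * q ^ 4)\<close> that the parameter requires.\<close>

lemma ram_computable_double_exp: "ram_computable (\<lambda>q. 2 ^ 2 ^ (4 * q + C))"
proof -
  define P where "P = Seq (Const 1 0) (Seq (Load 3 1) (Seq (Add 3 3 3) (Seq (Add 3 3 3) (Seq (Const 5 C) (Seq (Add 3 3 5)
    (Seq (Const 7 1) (Seq (Const 9 1) (Seq (WhileNZ 3 (Seq (Add 9 9 9) (Sub 3 3 7)))
    (Seq (Const 0 1) (WhileNZ 9 (Seq (Add 0 0 0) (Sub 9 9 7))))))))))))"
  have "\<exists>T. ram_outputs_within P [q] T (2 ^ 2 ^ (4 * q + C))" for q
  proof -
    define M where "M = snd (init_state [q])"
    define R1 where "R1 = (\<lambda>_ :: nat. 0 :: nat)(3 := 4 * q + C, 5 := C, 7 := 1, 9 := 1)"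
    have "\<exists>t R'. exec (WhileNZ 3 (Seq (Add 9 9 9) (Sub 3 3 7))) (R1, M) t (R', M)
      \<and> R' 9 = R1 9 * 2 ^ R1 3 \<and> R' 7 = 1 \<and> (\<forall>r. r \<noteq> 9 \<longrightarrow> r \<noteq> 3 \<longrightarrow> R' r = R1 r)"
      by (rule exec_doubling) (simp_all add: R1_def)
    then obtain t1 R2 where 1: "exec (WhileNZ 3 (Seq (Add 9 9 9) (Sub 3 3 7))) (R1, M) t1 (R2, M)"
      "R2 9 = 2 ^ (4 * q + C)" "R2 7 = 1" by (auto simp: R1_def)
    have "\<exists>t R'. exec (WhileNZ 9 (Seq (Add 0 0 0) (Sub 9 9 7))) (R2(0 := 1), M) t (R', M)
      \<and> R' 0 = (R2(0 := 1)) 0 * 2 ^ (R2(0 := 1)) 9 \<and> R' 7 = 1 \<and> (\<forall>r. r \<noteq> 0 \<longrightarrow> r \<noteq> 9 \<longrightarrow> R' r = (R2(0 := 1)) r)"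
      by (rule exec_doubling) (simp_all add: 1)
    then obtain t2 R3 where 2: "exec (WhileNZ 9 (Seq (Add 0 0 0) (Sub 9 9 7))) (R2(0 := 1), M) t2 (R3, M)"
      "R3 0 = 2 ^ 2 ^ (4 * q + C)" using 1(2) by auto
    have "exec P (init_state [q]) (1 + (1 + (1 + (1 + (1 + (1 + (1 + (1 + (t1 + (1 + t2)))))))))) (R3, M)"
      unfolding P_def init_state_def
      apply (rule exec.Seq, rule exec.Const, rule exec.Seq, rule exec.Load, rule exec.Seq, rule exec.Add,
          rule exec.Seq, rule exec.Add, rule exec.Seq, rule exec.Const, rule exec.Seq, rule exec.Add,
          rule exec.Seq, rule exec.Const, rule exec.Seq, rule exec.Const, rule exec.Seq)
       apply (rule back_subst[of "\<lambda>z. exec _ z _ _", OF 1(1)])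
      subgoal by (auto simp: R1_def M_def init_state_def fun_eq_iff)
      by (rule exec.Seq[OF exec.Const 2(1)])
    then show ?thesis unfolding ram_outputs_within_def using 2(2) by (metis fst_conv order_refl)
  qed
  then show ?thesis unfolding ram_computable_def by blast
qed

lemma double_exp_bound:
  assumes "e \<le> q ^ 4"
  shows "c * 2 ^ (c * e) \<le> (2 :: nat) ^ 2 ^ (4 * q + (c + 1))"
proof -
  have "c * 2 ^ (c * e) \<le> 2 ^ c * 2 ^ (c * e)" by (intro mult_le_mono1) (simp add: less_imp_le)
  also have "\<dots> = 2 ^ (c + c * e)" by (simp add: power_add)
  also have "\<dots> \<le> 2 ^ 2 ^ (4 * q + (c + 1))"
  proof (rule power_increasing)
    have "q ^ 4 \<le> (2 ^ q) ^ 4" by (intro power_mono) (simp_all add: less_imp_le)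
    then have "e \<le> 2 ^ (4 * q)" using assms by (simp add: power_mult[symmetric] mult.commute)
    then have "1 + e \<le> 2 * 2 ^ (4 * q)" using one_le_power[of "2 :: nat" "4 * q"] by linarith
    then have "c * (1 + e) \<le> 2 ^ c * (2 * 2 ^ (4 * q))" by (intro mult_le_mono) (simp_all add: less_imp_le)
    then show "c + c * e \<le> 2 ^ (4 * q + (c + 1))" by (simp add: power_add ac_simps)
  qed simp
  finally show ?thesis .
qed

theorem theorem4:
  shows
    "(\<exists>(P :: ram) (c :: nat). \<forall>(\<Delta> :: nat) > 0. \<forall>(G :: nat pair_pre_digraph) (b :: nat) (k :: nat) (p :: nat).
        input_digraph G \<longrightarrow> max_degree (with_proj G) \<le> \<Delta> \<longrightarrow> real k \<ge> real \<Delta> / 2 \<longrightarrow>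
        ram_decides_within P (core_input G b k p)
          (c * 2 ^ (c * (\<Delta> ^ 3 * b + \<Delta> ^ 2 * b * p)) * (card (verts (with_proj G)) + 1) ^ c)
          (has_anchored_core (with_proj G) b k p))
     \<and> fpt {(\<Delta> :: nat, G :: nat pair_pre_digraph, b :: nat, k :: nat, p :: nat).
              \<Delta> > 0 \<and> input_digraph G \<and> max_degree (with_proj G) \<le> \<Delta> \<and> real k \<ge> real \<Delta> / 2}
           (\<lambda>(\<Delta>, G, b, k, p). has_anchored_core (with_proj G) b k p)
           (\<lambda>(\<Delta>, G, b, k, p). core_input G b k p)
           (\<lambda>(\<Delta>, G, b, k, p). p + \<Delta>)"
proof -
  \<comment> \<open>One constant has to serve as factor, as coefficient in the exponent and as
    degree of the polynomial; the sum dominates all three.\<close>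
  define c where "c = WORK * 4 ^ DEPTH + 64 * DEPTH"
  have main: "ram_decides_within PROG (core_input G b k p) (c * 2 ^ (c * e) * m ^ c) (has_anchored_core (with_proj G) b k p)"
    if "0 < \<Delta>" "input_digraph G" "max_degree (with_proj G) \<le> \<Delta>" "real \<Delta> / 2 \<le> real k"
      "\<Delta>\<^sup>2 * (if 0 < b \<and> b < p then b * p else 0) \<le> e" "card (pverts G) + 1 \<le> m" for \<Delta> G b k p e m
  proof -
    let ?q = "\<Delta>\<^sup>2 * (if 0 < b \<and> b < p then b * p else 0)" and ?n = "card (pverts G)"
    have "WORK * 4 ^ DEPTH * 2 ^ (64 * DEPTH * ?q) * (?n + 1) ^ DEPTH \<le> c * 2 ^ (c * e) * m ^ c"
    proof (intro mult_le_mono)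
      show "WORK * 4 ^ DEPTH \<le> c" by (simp add: c_def)
      have "64 * DEPTH * ?q \<le> c * e" by (rule mult_le_mono[OF _ that(5)]) (simp add: c_def)
      then show "(2 :: nat) ^ (64 * DEPTH * ?q) \<le> 2 ^ (c * e)" by (rule power_increasing) simp
      have "(?n + 1) ^ DEPTH \<le> m ^ DEPTH" using that(6) by (rule power_mono) simp
      also have "\<dots> \<le> m ^ c" using that(6) by (intro power_increasing) (simp_all add: c_def)
      finally show "(?n + 1) ^ DEPTH \<le> m ^ c" .
    qed
    then show ?thesis
      using PROG_decides[OF that(1-4), of b p] ram_outputs_within_mono unfolding ram_decides_within_def by blast
  qed
  have "\<forall>\<Delta>>0. \<forall>G b k p. input_digraph G \<longrightarrow> max_degree (with_proj G) \<le> \<Delta> \<longrightarrow> real k \<ge> real \<Delta> / 2 \<longrightarrow>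
        ram_decides_within PROG (core_input G b k p)
          (c * 2 ^ (c * (\<Delta> ^ 3 * b + \<Delta> ^ 2 * b * p)) * (card (verts (with_proj G)) + 1) ^ c)
          (has_anchored_core (with_proj G) b k p)"
    by (intro allI impI main) (auto simp: mult.assoc)
  moreover have "fpt {(\<Delta>, G, b, k, p). \<Delta> > 0 \<and> input_digraph G \<and> max_degree (with_proj G) \<le> \<Delta> \<and> real k \<ge> real \<Delta> / 2}
           (\<lambda>(\<Delta>, G, b, k, p). has_anchored_core (with_proj G) b k p)
           (\<lambda>(\<Delta>, G, b, k, p). core_input G b k p) (\<lambda>(\<Delta>, G, b, k, p). p + \<Delta>)"
  proof -
    have "ram_decides_within PROG (core_input G b k p)
        (2 ^ 2 ^ (4 * (p + \<Delta>) + (c + 1)) * length (core_input G b k p) ^ c) (has_anchored_core (with_proj G) b k p)"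
      if "0 < \<Delta>" "input_digraph G" "max_degree (with_proj G) \<le> \<Delta>" "real \<Delta> / 2 \<le> real k" for \<Delta> G b k p
    proof -
      define e where "e = \<Delta>\<^sup>2 * (if 0 < b \<and> b < p then b * p else 0)"
      \<comment> \<open>The exponent is nonzero only for \<open>b < p\<close>, which is how
        \<open>b\<close> disappears from the parameter.\<close>
      have "e \<le> \<Delta> * \<Delta> * (p * p)" by (auto simp: e_def power2_eq_square intro!: mult_le_mono)
      also have "\<dots> \<le> (p + \<Delta>) * (p + \<Delta>) * ((p + \<Delta>) * (p + \<Delta>))" by (intro mult_le_mono) auto
      finally have "e \<le> (p + \<Delta>) ^ 4" by (simp add: power4_eq_xxxx mult.assoc)
      then have f: "c * 2 ^ (c * e) \<le> 2 ^ 2 ^ (4 * (p + \<Delta>) + (c + 1))" by (rule double_exp_bound)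
      have "card (pverts G) + 1 \<le> length (core_input G b k p)"
        using le_square[of "card (pverts G)"] unfolding length_core_input by linarith
      from main[OF that _ this, of b p e]
      have "ram_decides_within PROG (core_input G b k p) (c * 2 ^ (c * e) * length (core_input G b k p) ^ c)
        (has_anchored_core (with_proj G) b k p)" by (simp add: e_def)
      then show ?thesis
        using ram_outputs_within_mono mult_le_mono1[OF f] unfolding ram_decides_within_def by blast
    qed
    then show ?thesis
      unfolding fpt_def using ram_computable_double_exp[of "c + 1"]
      by (intro exI[of _ PROG] exI[of _ "\<lambda>q. 2 ^ 2 ^ (4 * q + (c + 1))"] exI[of _ c]) auto
  qed
  ultimately show ?thesis by blast
qed

end
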